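(* Suppose that $\mathbb{P}(\sum_{i=0}^{b-1}W_i=1)=1$, $\lim_{p\to\infty}\varphi_W(p)=0$, $\mathbb{P}(\#\{i:|W_i|=1\}=1)<1$, and that there exists $\gamma\in(0,1)$ such that, with probability 1, for each $0\le i\le b-1$ either $|W_i|\le\gamma$, or $|W_i|=1$ and $\big(\sum_{k=0}^{i-1}W_k,\sum_{k=0}^{i}W_k\big)\in\{(0,1),(1,0)\}$. Suppose also that the components of $W$ do not vanish (almost surely). Then, with probability 1, if the function $F_W$ can be decomposed as a monofractal function in multifractal time, $F_W=B\circ G$, where $G$ (the multifractal time) is a continuous increasing multifractal function on $[0,1]$ with $G(0)=0$ and $B$ is a continuous monofractal function on $[G(0),G(1)]$, then the Hölder exponent of $B$ is $0$, and $G$ must be such that $$\dim\big([0,1]\setminus\overline{E}_G(\infty)\big)=0,$$ where $$\overline{E}_G(\infty)=\Big\{t\in[0,1]:\ \limsup_{r\to0^+}\frac{\log(\mathrm{Osc}_G([t-r,t+r]))}{\log(r)}=\infty\Big\}.$$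
   Context: Fix an integer $b\ge 2$, let $\mathscr{A}=\{0,\dots,b-1\}$ and let $\mathscr{A}^*=\bigcup_{n\ge 0}\mathscr{A}^n$ be the set of finite words ($\mathscr{A}^0=\{\varnothing\}$). Let $W=(W_0,\dots,W_{b-1})$ be a $\mathbb{C}^b$-valued random vector with integrable components satisfying $\mathbb{E}\big(\sum_{i=0}^{b-1}W_i\big)=1$, and let $(W(w))_{w\in\mathscr{A}^*}$ be a family of independent copies of $W$. For $n\ge1$ and $t\in[0,1]$ define $$F_n(t)=\int_0^t b^n\prod_{k=1}^n W_{u_k}(u|k-1)\,\mathrm{d}u,$$ where a non $b$-adic point $u=\sum_{k\ge1}u_kb^{-k}$ is identified with the infinite word $u_1u_2\cdots$ of its $b$-adic digits, $u|k=u_1\cdots u_k$ and $u|0=\varnothing$. For $p\in\mathbb{R}_+$ let $\varphi_W(p)=-\log_b\mathbb{E}\big(\sum_{i=0}^{b-1}|W_i|^p\big)$. Under the hypotheses of the claim, $(F_n)$ converges almost surely uniformly on $[0,1]$ to a continuous limit denoted $F_W$. For a function $f$ on an interval, $\mathrm{Osc}_f(J)=\sup_{s,t}|f(t)-f(s)|$ over $s,t$ in $J$ intersected with the domain of $f$; $h_f(t)=\liminf_{r\to0^+}\frac{\log\mathrm{Osc}_f([t-r,t+r])}{\log r}$ is the Hölder exponent of $f$ at $t$, and $E_f(h)=\{t: h_f(t)=h\}$, $h\ge0$. The function $f$ is monofractal if there exists a unique $h\ge0$ such that $E_f(h)\ne\varnothing$ (this $h$ is then called its Hölder exponent); otherwise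 it is multifractal. $\dim$ denotes Hausdorff dimension. *)

theory Defs
  imports "HOL-Probability.Probability"
begin

section \<open>Complex multiplicative cascades\<close>

text \<open>A vector with \<open>b\<close> complex components is an element of the product space below, i.e. a
  function that is \<open>undefined\<close> outside \<open>{..<b}\<close>. Words over the alphabet \<open>{0, \<dots>, b - 1}\<close> are the
  elements of \<open>lists {..<b}\<close>.\<close>

abbreviation cvec_borel :: "nat \<Rightarrow> (nat \<Rightarrow> complex) measure" where
  "cvec_borel b \<equiv> PiM {..<b} (\<lambda>_. borel)"

definition independent_copies ::
  "'a measure \<Rightarrow> nat \<Rightarrow> ('a \<Rightarrow> nat \<Rightarrow> complex) \<Rightarrow> (nat list \<Rightarrow> 'a \<Rightarrow> nat \<Rightarrow> complex) \<Rightarrow> bool" where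
  "independent_copies M b W V \<longleftrightarrow>
     prob_space.indep_vars M (\<lambda>_. cvec_borel b) V (lists {..<b}) \<and>
     (\<forall>w\<in>lists {..<b}. distr M (cvec_borel b) (V w) = distr M (cvec_borel b) W)"

definition digit :: "nat \<Rightarrow> real \<Rightarrow> nat \<Rightarrow> nat" where
  "digit b u k = nat \<lfloor>u * real b ^ k\<rfloor> mod b"

definition digit_word :: "nat \<Rightarrow> real \<Rightarrow> nat \<Rightarrow> nat list" where
  "digit_word b u k = map (digit b u) [1..<Suc k]"

definition cascade ::
  "nat \<Rightarrow> (nat list \<Rightarrow> 'a \<Rightarrow> nat \<Rightarrow> complex) \<Rightarrow> nat \<Rightarrow> 'a \<Rightarrow> real \<Rightarrow> complex" where
  "cascade b V n \<omega> t =
     (CLINT u:{0..t}|lborel. of_nat b ^ n * (\<Prod>k=1..n. V (digit_word b u (k - 1)) \<omega> (digit b u k)))"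

definition cascade_limit ::
  "nat \<Rightarrow> (nat list \<Rightarrow> 'a \<Rightarrow> nat \<Rightarrow> complex) \<Rightarrow> 'a \<Rightarrow> real \<Rightarrow> complex" where
  "cascade_limit b V \<omega> t = lim (\<lambda>n. cascade b V n \<omega> t)"

text \<open>The logarithm with \<open>eln 0 = - \<infinity>\<close> and \<open>eln \<infinity> = \<infinity>\<close>, unlike \<open>ln 0 = 0\<close> on the reals.\<close>

definition eln :: "ennreal \<Rightarrow> ereal" where
  "eln x = (if x = 0 then - \<infinity> else if x = \<infinity> then \<infinity> else ereal (ln (enn2real x)))"

definition phi :: "'a measure \<Rightarrow> nat \<Rightarrow> ('a \<Rightarrow> nat \<Rightarrow> complex) \<Rightarrow> real \<Rightarrow> ereal" where
  "phi M b W p =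
     - (eln (\<integral>\<^sup>+\<omega>. ennreal (\<Sum>i<b. norm (W \<omega> i) powr p) \<partial>M) / ereal (ln (real b)))"


section \<open>Pointwise exponents\<close>

text \<open>In what follows \<open>D\<close> is the domain of the function \<open>f\<close>.\<close>

definition osc :: "real set \<Rightarrow> (real \<Rightarrow> 'b::metric_space) \<Rightarrow> real set \<Rightarrow> ennreal" where
  "osc D f J = (SUP (s, t) \<in> (J \<inter> D) \<times> (J \<inter> D). ennreal (dist (f s) (f t)))"

text \<open>Where \<open>f\<close> is locally constant the ratio is \<open>- \<infinity> / ln r = \<infinity>\<close> for small \<open>r\<close>.\<close>

definition log_osc_ratio ::
  "real set \<Rightarrow> (real \<Rightarrow> 'b::metric_space) \<Rightarrow> real \<Rightarrow> real \<Rightarrow> ereal" where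
  "log_osc_ratio D f t r = eln (osc D f {t - r..t + r}) / ereal (ln r)"

definition holder_exponent :: "real set \<Rightarrow> (real \<Rightarrow> 'b::metric_space) \<Rightarrow> real \<Rightarrow> ereal" where
  "holder_exponent D f t = Liminf (at_right 0) (log_osc_ratio D f t)"

definition holder_level_set ::
  "real set \<Rightarrow> (real \<Rightarrow> 'b::metric_space) \<Rightarrow> ereal \<Rightarrow> real set" where
  "holder_level_set D f h = {t \<in> D. holder_exponent D f t = h}"

definition upper_infinite_set :: "real set \<Rightarrow> (real \<Rightarrow> 'b::metric_space) \<Rightarrow> real set" where
  "upper_infinite_set D f = {t \<in> D. Limsup (at_right 0) (log_osc_ratio D f t) = \<infinity>}"

text \<open>The exponents \<open>h\<close> range over all possible values of \<^const>\<open>holder_exponent\<close>, that is, over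
  \<open>[0, \<infinity>]\<close>.\<close>

definition monofractal :: "real set \<Rightarrow> (real \<Rightarrow> 'b::metric_space) \<Rightarrow> bool" where
  "monofractal D f \<longleftrightarrow> (\<exists>!h. 0 \<le> h \<and> holder_level_set D f h \<noteq> {})"

definition monofractal_exponent :: "real set \<Rightarrow> (real \<Rightarrow> 'b::metric_space) \<Rightarrow> ereal" where
  "monofractal_exponent D f = (THE h. 0 \<le> h \<and> holder_level_set D f h \<noteq> {})"

definition multifractal :: "real set \<Rightarrow> (real \<Rightarrow> 'b::metric_space) \<Rightarrow> bool" where
  "multifractal D f \<longleftrightarrow> \<not> monofractal D f"


section \<open>Hausdorff dimension\<close>

definition hausdorff_premeasure :: "real \<Rightarrow> real \<Rightarrow> 'a::metric_space set \<Rightarrow> ennreal" where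
  "hausdorff_premeasure s \<delta> E =
     (INF U \<in> {U :: nat \<Rightarrow> 'a set. E \<subseteq> (\<Union>i. U i) \<and> (\<forall>i. bounded (U i) \<and> diameter (U i) \<le> \<delta>)}.
        \<Sum>i. ennreal (diameter (U i) powr s))"

definition hausdorff_measure :: "real \<Rightarrow> 'a::metric_space set \<Rightarrow> ennreal" where
  "hausdorff_measure s E = (SUP \<delta> \<in> {0<..}. hausdorff_premeasure s \<delta> E)"

text \<open>The infimum is over \<open>s > 0\<close> only, because \<open>0 powr 0 = 0\<close> makes \<^term>\<open>hausdorff_measure 0\<close>
  differ from the counting measure; this does not change its value.\<close>

definition hausdorff_dim :: "'a::metric_space set \<Rightarrow> ennreal" where
  "hausdorff_dim E = (INF s \<in> {s. 0 < s \<and> hausdorff_measure s E = 0}. ennreal s)"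

end

theory Submission
  imports Defs
begin

text \<open>
  Write \<open>F\<close> for the limit of the cascade, \<open>Q(w)\<close> for the product of the weights along the word \<open>w\<close>,
  and \<open>m(p)\<close> for the expectation of \<open>\<Sum>i<b. |W\<^sub>i|\<^sup>p\<close>. The weights at every node sum to one, so the cascade
  is eventually constant at each \<open>b\<close>-adic point, and the increment of \<open>F\<close> over the \<open>b\<close>-adic interval
  that is coded by \<open>w\<close> is exactly \<open>Q(w)\<close>. Weights of modulus one preserve or exchange the values 0
  and 1 at the two ends and all others are contractions, hence all partial sums stay within a fixed distance of \<open>1/2\<close>
  (\<open>centred_partial_sums_bounded\<close>). As \<open>F = B \<circ> G\<close> is continuous, this makes the oscillation of \<open>F\<close>
  over that interval comparable with \<open>|Q(w)|\<close> (\<open>cascade_adic_increments\<close>). Apart from this, only sums of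
  powers of \<open>|Q(w)|\<close> matter. Since \<open>\<phi>\<close> tends to 0, \<open>m(p)\<close> decreases to 1; it stays above 1, since
  \<open>m(p + 1) = m(p)\<close> would force \<open>|W\<^sub>i| = 1\<close> for all \<open>i\<close> and hence \<open>m(p) = b\<close> (\<open>moment_gt_one\<close>).

  The exponent of \<open>B\<close> is zero. If it were larger than \<open>1/p\<close>, then by Baire's theorem \<open>B\<close> would be
  uniformly \<open>1/p\<close>-Hoelder on the image of some \<open>b\<close>-adic interval, so that \<open>|F(s) - F(t)|\<^sup>p \<le> |G(s) - G(t)|\<close>
  there. Summation over the descendants of this interval would bound the sums of \<open>|Q(v)|\<^sup>p\<close> over all
  generations by the total growth of \<open>G\<close> (\<open>exponent_not_positive\<close>). These sums are a branching process with
  mean \<open>m(p)\<^sup>n\<close> and \<open>m(p) > 1\<close>. Its second moment is of the order of the squared mean, so it is large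
  with a probability bounded below; because boundedness at a node entails boundedness at its \<open>b\<close>
  independent children, it is almost surely unbounded (\<open>AE_unbounded_moments\<close>).

  The set has dimension zero. If the upper limit at \<open>t\<close> is finite, then \<open>G\<close> oscillates by at least \<open>r\<^sup>a\<close>
  on \<open>[t - r, t + r]\<close> for all small \<open>r\<close>. This growth may still be concentrated on one side of \<open>t\<close>, but points
  for which this happens to a large degree at infinitely many scales are forced to cluster and form a
  null set (\<open>flat_set_null\<close>). At the other points \<open>G\<close> grows at least like a power of \<open>r\<close> on
  both sides, and then the exponent zero of \<open>B\<close> at \<open>G(t)\<close> produces, for each \<open>\<epsilon>\<close>, infinitely many
  \<open>b\<close>-adic intervals near \<open>t\<close> of length \<open>r\<close> with \<open>|Q(w)| \<ge> r\<^sup>\<epsilon>\<close> up to a constant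
  (\<open>never_flat_large_increments\<close>). Markov's inequality, with \<open>m(p)\<close> close to one, shows that such
  intervals are too rare to support a positive dimension (\<open>large_increments_null\<close>).
\<close>

section \<open>Sets of Hausdorff dimension zero\<close>

text \<open>As \<open>s > 0\<close>, the mesh of the covers need not be controlled: each term of a small sum is small.\<close>

lemma hausdorff_measure_zeroI:
  assumes s: "s > 0"
    and cover: "\<And>\<eta>. \<eta> > 0 \<Longrightarrow> \<exists>U :: nat \<Rightarrow> 'a::metric_space set. E \<subseteq> (\<Union>i. U i) \<and>
      (\<forall>i. bounded (U i)) \<and> (\<Sum>i. ennreal (diameter (U i) powr s)) \<le> ennreal \<eta>"
  shows "hausdorff_measure s E = 0"
proof -
  have "hausdorff_premeasure s \<delta> E \<le> ennreal \<eta>" if \<delta>: "\<delta> > 0" and \<eta>: "\<eta> > 0" for \<delta> \<eta> :: real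
  proof -
    have pos: "min \<eta> (\<delta> powr s) > 0"
      using \<delta> \<eta> by simp
    obtain U :: "nat \<Rightarrow> 'a set" where U: "E \<subseteq> (\<Union>i. U i)" "\<And>i. bounded (U i)"
      and sum: "(\<Sum>i. ennreal (diameter (U i) powr s)) \<le> ennreal (min \<eta> (\<delta> powr s))"
      using cover[OF pos] by blast
    have "diameter (U i) \<le> \<delta>" for i
    proof -
      have "(\<Sum>j\<in>{i}. ennreal (diameter (U j) powr s)) \<le> (\<Sum>j. ennreal (diameter (U j) powr s))"
        by (rule sum_le_suminf) auto
      also have "\<dots> \<le> ennreal (\<delta> powr s)"
        using sum by (rule order.trans[OF _ ennreal_leI[OF min.cobounded2]])
      finally have "ennreal (diameter (U i) powr s) \<le> ennreal (\<delta> powr s)"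
        by simp
      then have "diameter (U i) powr s \<le> \<delta> powr s"
        by simp
      then show ?thesis
        using powr_less_mono2[of s \<delta> "diameter (U i)"] s \<delta> by linarith
    qed
    then have "hausdorff_premeasure s \<delta> E \<le> (\<Sum>i. ennreal (diameter (U i) powr s))"
      unfolding hausdorff_premeasure_def by (intro INF_lower) (use U in auto)
    also have "\<dots> \<le> ennreal \<eta>"
      using sum by (rule order.trans[OF _ ennreal_leI[OF min.cobounded1]])
    finally show ?thesis .
  qed
  then have "hausdorff_premeasure s \<delta> E = 0" if "\<delta> > 0" for \<delta>
    using that ennreal_le_epsilon[of 0 "hausdorff_premeasure s \<delta> E"] by simp
  then show ?thesis
    unfolding hausdorff_measure_def by (intro antisym SUP_least) auto
qed

lemma hausdorff_measure_zeroD: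
  assumes "hausdorff_measure s E = 0" "\<eta> > 0"
  shows "\<exists>U :: nat \<Rightarrow> 'a::metric_space set. E \<subseteq> (\<Union>i. U i) \<and> (\<forall>i. bounded (U i)) \<and>
    (\<Sum>i. ennreal (diameter (U i) powr s)) \<le> ennreal \<eta>"
proof -
  have "hausdorff_premeasure s 1 E \<le> hausdorff_measure s E"
    unfolding hausdorff_measure_def by (rule SUP_upper) simp
  then have "hausdorff_premeasure s 1 E < ennreal \<eta>"
    using assms by simp
  then show ?thesis
    unfolding hausdorff_premeasure_def INF_less_iff using less_imp_le by blast
qed

lemma hausdorff_null_subset:
  assumes "s > 0" "hausdorff_measure s E' = 0" "E \<subseteq> E'"
  shows "hausdorff_measure s E = 0"
proof (rule hausdorff_measure_zeroI[OF assms(1)])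
  fix \<eta> :: real assume "\<eta> > 0"
  from hausdorff_measure_zeroD[OF assms(2) this] obtain U :: "nat \<Rightarrow> 'a set" where
    "E' \<subseteq> (\<Union>i. U i)" "\<And>i. bounded (U i)" "(\<Sum>i. ennreal (diameter (U i) powr s)) \<le> ennreal \<eta>"
    by blast
  with assms(3) show "\<exists>U. E \<subseteq> (\<Union>i. U i) \<and> (\<forall>i. bounded (U i)) \<and> (\<Sum>i. ennreal (diameter (U i) powr s)) \<le> ennreal \<eta>"
    by blast
qed

text \<open>Doubly indexed covers are what countable unions and limit superior sets produce.\<close>

lemma hausdorff_null_double_cover:
  assumes s: "s > 0"
    and cover: "\<And>\<eta>. \<eta> > 0 \<Longrightarrow> \<exists>U :: nat \<Rightarrow> nat \<Rightarrow> 'a::metric_space set. E \<subseteq> (\<Union>n i. U n i) \<and>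
      (\<forall>n i. bounded (U n i)) \<and> (\<Sum>n. \<Sum>i. ennreal (diameter (U n i) powr s)) \<le> ennreal \<eta>"
  shows "hausdorff_measure s E = 0"
proof (rule hausdorff_measure_zeroI[OF s])
  fix \<eta> :: real assume "\<eta> > 0"
  from cover[OF this] obtain U :: "nat \<Rightarrow> nat \<Rightarrow> 'a set" where U: "E \<subseteq> (\<Union>n i. U n i)" "\<And>n i. bounded (U n i)"
    "(\<Sum>n. \<Sum>i. ennreal (diameter (U n i) powr s)) \<le> ennreal \<eta>" by auto
  define U' where "U' k = U (fst (prod_decode k)) (snd (prod_decode k))" for k
  have "(\<Sum>k. ennreal (diameter (U' k) powr s)) = (\<Sum>n. \<Sum>i. ennreal (diameter (U n i) powr s))"
    unfolding U'_def
    by (rule suminf_ennreal_2dimen[of _ "\<lambda>p. ennreal (diameter (U (fst p) (snd p)) powr s)"]) simp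
  moreover have "E \<subseteq> (\<Union>k. U' k)"
  proof
    fix x assume "x \<in> E"
    then obtain n i where "x \<in> U n i"
      using U(1) by blast
    then have "x \<in> U' (prod_encode (n, i))"
      by (simp add: U'_def)
    then show "x \<in> (\<Union>k. U' k)"
      by blast
  qed
  moreover have "\<forall>k. bounded (U' k)"
    using U(2) unfolding U'_def by blast
  ultimately show "\<exists>U. E \<subseteq> (\<Union>i. U i) \<and> (\<forall>i. bounded (U i)) \<and> (\<Sum>i. ennreal (diameter (U i) powr s)) \<le> ennreal \<eta>"
    using U(3) by (intro exI[of _ U'] conjI) (assumption | simp only:)+
qed

lemma hausdorff_null_UN:
  assumes s: "s > 0" and null: "\<And>n::nat. hausdorff_measure s (E n :: 'a::metric_space set) = 0"
  shows "hausdorff_measure s (\<Union>n. E n) = 0"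
proof (rule hausdorff_null_double_cover[OF s])
  fix \<eta> :: real assume \<eta>: "\<eta> > 0"
  have "\<exists>U :: nat \<Rightarrow> 'a set. E n \<subseteq> (\<Union>i. U i) \<and> (\<forall>i. bounded (U i)) \<and>
      (\<Sum>i. ennreal (diameter (U i) powr s)) \<le> ennreal (\<eta> * (1 / 2) ^ Suc n)" for n
  proof -
    have "\<eta> * (1 / 2) ^ Suc n > 0"
      using \<eta> by simp
    then show ?thesis
      by (rule hausdorff_measure_zeroD[OF null])
  qed
  then obtain U :: "nat \<Rightarrow> nat \<Rightarrow> 'a set" where *: "\<And>n. E n \<subseteq> (\<Union>i. U n i) \<and> (\<forall>i. bounded (U n i)) \<and>
      (\<Sum>i. ennreal (diameter (U n i) powr s)) \<le> ennreal (\<eta> * (1 / 2) ^ Suc n)"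
    by metis
  have U: "E n \<subseteq> (\<Union>i. U n i)" "bounded (U n i)"
    "(\<Sum>i. ennreal (diameter (U n i) powr s)) \<le> ennreal (\<eta> * (1 / 2) ^ Suc n)" for n i
    using *[of n] by (blast, blast, blast)
  have "(\<Sum>n. \<Sum>i. ennreal (diameter (U n i) powr s)) \<le> (\<Sum>n. ennreal (\<eta> * (1 / 2) ^ Suc n))"
    by (intro suminf_le U) auto
  also have "\<dots> = ennreal \<eta>"
    using sums_mult[OF power_half_series, of \<eta>] \<eta> by (intro suminf_ennreal_eq) auto
  finally have sum: "(\<Sum>n. \<Sum>i. ennreal (diameter (U n i) powr s)) \<le> ennreal \<eta>" .
  have "(\<Union>n. E n) \<subseteq> (\<Union>n i. U n i)"
    using U(1) by fast
  then show "\<exists>U. (\<Union>n. E n) \<subseteq> (\<Union>n i. U n i) \<and> (\<forall>n i. bounded (U n i)) \<and>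
      (\<Sum>n. \<Sum>i. ennreal (diameter (U n i) powr s)) \<le> ennreal \<eta>"
    by (intro exI[of _ U] conjI allI sum U(2))
qed

lemma hausdorff_null_Un:
  assumes "s > 0" "hausdorff_measure s E = 0" "hausdorff_measure s E' = 0"
  shows "hausdorff_measure s (E \<union> E') = 0"
proof (rule hausdorff_null_subset[OF assms(1) hausdorff_null_UN[OF assms(1)]])
  show "hausdorff_measure s (if n = 0 then E else E') = 0" for n :: nat
    using assms by simp
  show "E \<union> E' \<subseteq> (\<Union>n::nat. if n = 0 then E else E')"
    using UN_upper[of 0 UNIV "\<lambda>n::nat. if n = 0 then E else E'"]
      UN_upper[of 1 UNIV "\<lambda>n::nat. if n = 0 then E else E'"] by simp
qed

text \<open>The convergence part of the Borel-Cantelli argument: the tails of the series bound the cost of covering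
  \<open>E\<close> by all sets of late generations.\<close>

lemma hausdorff_null_limsup:
  fixes U :: "nat \<Rightarrow> nat \<Rightarrow> 'a::metric_space set"
  assumes s: "s > 0" and J: "\<And>n. finite (J n)"
    and U: "\<And>n i. i \<in> J n \<Longrightarrow> bounded (U n i)" "\<And>n i. i \<in> J n \<Longrightarrow> diameter (U n i) \<le> d n"
    and sum: "summable (\<lambda>n. real (card (J n)) * d n powr s)"
    and E: "\<And>x. x \<in> E \<Longrightarrow> \<exists>\<^sub>\<infinity>n. \<exists>i\<in>J n. x \<in> U n i"
  shows "hausdorff_measure s E = 0"
proof (rule hausdorff_null_double_cover[OF s])
  fix \<eta> :: real assume \<eta>: "\<eta> > 0"
  let ?f = "\<lambda>n. real (card (J n)) * d n powr s"
  obtain N where N: "norm (\<Sum>n. ?f (n + N)) < \<eta>"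
    using suminf_exist_split[OF \<eta> sum] by blast
  define U' where "U' n i = (if i \<in> J (n + N) then U (n + N) i else {})" for n i
  have "(\<Sum>n. \<Sum>i. ennreal (diameter (U' n i) powr s)) \<le> (\<Sum>n. ennreal (?f (n + N)))"
  proof (intro suminf_le)
    fix n
    have "(\<Sum>i. ennreal (diameter (U' n i) powr s)) = (\<Sum>i\<in>J (n + N). ennreal (diameter (U' n i) powr s))"
      by (rule suminf_finite[OF J]) (simp add: U'_def)
    also have "\<dots> \<le> (\<Sum>i\<in>J (n + N). ennreal (d (n + N) powr s))"
      using U s by (intro sum_mono ennreal_leI powr_mono2) (auto simp: U'_def diameter_ge_0)
    also have "\<dots> = ennreal (?f (n + N))"
      by (simp add: ennreal_mult ennreal_of_nat_eq_real_of_nat)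
    finally show "(\<Sum>i. ennreal (diameter (U' n i) powr s)) \<le> ennreal (?f (n + N))" .
  qed auto
  also have "\<dots> = ennreal (\<Sum>n. ?f (n + N))"
    using summable_ignore_initial_segment[OF sum, of N] by (intro suminf_ennreal2) auto
  also have "\<dots> \<le> ennreal \<eta>"
    using N unfolding real_norm_def by (intro ennreal_leI) linarith
  finally have total: "(\<Sum>n. \<Sum>i. ennreal (diameter (U' n i) powr s)) \<le> ennreal \<eta>" .
  have cover: "E \<subseteq> (\<Union>n i. U' n i)"
  proof
    fix x assume "x \<in> E"
    then obtain n i where n: "n \<ge> N" "i \<in> J n" "x \<in> U n i"
      using E[of x] unfolding INFM_nat_le by blast
    then have "x \<in> U' (n - N) i"
      unfolding U'_def by simp
    then show "x \<in> (\<Union>n i. U' n i)"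
      by blast
  qed
  have bounded: "bounded (U' n i)" for n i
  proof (cases "i \<in> J (n + N)")
    case True
    then show ?thesis unfolding U'_def using U(1)[OF True] by (simp only: if_True)
  next
    case False
    then show ?thesis unfolding U'_def by (simp only: if_False bounded_empty)
  qed
  show "\<exists>U. E \<subseteq> (\<Union>n i. U n i) \<and> (\<forall>n i. bounded (U n i)) \<and>
      (\<Sum>n. \<Sum>i. ennreal (diameter (U n i) powr s)) \<le> ennreal \<eta>"
    by (intro exI[of _ U'] conjI allI total cover bounded)
qed

lemma hausdorff_dim_zeroI:
  assumes "\<And>s. s > 0 \<Longrightarrow> hausdorff_measure s E = 0"
  shows "hausdorff_dim E = 0"
proof -
  have "hausdorff_dim E \<le> ennreal e" if "e > 0" for e
    unfolding hausdorff_dim_def using that assms by (intro INF_lower) auto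
  then show ?thesis
    using ennreal_le_epsilon[of 0 "hausdorff_dim E"] by simp
qed

section \<open>Logarithmic oscillation ratios as power bounds\<close>

text \<open>All statements about exponents are turned into power bounds by this equivalence. Taking logarithms
  reverses the inequality, because \<open>ln r < 0\<close>; the values 0 and \<open>\<infinity>\<close> of \<open>x\<close> are in agreement with it.\<close>

lemma eln_ratio_less_iff:
  assumes r: "0 < r" "r < 1"
  shows "eln x / ereal (ln r) < ereal h \<longleftrightarrow> ennreal (r powr h) < x"
proof (cases x)
  case (real y)
  have lr: "ln r < 0" using r by simp
  show ?thesis
  proof (cases "y = 0")
    case True
    then show ?thesis using real lr by (simp add: eln_def)
  next
    case False
    then have y: "y > 0" using real by simp
    have "eln x / ereal (ln r) < ereal h \<longleftrightarrow> ln y / ln r < h"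
      using real y lr by (simp add: eln_def)
    also have "\<dots> \<longleftrightarrow> h * ln r < ln y"
      using lr by (simp add: neg_divide_less_eq)
    also have "\<dots> \<longleftrightarrow> r powr h < y"
      using y r by (metis ln_less_cancel_iff ln_powr powr_gt_zero less_irrefl)
    also have "\<dots> \<longleftrightarrow> ennreal (r powr h) < x"
      using real y by (simp add: ennreal_less_iff)
    finally show ?thesis .
  qed
next
  case top
  then show ?thesis using r by (simp add: eln_def)
qed

lemma log_osc_ratio_less_iff:
  assumes "0 < r" "r < 1"
  shows "log_osc_ratio D f t r < ereal h \<longleftrightarrow> ennreal (r powr h) < osc D f {t - r..t + r}"
  unfolding log_osc_ratio_def by (rule eln_ratio_less_iff[OF assms])

lemma osc_gtD:
  assumes "ennreal c < osc D f J"
  obtains u v where "u \<in> J \<inter> D" "v \<in> J \<inter> D" "c < dist (f u) (f v)"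
proof -
  from assms obtain u v where "u \<in> J \<inter> D" "v \<in> J \<inter> D" "ennreal c < ennreal (dist (f u) (f v))"
    unfolding osc_def less_SUP_iff by auto
  then show ?thesis
    using that[of u v] by (meson ennreal_leI not_less)
qed

lemma dist_le_osc: "u \<in> J \<inter> D \<Longrightarrow> v \<in> J \<inter> D \<Longrightarrow> ennreal (dist (f u) (f v)) \<le> osc D f J"
  unfolding osc_def by (rule SUP_upper2[of "(u, v)"]) auto

lemma eventually_at_right_less: "0 < (c::real) \<Longrightarrow> eventually (\<lambda>r. 0 < r \<and> r < c) (at_right 0)"
  unfolding eventually_at_right_field by blast

lemma holder_exponent_nonneg:
  assumes "continuous_on D f" "t \<in> D"
  shows "holder_exponent D f t \<ge> 0"
  unfolding holder_exponent_def
proof (rule Liminf_bounded)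
  from assms obtain \<delta> where \<delta>: "\<delta> > 0" "\<And>u. u \<in> D \<Longrightarrow> dist u t < \<delta> \<Longrightarrow> dist (f u) (f t) < 1 / 2"
    unfolding continuous_on_iff by (metis half_gt_zero_iff zero_less_one)
  show "eventually (\<lambda>r. 0 \<le> log_osc_ratio D f t r) (at_right 0)"
  proof (rule eventually_mono)
    show "eventually (\<lambda>r. 0 < r \<and> r < min 1 \<delta>) (at_right 0)"
      by (rule eventually_at_right_less) (use \<delta>(1) in simp)
    fix r :: real assume r: "0 < r \<and> r < min 1 \<delta>"
    have "osc D f {t - r..t + r} \<le> 1"
      unfolding osc_def
    proof (rule SUP_least, clarify)
      fix u v assume "u \<in> {t - r..t + r}" "v \<in> {t - r..t + r}" "u \<in> D" "v \<in> D"
      then have "dist (f u) (f t) < 1 / 2" "dist (f v) (f t) < 1 / 2"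
        using r by (intro \<delta>(2); simp add: dist_real_def abs_less_iff)+
      then have "dist (f u) (f v) \<le> 1"
        using dist_triangle2[of "f u" "f v" "f t"] by linarith
      then show "ennreal (dist (f u) (f v)) \<le> 1"
        by (simp add: ennreal_le_1)
    qed
    then show "0 \<le> log_osc_ratio D f t r"
      using log_osc_ratio_less_iff[of r D f t 0] r by (auto simp: not_less[symmetric] zero_ereal_def[symmetric])
  qed
qed

lemma holder_exponent_gtD:
  assumes "ereal h < holder_exponent D f t" "h > 0" "t \<in> D"
  obtains \<delta> where "\<delta> > 0" "\<And>u. u \<in> D \<Longrightarrow> \<bar>u - t\<bar> < \<delta> \<Longrightarrow> dist (f u) (f t) \<le> \<bar>u - t\<bar> powr h"
proof -
  have "eventually (\<lambda>r. ereal h < log_osc_ratio D f t r) (at_right 0)"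
    using assms(1) unfolding holder_exponent_def by (rule less_LiminfD)
  then obtain \<delta> where \<delta>: "\<delta> > 0" "\<And>r. 0 < r \<Longrightarrow> r < \<delta> \<Longrightarrow> ereal h < log_osc_ratio D f t r"
    unfolding eventually_at_right_field by blast
  show ?thesis
  proof (rule that[of "min 1 \<delta>"])
    fix u assume u: "u \<in> D" "\<bar>u - t\<bar> < min 1 \<delta>"
    show "dist (f u) (f t) \<le> \<bar>u - t\<bar> powr h"
    proof (cases "u = t")
      case False
      define r where "r = \<bar>u - t\<bar>"
      have r: "0 < r" "r < 1" "r < \<delta>"
        using False u by (auto simp: r_def)
      have "\<not> log_osc_ratio D f t r < ereal h"
        using \<delta>(2)[OF r(1,3)] by simp
      then have "osc D f {t - r..t + r} \<le> ennreal (r powr h)"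
        using log_osc_ratio_less_iff[OF r(1,2)] by (metis not_less)
      moreover have "ennreal (dist (f u) (f t)) \<le> osc D f {t - r..t + r}"
        using u assms(3) by (intro dist_le_osc) (auto simp: r_def)
      ultimately have "ennreal (dist (f u) (f t)) \<le> ennreal (r powr h)"
        by (rule order_trans[rotated])
      then show ?thesis
        by (simp add: r_def)
    qed simp
  qed (use \<delta> in auto)
qed

text \<open>The factor 2 arises because the oscillation compares two arbitrary points of the window, one of which
  is replaced by its centre.\<close>

lemma holder_exponent_zeroD:
  assumes h: "holder_exponent D f t = 0" "\<epsilon> > 0" "\<delta> > 0" and t: "t \<in> D"
  obtains \<rho> u where "0 < \<rho>" "\<rho> < \<delta>" "u \<in> D" "\<bar>u - t\<bar> \<le> \<rho>" "\<rho> powr \<epsilon> < 2 * dist (f u) (f t)"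
proof -
  have "\<not> eventually (\<lambda>r. ereal \<epsilon> \<le> log_osc_ratio D f t r) (at_right 0)"
  proof
    assume "eventually (\<lambda>r. ereal \<epsilon> \<le> log_osc_ratio D f t r) (at_right 0)"
    then have "ereal \<epsilon> \<le> holder_exponent D f t"
      unfolding holder_exponent_def by (rule Liminf_bounded)
    then show False using h by simp
  qed
  then have "\<not> (\<forall>r. 0 < r \<and> r < min 1 \<delta> \<longrightarrow> ereal \<epsilon> \<le> log_osc_ratio D f t r)"
    using h(3) eventually_at_right_less[of "min 1 \<delta>"] unfolding eventually_at_right_field by (meson min_less_iff_conj zero_less_one)
  then obtain r where r: "0 < r" "r < 1" "r < \<delta>" "log_osc_ratio D f t r < ereal \<epsilon>"
    by (auto simp: not_le)
  then have "ennreal (r powr \<epsilon>) < osc D f {t - r..t + r}"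
    using log_osc_ratio_less_iff[of r D f t] by simp
  then obtain u v where uv: "u \<in> {t - r..t + r} \<inter> D" "v \<in> {t - r..t + r} \<inter> D" "r powr \<epsilon> < dist (f u) (f v)"
    by (rule osc_gtD)
  have "dist (f u) (f v) \<le> dist (f u) (f t) + dist (f v) (f t)"
    by (rule dist_triangle2)
  then have "r powr \<epsilon> < 2 * dist (f u) (f t) \<or> r powr \<epsilon> < 2 * dist (f v) (f t)"
    using uv(3) by linarith
  then show ?thesis
    using that[of r u] that[of r v] uv r by (auto simp: abs_le_iff)
qed

text \<open>The bounds on the exponent and on the scale are natural numbers so that the complement of the
  exceptional set becomes a countable union.\<close>

lemma not_upper_infiniteD:
  assumes "t \<in> D - upper_infinite_set D f"
  shows "\<exists>a m :: nat. \<forall>r. 0 < r \<and> r < 1 / real (Suc m) \<longrightarrow>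
    (\<exists>u\<in>D. \<exists>v\<in>D. \<bar>u - t\<bar> \<le> r \<and> \<bar>v - t\<bar> \<le> r \<and> r powr real (Suc a) < dist (f u) (f v))"
proof -
  have "Limsup (at_right 0) (log_osc_ratio D f t) < \<infinity>"
    using assms unfolding upper_infinite_set_def by (cases "Limsup (at_right 0) (log_osc_ratio D f t)") auto
  then obtain a :: nat where "Limsup (at_right 0) (log_osc_ratio D f t) < ereal (real a)"
    using less_PInf_Ex_of_nat by auto
  then have a: "Limsup (at_right 0) (log_osc_ratio D f t) < ereal (real (Suc a))"
    by (rule less_le_trans) simp
  then obtain \<delta> where \<delta>: "\<delta> > 0" "\<And>r. 0 < r \<Longrightarrow> r < \<delta> \<Longrightarrow> log_osc_ratio D f t r < ereal (real (Suc a))"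
    using Limsup_lessD[OF a] unfolding eventually_at_right_field by blast
  obtain m :: nat where m: "1 / real (Suc m) < min 1 \<delta>"
    using \<delta>(1) nat_approx_posE[of "min 1 \<delta>"] by auto
  show ?thesis
  proof (rule exI[of _ a], rule exI[of _ m], intro allI impI)
    fix r :: real assume "0 < r \<and> r < 1 / real (Suc m)"
    then have r: "0 < r" "r < 1 / real (Suc m)" by auto
    then have "r < 1" "r < \<delta>" using m by linarith+
    then have "ennreal (r powr real (Suc a)) < osc D f {t - r..t + r}"
      using \<delta>(2)[of r] r(1) log_osc_ratio_less_iff[of r D f t] by simp
    then obtain u v where "u \<in> {t - r..t + r} \<inter> D" "v \<in> {t - r..t + r} \<inter> D" "r powr real (Suc a) < dist (f u) (f v)"
      by (rule osc_gtD)
    then show "\<exists>u\<in>D. \<exists>v\<in>D. \<bar>u - t\<bar> \<le> r \<and> \<bar>v - t\<bar> \<le> r \<and> r powr real (Suc a) < dist (f u) (f v)"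
      by (intro bexI[of _ u] bexI[of _ v]) (auto simp: abs_le_iff)
  qed
qed

lemma monofractal_exponent_eq:
  assumes "monofractal D f" "continuous_on D f" "t \<in> D"
  shows "holder_exponent D f t = monofractal_exponent D f"
proof -
  have "0 \<le> holder_exponent D f t \<and> holder_level_set D f (holder_exponent D f t) \<noteq> {}"
    using assms holder_exponent_nonneg[OF assms(2,3)] by (auto simp: holder_level_set_def)
  then show ?thesis
    using assms(1) unfolding monofractal_def monofractal_exponent_def by (intro the1_equality[symmetric]) auto
qed

section \<open>Sets on which a monotone function is flat on one side only\<close>

definition polynomially_spread :: "(real \<Rightarrow> real) \<Rightarrow> real \<Rightarrow> real \<Rightarrow> real set" where
  "polynomially_spread G a r0 = {t \<in> {0..1}. \<forall>r. 0 < r \<and> r < r0 \<longrightarrow>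
     (\<exists>u\<in>{0..1}. \<exists>v\<in>{0..1}. \<bar>u - t\<bar> \<le> r \<and> \<bar>v - t\<bar> \<le> r \<and> r powr a < \<bar>G u - G v\<bar>)}"

text \<open>The sign \<open>\<sigma>\<close> is \<open>1\<close> for the right hand side of \<open>t\<close> and \<open>-1\<close> for the left hand side.\<close>

definition flat_side :: "(real \<Rightarrow> real) \<Rightarrow> real \<Rightarrow> real \<Rightarrow> nat \<Rightarrow> real \<Rightarrow> bool" where
  "flat_side G \<sigma> A k t \<longleftrightarrow> t + \<sigma> / 2 ^ k \<in> {0..1} \<and> \<bar>G (t + \<sigma> / 2 ^ k) - G t\<bar> < (1 / 2 ^ k) powr A"

text \<open>The window around \<open>p\<close> that has \<open>c\<close> on its boundary lies within the flat side of \<open>c\<close>. The growth of \<open>G\<close> on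
  it is therefore tiny, which by the lower bound at \<open>p\<close> is possible only if the window itself is tiny.\<close>

lemma flat_points_close:
  assumes mono: "mono_on {0..1} G" and a: "a > 0" and \<sigma>: "\<sigma> = 1 \<or> \<sigma> = (-1::real)"
    and p: "p \<in> polynomially_spread G a r0" and c: "c \<in> {0..1}" "flat_side G \<sigma> A k c"
    and pc: "0 < \<sigma> * (p - c)" "\<sigma> * (p - c) \<le> 1 / 2 ^ Suc k" "1 / 2 ^ Suc k < r0"
  shows "\<sigma> * (p - c) \<le> (1 / 2 ^ k) powr (A / a)"
proof -
  define r where "r = \<sigma> * (p - c)"
  have r: "0 < r" "r < r0" "2 * r \<le> 1 / 2 ^ k"
    using pc by (auto simp: r_def)
  obtain u v where uv: "u \<in> {0..1}" "v \<in> {0..1}" "\<bar>u - p\<bar> \<le> r" "\<bar>v - p\<bar> \<le> r"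
    "r powr a < \<bar>G u - G v\<bar>"
    using p r(1,2) unfolding polynomially_spread_def by blast
  have end_in: "c + \<sigma> / 2 ^ k \<in> {0..1}"
    and end_flat: "\<bar>G (c + \<sigma> / 2 ^ k) - G c\<bar> < (1 / 2 ^ k) powr A"
    using c by (auto simp: flat_side_def)
  have between: "\<bar>G x - G y\<bar> \<le> \<bar>G (c + \<sigma> / 2 ^ k) - G c\<bar>"
    if "x \<in> {0..1}" "\<bar>x - p\<bar> \<le> r" "y \<in> {0..1}" "\<bar>y - p\<bar> \<le> r" for x y
    using \<sigma>
  proof
    assume [simp]: "\<sigma> = 1"
    have "c \<le> z \<and> z \<le> c + \<sigma> / 2 ^ k" if "\<bar>z - p\<bar> \<le> r" for z
      using that r by (auto simp: r_def)
    then have "G c \<le> G z \<and> G z \<le> G (c + \<sigma> / 2 ^ k)" if "z \<in> {0..1}" "\<bar>z - p\<bar> \<le> r" for z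
      using that mono_onD[OF mono] c(1) end_in by meson
    from this[OF that(1,2)] this[OF that(3,4)] show ?thesis by linarith
  next
    assume [simp]: "\<sigma> = -1"
    have "c + \<sigma> / 2 ^ k \<le> z \<and> z \<le> c" if "\<bar>z - p\<bar> \<le> r" for z
      using that r by (auto simp: r_def)
    then have "G (c + \<sigma> / 2 ^ k) \<le> G z \<and> G z \<le> G c" if "z \<in> {0..1}" "\<bar>z - p\<bar> \<le> r" for z
      using that mono_onD[OF mono] c(1) end_in by meson
    from this[OF that(1,2)] this[OF that(3,4)] show ?thesis by linarith
  qed
  have "r powr a < (1 / 2 ^ k) powr A"
    using between[OF uv(1,3,2,4)] uv(5) end_flat by linarith
  then have "(r powr a) powr (1 / a) \<le> ((1 / 2 ^ k) powr A) powr (1 / a)"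
    using a by (intro powr_mono2) auto
  then show ?thesis
    using a r(1) by (simp add: powr_powr r_def)
qed

text \<open>Among the points of an interval of length \<open>2\<^sup>-\<^sup>k\<^sup>-\<^sup>1\<close> those with a flat side at scale \<open>2\<^sup>-\<^sup>k\<close> are within distance
  \<open>(2\<^sup>-\<^sup>k)\<^sup>A\<^sup>/\<^sup>a\<close> of one another. With \<open>A = 2 a / s\<close> the \<open>s\<close>-th power of this distance is \<open>4\<^sup>-\<^sup>k\<close>, which
  outweighs the number of intervals, about \<open>2\<^sup>k\<^sup>+\<^sup>1\<close>.\<close>

lemma flat_set_null:
  assumes mono: "mono_on {0..1} G" and a: "a > 0" and r0: "r0 > 0" and \<sigma>: "\<sigma> = 1 \<or> \<sigma> = (-1::real)"
    and s: "s > 0"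
  shows "hausdorff_measure s {t \<in> polynomially_spread G a r0. \<exists>\<^sub>\<infinity>k. flat_side G \<sigma> (2 * a / s) k t} = 0"
proof -
  define A where "A = 2 * a / s"
  define U where "U k i = {t \<in> polynomially_spread G a r0. flat_side G \<sigma> A k t} \<inter> {real i / 2 ^ Suc k..(real i + 1) / 2 ^ Suc k}" for k i
  obtain k0 where k0: "1 / 2 ^ k0 < r0"
    using real_arch_pow_inv[of r0 "1 / 2"] r0 by (auto simp: power_one_over)
  define J where "J k = (if k0 \<le> k then {..(2::nat) ^ Suc k} else {})" for k
  have "hausdorff_measure s {t \<in> polynomially_spread G a r0. \<exists>\<^sub>\<infinity>k. flat_side G \<sigma> A k t} = 0"
  proof (rule hausdorff_null_limsup[where J = J and U = U and d = "\<lambda>k. (1 / 2 ^ k) powr (A / a)", OF s])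
    show "finite (J k)" for k
      by (simp add: J_def)
    show "bounded (U k i)" for k i
      unfolding U_def by (rule bounded_subset[OF bounded_closed_interval]) blast
    show "diameter (U k i) \<le> (1 / 2 ^ k) powr (A / a)" if "i \<in> J k" for k i
    proof (rule diameter_le)
      have "k0 \<le> k"
        using that by (auto simp: J_def split: if_splits)
      then have small: "1 / 2 ^ Suc k < r0"
      proof -
        have "1 / 2 ^ Suc k \<le> (1 / 2 ^ k0 :: real)"
          using \<open>k0 \<le> k\<close> by (intro divide_left_mono power_increasing) auto
        then show ?thesis using k0 by linarith
      qed
      have *: "y - x \<le> (1 / 2 ^ k) powr (A / a)" if xy: "x \<in> U k i" "y \<in> U k i" "x < y" for x y
      proof -
        have len: "y - x \<le> 1 / 2 ^ Suc k"
          using xy by (auto simp: U_def add_divide_distrib)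
        have sp: "x \<in> polynomially_spread G a r0" "y \<in> polynomially_spread G a r0" "flat_side G \<sigma> A k x" "flat_side G \<sigma> A k y" "x \<in> {0..1}" "y \<in> {0..1}"
          using xy by (auto simp: U_def polynomially_spread_def)
        show ?thesis
          using flat_points_close[OF mono a \<sigma> sp(1,6,4)] flat_points_close[OF mono a \<sigma> sp(2,5,3)]
            \<sigma> len small xy(3) by auto
      qed
      show "norm (x - y) \<le> (1 / 2 ^ k) powr (A / a)" if "x \<in> U k i" "y \<in> U k i" for x y
        using *[OF that] *[OF that(2,1)] by (cases x y rule: linorder_cases) auto
    qed simp
    show "summable (\<lambda>k. real (card (J k)) * ((1 / 2 ^ k) powr (A / a)) powr s)"
    proof (rule summable_comparison_test)
      have "((1 / 2 ^ k) powr (A / a)) powr s = (1 / 4) ^ k" for k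
      proof -
        have "((1 / 2 ^ k) powr (A / a)) powr s = ((1 / 2 ^ k) :: real) powr 2"
          using a s by (simp add: powr_powr A_def)
        also have "\<dots> = (1 / 4) ^ k"
          by (simp add: power_one_over power_divide power2_eq_square flip: power_mult_distrib)
        finally show ?thesis .
      qed
      moreover have "real (card (J k)) \<le> 3 * 2 ^ k" for k
        by (simp add: J_def)
      then have "real (card (J k)) * (1 / 4) ^ k \<le> 3 * 2 ^ k * (1 / 4) ^ k" for k
        by (rule mult_right_mono) simp
      moreover have "3 * 2 ^ k * (1 / 4) ^ k = 3 * (1 / 2 :: real) ^ k" for k
        by (simp add: mult.assoc flip: power_mult_distrib)
      ultimately show "\<exists>N. \<forall>k\<ge>N. norm (real (card (J k)) * ((1 / 2 ^ k) powr (A / a)) powr s) \<le> 3 * (1 / 2) ^ k"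
        by simp
      show "summable (\<lambda>k. 3 * (1 / 2 :: real) ^ k)"
        by (intro summable_mult summable_geometric) simp
    qed
    show "\<exists>\<^sub>\<infinity>k. \<exists>i\<in>J k. t \<in> U k i" if t: "t \<in> {t \<in> polynomially_spread G a r0. \<exists>\<^sub>\<infinity>k. flat_side G \<sigma> A k t}" for t
    proof -
      have "\<exists>\<^sub>\<infinity>k. flat_side G \<sigma> A k t \<and> k0 \<le> k"
        using t by (intro INFM_conjI MOST_ge_nat) auto
      then show ?thesis
      proof (rule INFM_mono)
        fix k assume k: "flat_side G \<sigma> A k t \<and> k0 \<le> k"
        define i where "i = nat \<lfloor>t * 2 ^ Suc k\<rfloor>"
        have t01: "0 \<le> t" "t \<le> 1"
          using t by (auto simp: polynomially_spread_def)
        have i: "real i \<le> t * 2 ^ Suc k" "t * 2 ^ Suc k \<le> real i + 1"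
          using t01 by (auto simp: i_def)
        have "t * 2 ^ Suc k \<le> 2 ^ Suc k"
          using t01 by (simp add: mult_le_cancel_right1)
        then have "real i \<le> real (2 ^ Suc k)"
          using i(1) unfolding of_nat_power of_nat_numeral by linarith
        then have "i \<in> J k"
          unfolding of_nat_le_iff using k by (simp add: J_def)
        moreover have "t \<in> U k i"
          using t k i by (simp add: U_def divide_simps del: power_Suc)
        ultimately show "\<exists>i\<in>J k. t \<in> U k i" by blast
      qed
    qed
  qed
  then show ?thesis by (simp add: A_def)
qed

section \<open>Functions with comparable increments and oscillations\<close>

lemma exists_scale:
  fixes \<beta> d :: real
  assumes "\<beta> > 1" "0 < d" "d \<le> 1"
  obtains n :: nat where "1 / \<beta> ^ Suc n < d" "d \<le> 1 / \<beta> ^ n"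
proof -
  have ex: "\<exists>n. 1 / \<beta> ^ Suc n < d"
  proof -
    obtain n where "(1 / \<beta>) ^ n < d"
      using real_arch_pow_inv[of d "1 / \<beta>"] assms by auto
    then have "1 / \<beta> ^ n < d" by (simp add: power_one_over)
    moreover have "1 / \<beta> ^ Suc n \<le> 1 / \<beta> ^ n"
      using assms(1) by (intro divide_left_mono power_increasing) auto
    ultimately show ?thesis by (blast intro: le_less_trans)
  qed
  define n where "n = (LEAST n. 1 / \<beta> ^ Suc n < d)"
  have 1: "1 / \<beta> ^ Suc n < d"
    unfolding n_def by (rule LeastI_ex[OF ex])
  have 2: "d \<le> 1 / \<beta> ^ n"
  proof (cases n)
    case 0
    then show ?thesis using assms by simp
  next
    case (Suc m)
    then have "\<not> 1 / \<beta> ^ Suc m < d"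
      using not_less_Least[of m "\<lambda>n. 1 / \<beta> ^ Suc n < d"] n_def by simp
    then show ?thesis unfolding Suc by simp
  qed
  from 1 2 show ?thesis by (rule that)
qed

text \<open>The interface between the cascade and the time change: all that matters about \<open>F\<close> is that its increments
  over \<open>b\<close>-adic intervals control its oscillations there.\<close>

locale adic_increments =
  fixes b :: nat and F :: "real \<Rightarrow> complex" and q :: "nat \<Rightarrow> nat \<Rightarrow> complex" and C :: real
  assumes b: "b \<ge> 2" and C: "C \<ge> 0" and cont_F: "continuous_on {0..1} F"
    and increment: "j < b ^ n \<Longrightarrow> F (real (Suc j) / real b ^ n) - F (real j / real b ^ n) = q n j"
    and osc_le: "j < b ^ n \<Longrightarrow> real j / real b ^ n \<le> t \<Longrightarrow> t \<le> real (Suc j) / real b ^ n \<Longrightarrow>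
      norm (F t - F (real j / real b ^ n)) \<le> C * norm (q n j)"
begin

lemma bn_pos: "0 < real b ^ n"
  using b by simp

lemma adic_interval:
  assumes "0 \<le> t" "t \<le> 1"
  obtains j where "j < b ^ n" "real j / real b ^ n \<le> t" "t \<le> real (Suc j) / real b ^ n"
proof (cases "t = 1")
  case True
  have *: "real (b ^ n - 1) + 1 = real b ^ n"
    using bn_pos[of n] b by (simp add: of_nat_diff)
  show ?thesis
    using bn_pos[of n] b * True by (intro that[of "b ^ n - 1"]) (simp_all add: divide_simps add.commute)
next
  case False
  define j where "j = nat \<lfloor>t * real b ^ n\<rfloor>"
  have "t * real b ^ n < real b ^ n"
    using False assms bn_pos[of n] by simp
  moreover have j: "real j \<le> t * real b ^ n" "t * real b ^ n \<le> real j + 1"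
    using assms bn_pos[of n] by (auto simp: j_def)
  ultimately have "real j < real (b ^ n)"
    unfolding of_nat_power by linarith
  then show ?thesis
    using j bn_pos[of n] by (intro that[of j]) (simp_all add: divide_simps add.commute)
qed

text \<open>Two points at distance at most \<open>b\<^sup>-\<^sup>n\<close> lie in the same or in adjacent intervals of generation \<open>n\<close>; one of
  the increments involved must then dominate the difference of the values of \<open>F\<close>, up to a constant.\<close>

lemma near_increment:
  assumes xy: "0 \<le> x" "x \<le> y" "y \<le> 1" "y - x \<le> 1 / real b ^ n"
  obtains i where "i < b ^ n" "{x..y} \<subseteq> {(real i - 1) / real b ^ n..(real i + 2) / real b ^ n}"
    "norm (F x - F y) \<le> (2 * C + 1) * norm (q n i)"
proof -
  obtain j where j: "j < b ^ n" "real j / real b ^ n \<le> x" "x \<le> real (Suc j) / real b ^ n"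
    by (rule adic_interval[of x n]) (use xy in auto)
  have y_le: "y \<le> (real j + 2) / real b ^ n"
    using j(3) xy(4) by (simp add: add_divide_distrib)
  have Fx: "norm (F x - F (real j / real b ^ n)) \<le> C * norm (q n j)"
    by (rule osc_le[OF j])
  have le: "(real i - 1) / real b ^ n \<le> real i / real b ^ n" for i
    using bn_pos[of n] by (simp add: divide_right_mono)
  have le1: "real (Suc i) / real b ^ n \<le> (real i + 2) / real b ^ n" for i
    using bn_pos[of n] by (simp add: divide_right_mono)
  show ?thesis
  proof (cases "y \<le> real (Suc j) / real b ^ n")
    case True
    have "norm (F y - F (real j / real b ^ n)) \<le> C * norm (q n j)"
      using j xy True by (intro osc_le) auto
    then have "norm (F x - F y) \<le> C * norm (q n j) + C * norm (q n j)"
      using Fx norm_triangle_ineq4[of "F x - F (real j / real b ^ n)" "F y - F (real j / real b ^ n)"] by simp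
    also have "\<dots> \<le> (2 * C + 1) * norm (q n j)"
      by (simp add: algebra_simps)
    finally show ?thesis
      using j(1,2) le[of j] le1[of j] True by (intro that[of j]) auto
  next
    case False
    have "Suc j < b ^ n"
    proof (rule ccontr)
      assume "\<not> Suc j < b ^ n"
      then have "real (b ^ n) \<le> real (Suc j)"
        unfolding of_nat_le_iff by simp
      then have "1 \<le> real (Suc j) / real b ^ n"
        using bn_pos[of n] by simp
      then show False using False xy by linarith
    qed
    define m where "m = max (norm (q n j)) (norm (q n (Suc j)))"
    have Fy: "norm (F y - F (real (Suc j) / real b ^ n)) \<le> C * norm (q n (Suc j))"
      using False y_le \<open>Suc j < b ^ n\<close> by (intro osc_le) (auto simp: add.commute)
    have split: "F x - F y = (F x - F (real j / real b ^ n)) - q n j - (F y - F (real (Suc j) / real b ^ n))"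
      unfolding increment[OF j(1), symmetric] by simp
    have "norm (F x - F y) \<le> norm (F x - F (real j / real b ^ n)) + norm (q n j) + norm (F y - F (real (Suc j) / real b ^ n))"
      using norm_triangle_ineq4[of "F x - F (real j / real b ^ n) - q n j" "F y - F (real (Suc j) / real b ^ n)"]
        norm_triangle_ineq4[of "F x - F (real j / real b ^ n)" "q n j"] by (subst split) linarith
    also have "\<dots> \<le> C * m + m + C * m"
    proof -
      have m: "norm (q n j) \<le> m" "norm (q n (Suc j)) \<le> m"
        by (auto simp: m_def)
      then show ?thesis
        using Fx Fy mult_left_mono[OF m(1) C] mult_left_mono[OF m(2) C] by linarith
    qed
    also have "\<dots> = (2 * C + 1) * m"
      by (simp add: algebra_simps)
    finally have *: "norm (F x - F y) \<le> (2 * C + 1) * m" .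
    have sub: "{x..y} \<subseteq> {(real j - 1) / real b ^ n..(real j + 2) / real b ^ n}"
      "{x..y} \<subseteq> {(real (Suc j) - 1) / real b ^ n..(real (Suc j) + 2) / real b ^ n}"
    proof -
      have "(real j + 2) / real b ^ n \<le> (real (Suc j) + 2) / real b ^ n"
        using bn_pos[of n] by (simp add: divide_right_mono)
      then show "{x..y} \<subseteq> {(real j - 1) / real b ^ n..(real j + 2) / real b ^ n}"
        "{x..y} \<subseteq> {(real (Suc j) - 1) / real b ^ n..(real (Suc j) + 2) / real b ^ n}"
        using j(2) y_le le[of j] by auto
    qed
    show ?thesis
    proof (cases "norm (q n j) \<le> norm (q n (Suc j))")
      case True
      then show ?thesis
        using * sub(2) \<open>Suc j < b ^ n\<close> by (intro that[of "Suc j"]) (auto simp: m_def max_def)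
    next
      case False
      then show ?thesis
        using * sub(1) j(1) by (intro that[of j]) (auto simp: m_def max_def)
    qed
  qed
qed

text \<open>Markov's inequality bounds the number of intervals of generation \<open>n\<close> with a large increment. With
  \<open>\<epsilon> = s / (2 k)\<close> it costs a factor \<open>b\<^bsup>n s / 2\<^esup>\<close>, which uses up half of the exponent in the gain \<open>b\<^bsup>- n s\<^esup>\<close> from the
  diameters; the other half is left to the series in the hypothesis.\<close>

lemma large_increments_null:
  fixes k :: nat
  assumes s: "s > 0" and k: "k > 0" and c: "c > 0"
    and sum: "summable (\<lambda>n. real b powr (- real n * s / 2) * (\<Sum>j<b ^ n. norm (q n j) ^ k))"
  shows "hausdorff_measure s {t. \<exists>\<^sub>\<infinity>n. \<exists>i<b ^ n. t \<in> {(real i - 1) / real b ^ n..(real i + 2) / real b ^ n} \<and>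
    c * real b powr (- real n * (s / (2 * real k))) \<le> norm (q n i)} = 0"
proof -
  define \<epsilon> where "\<epsilon> = s / (2 * real k)"
  define J where "J n = {i. i < b ^ n \<and> c * real b powr (- real n * \<epsilon>) \<le> norm (q n i)}" for n
  define U where "U n i = {(real i - 1) / real b ^ n..(real i + 2) / real b ^ n}" for n i
  have "hausdorff_measure s {t. \<exists>\<^sub>\<infinity>n. \<exists>i<b ^ n. t \<in> U n i \<and> c * real b powr (- real n * \<epsilon>) \<le> norm (q n i)} = 0"
  proof (rule hausdorff_null_limsup[where J = J and U = U and d = "\<lambda>n. 3 / real b ^ n", OF s])
    show "finite (J n)" for n
      by (rule finite_subset[of _ "{..<b ^ n}"]) (auto simp: J_def)
    show "bounded (U n i)" for n i
      unfolding U_def by (rule bounded_closed_interval)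
    show "diameter (U n i) \<le> 3 / real b ^ n" for n i
      unfolding U_def diameter_closed_interval using bn_pos[of n]
      by (auto simp: diff_divide_distrib[symmetric])
    show "\<exists>\<^sub>\<infinity>n. \<exists>i\<in>J n. t \<in> U n i"
      if "t \<in> {t. \<exists>\<^sub>\<infinity>n. \<exists>i<b ^ n. t \<in> U n i \<and> c * real b powr (- real n * \<epsilon>) \<le> norm (q n i)}" for t
      using that unfolding mem_Collect_eq by (rule INFM_mono) (auto simp: J_def)
    let ?x = "\<lambda>n. \<Sum>j<b ^ n. norm (q n j) ^ k"
    show "summable (\<lambda>n. real (card (J n)) * (3 / real b ^ n) powr s)"
    proof (rule summable_comparison_test)
      show "summable (\<lambda>n. 3 powr s / c ^ k * (real b powr (- real n * s / 2) * ?x n))"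
        by (intro summable_mult sum)
      have "norm (real (card (J n)) * (3 / real b ^ n) powr s) \<le>
          3 powr s / c ^ k * (real b powr (- real n * s / 2) * ?x n)" for n
      proof -
        have pk: "(c * real b powr (- real n * \<epsilon>)) ^ k = c ^ k * real b powr (- real n * s / 2)"
        proof -
          have "(real b powr (- real n * \<epsilon>)) ^ k = real b powr (real k * (- real n * \<epsilon>))"
            using b by (simp add: powr_power mult.commute)
          also have "real k * (- real n * \<epsilon>) = - real n * s / 2"
            using k by (simp add: \<epsilon>_def field_simps)
          finally show ?thesis by (simp add: power_mult_distrib)
        qed
        have "real (card (J n)) * (c * real b powr (- real n * \<epsilon>)) ^ k = (\<Sum>j\<in>J n. (c * real b powr (- real n * \<epsilon>)) ^ k)"
          by simp
        also have "\<dots> \<le> (\<Sum>j\<in>J n. norm (q n j) ^ k)"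
          using c by (intro sum_mono power_mono) (auto simp: J_def)
        also have "\<dots> \<le> ?x n"
          by (intro sum_mono2) (auto simp: J_def)
        finally have *: "real (card (J n)) * (c ^ k * real b powr (- real n * s / 2)) \<le> ?x n"
          unfolding pk .
        have scale: "(3 / real b ^ n) powr s = 3 powr s * (real b powr (- real n * s / 2) * real b powr (- real n * s / 2))"
        proof -
          have "(3 / real b ^ n) powr s = (3 * real b powr (- real n)) powr s"
            using b by (simp add: powr_minus powr_realpow divide_inverse)
          also have "\<dots> = 3 powr s * real b powr (- real n * s)"
            using b by (simp add: powr_mult powr_powr mult.commute)
          also have "real b powr (- real n * s) = real b powr (- real n * s / 2) * real b powr (- real n * s / 2)"
            by (simp add: mult.commute flip: powr_add)
          finally show ?thesis .
        qed
        have "real (card (J n)) * (3 / real b ^ n) powr s =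
            3 powr s / c ^ k * (real b powr (- real n * s / 2) * (real (card (J n)) * (c ^ k * real b powr (- real n * s / 2))))"
          unfolding scale using c by simp
        also have "\<dots> \<le> 3 powr s / c ^ k * (real b powr (- real n * s / 2) * ?x n)"
          using c by (intro mult_left_mono *) auto
        finally show ?thesis
          by (simp add: abs_mult)
      qed
      then show "\<exists>N. \<forall>n\<ge>N. norm (real (card (J n)) * (3 / real b ^ n) powr s) \<le>
          3 powr s / c ^ k * (real b powr (- real n * s / 2) * ?x n)"
        by blast
    qed
  qed
  then show ?thesis
    by (simp add: U_def \<epsilon>_def)
qed

end

section \<open>Monofractal functions in a monotone time\<close>

locale time_change = adic_increments +
  fixes B :: "real \<Rightarrow> complex" and G :: "real \<Rightarrow> real"
  assumes cont_G: "continuous_on {0..1} G" and mono_G: "mono_on {0..1} G"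
    and F_eq: "t \<in> {0..1} \<Longrightarrow> F t = B (G t)"
begin

lemma G_in: "t \<in> {0..1} \<Longrightarrow> G t \<in> {G 0..G 1}"
  using mono_onD[OF mono_G, of 0 t] mono_onD[OF mono_G, of t 1] by simp

text \<open>Baire's theorem turns the pointwise Hoelder bounds for \<open>B\<close> into a uniform one on a \<open>b\<close>-adic interval, where
  \<open>p\<close>-th powers of the increments of \<open>F\<close> are then dominated by increments of \<open>G\<close>, which telescope.\<close>

lemma exponent_not_positive:
  assumes unbounded: "\<And>n j p K. j < b ^ n \<Longrightarrow> 0 < p \<Longrightarrow>
      \<exists>N. K < (\<Sum>l<b ^ N. norm (q (n + N) (j * b ^ N + l)) ^ p)"
    and exponent: "\<And>y. y \<in> {G 0..G 1} \<Longrightarrow> holder_exponent {G 0..G 1} B y = H"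
  shows "\<not> 0 < H"
proof
  assume "0 < H"
  then obtain p where p: "p > 0" "ereal (1 / real p) < H"
  proof (cases H)
    case (real h)
    then obtain m where "1 / real (Suc m) < h"
      using \<open>0 < H\<close> nat_approx_posE[of h] by auto
    then show ?thesis using that[of "Suc m"] real by simp
  next
    case PInf
    then show ?thesis using that[of 1] by simp
  qed (use \<open>0 < H\<close> in auto)
  define T where "T m = {t \<in> {0..1}. \<forall>x\<in>{0..1}. \<bar>G x - G t\<bar> < 1 / real (Suc m) \<longrightarrow>
    norm (F x - F t) \<le> \<bar>G x - G t\<bar> powr (1 / real p)}" for m
  have T_cover: "\<exists>m. t \<in> T m" if t: "t \<in> {0..1}" for t
  proof -
    have "ereal (1 / real p) < holder_exponent {G 0..G 1} B (G t)"
      using exponent[OF G_in[OF t]] p by simp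
    then obtain \<delta> where \<delta>: "\<delta> > 0"
      "\<And>u. u \<in> {G 0..G 1} \<Longrightarrow> \<bar>u - G t\<bar> < \<delta> \<Longrightarrow> dist (B u) (B (G t)) \<le> \<bar>u - G t\<bar> powr (1 / real p)"
      using p(1) G_in[OF t] by (elim holder_exponent_gtD) auto
    obtain m where m: "1 / real (Suc m) < \<delta>"
      using \<delta>(1) nat_approx_posE by blast
    have "norm (F x - F t) \<le> \<bar>G x - G t\<bar> powr (1 / real p)"
      if "x \<in> {0..1}" "\<bar>G x - G t\<bar> < 1 / real (Suc m)" for x
      using \<delta>(2)[OF G_in[OF that(1)]] that(2) m F_eq[OF that(1)] F_eq[OF t] by (simp add: dist_norm)
    then show ?thesis
      using t unfolding T_def by blast
  qed
  \<comment> \<open>Each \<open>T m\<close> asks for a uniform Hoelder bound; these closed sets exhaust the unit interval.\<close>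
  have T_closed: "closed (T m)" for m
    unfolding closed_sequential_limits
  proof (intro allI impI, elim conjE)
    fix X t assume X: "\<forall>n. X n \<in> T m" and lim: "X \<longlonglongrightarrow> t"
    have X01: "X n \<in> {0..1}" for n
      using X by (simp add: T_def)
    have t01: "t \<in> {0..1}"
      using closed_sequentially[OF closed_atLeastAtMost _ lim] X01 by blast
    have G_lim: "(\<lambda>n. G (X n)) \<longlonglongrightarrow> G t" and F_lim: "(\<lambda>n. F (X n)) \<longlonglongrightarrow> F t"
      using cont_G cont_F t01 X01 lim unfolding continuous_on_sequentially by (auto simp: o_def)
    have "norm (F x - F t) \<le> \<bar>G x - G t\<bar> powr (1 / real p)"
      if x: "x \<in> {0..1}" "\<bar>G x - G t\<bar> < 1 / real (Suc m)" for x
    proof (rule tendsto_le[OF sequentially_bot])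
      show "(\<lambda>n. \<bar>G x - G (X n)\<bar> powr (1 / real p)) \<longlonglongrightarrow> \<bar>G x - G t\<bar> powr (1 / real p)"
        using p(1) by (intro tendsto_powr' tendsto_intros G_lim) auto
      show "(\<lambda>n. norm (F x - F (X n))) \<longlonglongrightarrow> norm (F x - F t)"
        by (intro tendsto_intros F_lim)
      have "(\<lambda>n. \<bar>G x - G (X n)\<bar>) \<longlonglongrightarrow> \<bar>G x - G t\<bar>"
        by (intro tendsto_intros G_lim)
      then have "eventually (\<lambda>n. \<bar>G x - G (X n)\<bar> < 1 / real (Suc m)) sequentially"
        using x(2) by (rule order_tendstoD(2))
      then show "eventually (\<lambda>n. norm (F x - F (X n)) \<le> \<bar>G x - G (X n)\<bar> powr (1 / real p)) sequentially"
        by (rule eventually_mono) (use X x(1) in \<open>auto simp: T_def\<close>)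
    qed
    then show "t \<in> T m"
      using t01 unfolding T_def by blast
  qed
  have "\<exists>m. \<not> {0..1} \<subseteq> closure ({0..1} - T m)"
  proof (rule ccontr)
    assume dense: "\<not> ?thesis"
    have "{0..1::real} \<subseteq> closure (\<Inter>m. {0..1} - T m)"
    proof (rule Baire)
      fix S assume "S \<in> range (\<lambda>m. {0..1} - T m)"
      then obtain m where S: "S = {0..1} - T m" by blast
      have "openin (top_of_set {0..1}) S"
        unfolding S by (intro openin_diff openin_subtopology_self closedin_closed_Int[of "T m" "{0..1}", THEN back_subst[of "\<lambda>S. closedin _ S"]] T_closed)
          (auto simp: T_def)
      then show "openin (top_of_set {0..1}) S \<and> {0..1} \<subseteq> closure S"
        using dense S by blast
    qed auto
    moreover have "(\<Inter>m. {0..1} - T m) = {}"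
      using T_cover by blast
    ultimately have "{0..1::real} \<subseteq> closure {}"
      by (simp only:)
    then show False by auto
  qed
  then obtain m t where t: "t \<in> {0..1}" "t \<notin> closure ({0..1} - T m)" by blast
  then obtain \<epsilon> where \<epsilon>: "\<epsilon> > 0" "\<And>x. x \<in> {0..1} \<Longrightarrow> \<bar>x - t\<bar> < \<epsilon> \<Longrightarrow> x \<in> T m"
    unfolding closure_approachable dist_real_def by (metis Diff_iff)
  have "uniformly_continuous_on {0..1} G"
    using cont_G compact_Icc by (rule compact_uniformly_continuous)
  then obtain \<delta> where \<delta>: "\<delta> > 0" "\<And>x y. x \<in> {0..1} \<Longrightarrow> y \<in> {0..1} \<Longrightarrow> \<bar>x - y\<bar> < \<delta> \<Longrightarrow> \<bar>G x - G y\<bar> < 1 / real (Suc m)"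
    unfolding uniformly_continuous_on_def dist_real_def by (metis of_nat_0_less_iff zero_less_Suc zero_less_divide_1_iff)
  obtain n where n: "1 / real b ^ n < min \<epsilon> \<delta>"
    using real_arch_pow_inv[of "min \<epsilon> \<delta>" "1 / real b"] \<epsilon>(1) \<delta>(1) b by (auto simp: power_one_over)
  obtain j where j: "j < b ^ n" "real j / real b ^ n \<le> t" "t \<le> real (Suc j) / real b ^ n"
    by (rule adic_interval[of t n]) (use t in auto)
  have width: "real (Suc j) / real b ^ n = real j / real b ^ n + 1 / real b ^ n"
    by (simp add: add_divide_distrib)
  \<comment> \<open>The \<open>e i\<close> below are the end points of the descendants of the interval \<open>(n, j)\<close> in generation \<open>n + N\<close>.\<close>
  have "(\<Sum>l<b ^ N. norm (q (n + N) (j * b ^ N + l)) ^ p) \<le> G 1 - G 0" for N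
  proof -
    define e where "e i = real (j * b ^ N + i) / real b ^ (n + N)" for i
    have e_le: "e i \<le> e i'" if "i \<le> i'" for i i'
      using that bn_pos[of "n + N"] by (simp add: e_def divide_right_mono)
    have e_first: "e 0 = real j / real b ^ n"
      using b by (simp add: e_def power_add)
    have e_last: "e (b ^ N) = real (Suc j) / real b ^ n"
      using b by (simp add: e_def power_add field_simps)
    have "real (Suc j) \<le> real (b ^ n)"
      using j(1) unfolding of_nat_le_iff by simp
    then have j1: "real (Suc j) / real b ^ n \<le> 1"
      using bn_pos[of n] by simp
    have e01: "e i \<in> {0..1}" if "i \<le> b ^ N" for i
      using e_le[OF that] e_le[of 0 i] e_last j1 by (auto simp: e_def intro: order_trans)
    have "norm (q (n + N) (j * b ^ N + l)) ^ p \<le> G (e (Suc l)) - G (e l)" if l: "l < b ^ N" for l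
    proof -
      have "j * b ^ N + l < j * b ^ N + b ^ N"
        using l by simp
      also have "\<dots> = Suc j * b ^ N" by simp
      also have "\<dots> \<le> b ^ n * b ^ N"
        using j(1) by (intro mult_le_mono1) simp
      finally have idx: "j * b ^ N + l < b ^ (n + N)"
        by (simp add: power_add)
      have q_eq: "F (e (Suc l)) - F (e l) = q (n + N) (j * b ^ N + l)"
        using increment[OF idx] by (simp add: e_def)
      have near: "\<bar>e l - t\<bar> < \<epsilon>" "\<bar>e (Suc l) - e l\<bar> < \<delta>"
        using e_le[of 0 l] e_le[of l "Suc l"] e_le[of "Suc l" "b ^ N"] l e_first e_last width n j(2,3) by auto
      have in01: "e l \<in> {0..1}" "e (Suc l) \<in> {0..1}"
        using l by (auto intro!: e01 simp del: atLeastAtMost_iff)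
      have "e l \<in> T m"
        using \<epsilon>(2)[OF in01(1) near(1)] .
      then have "norm (F (e (Suc l)) - F (e l)) \<le> \<bar>G (e (Suc l)) - G (e l)\<bar> powr (1 / real p)"
        using \<delta>(2)[OF in01(2,1) near(2)] in01(2) by (simp add: T_def)
      then have "norm (q (n + N) (j * b ^ N + l)) ^ p \<le> (\<bar>G (e (Suc l)) - G (e l)\<bar> powr (1 / real p)) ^ p"
        unfolding q_eq by (rule power_mono) simp
      also have "\<dots> = \<bar>G (e (Suc l)) - G (e l)\<bar>"
      proof (cases "G (e (Suc l)) = G (e l)")
        case True
        then show ?thesis using p(1) by simp
      next
        case False
        then show ?thesis using p(1) by (simp add: powr_realpow[symmetric] powr_powr)
      qed
      also have "\<dots> = G (e (Suc l)) - G (e l)"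
        using mono_onD[OF mono_G in01] e_le[of l "Suc l"] by simp
      finally show ?thesis .
    qed
    then have "(\<Sum>l<b ^ N. norm (q (n + N) (j * b ^ N + l)) ^ p) \<le> (\<Sum>l<b ^ N. G (e (Suc l)) - G (e l))"
      by (intro sum_mono) simp
    also have "\<dots> = G (e (b ^ N)) - G (e 0)"
      by (rule sum_lessThan_telescope)
    also have "\<dots> \<le> G 1 - G 0"
      using G_in[OF e01[of "b ^ N"]] G_in[OF e01[of 0]] by simp
    finally show ?thesis .
  qed
  then show False
    using unbounded[OF j(1) p(1), of "G 1 - G 0"] by (meson not_le)
qed

text \<open>Monotonicity carries the growth at distance \<open>2\<^sup>-\<^sup>k\<close> from \<open>t\<close> over to all points farther away on the same side.\<close>

lemma not_flat_lower_bound: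
  assumes nf: "\<And>\<sigma>. \<sigma> = 1 \<or> \<sigma> = -1 \<Longrightarrow> \<not> flat_side G \<sigma> A k t"
    and tx: "t \<in> {0..1}" "x \<in> {0..1}" "1 / 2 ^ k \<le> \<bar>x - t\<bar>"
  shows "(1 / 2 ^ k) powr A \<le> \<bar>G x - G t\<bar>"
proof (cases "t \<le> x")
  case True
  then have z: "t + 1 / 2 ^ k \<in> {0..1}" "t + 1 / 2 ^ k \<le> x" "t \<le> t + 1 / 2 ^ k"
    using tx by auto
  then have "(1 / 2 ^ k) powr A \<le> \<bar>G (t + 1 / 2 ^ k) - G t\<bar>"
    using nf[of 1] unfolding flat_side_def by (meson not_le)
  then show ?thesis
    using mono_onD[OF mono_G tx(1) z(1,3)] mono_onD[OF mono_G z(1) tx(2) z(2)] by linarith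
next
  case False
  then have z: "x \<le> t + - 1 / 2 ^ k" "t + - 1 / 2 ^ k \<le> t"
    using tx(3) by auto
  then have z': "t + - 1 / 2 ^ k \<in> {0..1}"
    using tx(1,2) unfolding atLeastAtMost_iff by linarith
  then have "(1 / 2 ^ k) powr A \<le> \<bar>G (t + - 1 / 2 ^ k) - G t\<bar>"
    using nf[of "-1"] unfolding flat_side_def by (meson not_le)
  then show ?thesis
    using mono_onD[OF mono_G z' tx(1) z(2)] mono_onD[OF mono_G tx(2) z' z(1)] by linarith
qed

text \<open>At \<open>G t\<close> the exponent zero of \<open>B\<close> gives a value \<open>G x\<close> at distance at most \<open>\<rho>\<close> with a difference of \<open>B\<close> of at
  least \<open>\<rho>\<^bsup>\<epsilon> / A\<^esup> / 2\<close>. As \<open>G\<close> is not flat at \<open>t\<close> on the side of \<open>x\<close>, \<open>\<rho>\<close> is at least of the order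
  \<open>|x - t|\<^sup>A\<close>, and so \<open>F\<close> varies by \<open>|x - t|\<^sup>\<epsilon>\<close>, up to a constant, between \<open>t\<close> and \<open>x\<close>.
  Non-flatness is needed on both sides because the side of \<open>x\<close> cannot be chosen.\<close>

lemma never_flat_large_increments:
  assumes t: "t \<in> {0..1}" and A: "A > 0" and \<epsilon>: "\<epsilon> > 0"
    and nf: "\<And>k \<sigma>. k0 \<le> k \<Longrightarrow> \<sigma> = 1 \<or> \<sigma> = -1 \<Longrightarrow> \<not> flat_side G \<sigma> A k t"
    and h: "holder_exponent {G 0..G 1} B (G t) = 0"
  shows "\<exists>\<^sub>\<infinity>n. \<exists>i<b ^ n. t \<in> {(real i - 1) / real b ^ n..(real i + 2) / real b ^ n} \<and>
    real b powr (- 2 * \<epsilon>) / (2 * (2 * C + 1)) * real b powr (- real n * \<epsilon>) \<le> norm (q n i)"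
  unfolding INFM_nat_le
proof
  fix N :: nat
  obtain k1 where k1: "k0 \<le> k1" "1 / 2 ^ k1 \<le> 1 / real b ^ N"
  proof -
    obtain m where m: "(1 / 2 :: real) ^ m < 1 / real b ^ N"
      using real_arch_pow_inv[of "1 / real b ^ N" "1 / 2"] bn_pos[of N] by auto
    have "1 / 2 ^ max k0 m \<le> (1 / 2 ^ m :: real)"
      by (intro divide_left_mono power_increasing) auto
    then show ?thesis
      using m that[of "max k0 m"] by (simp add: power_one_over)
  qed
  have "\<epsilon> / A > 0" "(1 / 2 ^ k1 :: real) powr A > 0"
    using \<epsilon> A by auto
  then obtain \<rho> u where \<rho>: "0 < \<rho>" "\<rho> < (1 / 2 ^ k1) powr A" and u: "u \<in> {G 0..G 1}" "\<bar>u - G t\<bar> \<le> \<rho>"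
    "\<rho> powr (\<epsilon> / A) < 2 * dist (B u) (B (G t))"
    using holder_exponent_zeroD[OF h _ _ G_in[OF t]] by blast
  obtain x where x: "x \<in> {0..1}" "G x = u"
    using IVT'[of G 0 u 1] u(1) cont_G by auto
  have big: "\<rho> powr (\<epsilon> / A) < 2 * norm (F x - F t)"
    using u(3) x F_eq[OF x(1)] F_eq[OF t] by (simp add: dist_norm)
  define d where "d = \<bar>x - t\<bar>"
  have "x \<noteq> t"
    using big by (auto simp: not_less)
  then have d: "0 < d" "d \<le> 1"
    using x(1) t by (auto simp: d_def)
  have d_small: "d < 1 / 2 ^ k1"
  proof (rule ccontr)
    assume "\<not> d < 1 / 2 ^ k1"
    then have "(1 / 2 ^ k1) powr A \<le> \<bar>G x - G t\<bar>"
      by (intro not_flat_lower_bound nf k1 t x(1)) (auto simp: d_def)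
    then show False
      using u(2) x(2) \<rho>(2) by linarith
  qed
  \<comment> \<open>The dyadic scale of \<open>|x - t|\<close> serves for the flatness of \<open>G\<close>, the \<open>b\<close>-adic one for the increments of \<open>F\<close>.\<close>
  obtain m where m: "1 / 2 ^ Suc m < d" "d \<le> 1 / 2 ^ m"
    by (rule exists_scale[of 2 d]) (use d in auto)
  have "(1 / 2 :: real) ^ Suc m < (1 / 2) ^ k1"
    using m(1) d_small by (simp add: power_one_over)
  then have "k1 < Suc m"
    by (subst (asm) power_strict_decreasing_iff) auto
  then have "(1 / 2 ^ Suc m) powr A \<le> \<bar>G x - G t\<bar>"
    using k1(1) m(1) by (intro not_flat_lower_bound nf t x(1)) (auto simp: d_def)
  then have le_\<rho>: "(1 / 2 ^ Suc m) powr A \<le> \<rho>"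
    using u(2) x(2) by linarith
  have "(d / 2) powr A \<le> (1 / 2 ^ Suc m) powr A"
    using m(2) d(1) A by (intro powr_mono2) auto
  then have "((d / 2) powr A) powr (\<epsilon> / A) \<le> \<rho> powr (\<epsilon> / A)"
    using le_\<rho> \<epsilon> A by (intro powr_mono2) auto
  then have F_big: "(d / 2) powr \<epsilon> < 2 * norm (F x - F t)"
    using A big by (simp add: powr_powr)
  obtain n where n: "1 / real b ^ Suc n < d" "d \<le> 1 / real b ^ n"
    by (rule exists_scale[of "real b" d]) (use d b in auto)
  have "(1 / real b) ^ Suc n < (1 / real b) ^ N"
    using n(1) d_small k1(2) by (simp add: power_one_over)
  then have "N < Suc n"
    using b by (subst (asm) power_strict_decreasing_iff) auto
  have "max x t - min x t = d"
    by (simp add: d_def max_def min_def)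
  obtain i where i: "i < b ^ n" "{min x t..max x t} \<subseteq> {(real i - 1) / real b ^ n..(real i + 2) / real b ^ n}"
    "norm (F (min x t) - F (max x t)) \<le> (2 * C + 1) * norm (q n i)"
    by (rule near_increment[of "min x t" "max x t" n]) (use x(1) t n(2) \<open>max x t - min x t = d\<close> in auto)
  have "norm (F (min x t) - F (max x t)) = norm (F x - F t)"
    by (simp add: min_def max_def norm_minus_commute)
  then have F_small: "norm (F x - F t) \<le> (2 * C + 1) * norm (q n i)"
    using i(3) by simp
  have "real b powr (- 2 * \<epsilon>) * real b powr (- real n * \<epsilon>) = (1 / real b ^ (n + 2)) powr \<epsilon>"
  proof -
    have "1 / real b ^ m = real b powr (- real m)" for m
      using b by (simp add: powr_minus powr_realpow divide_inverse)
    then have "(1 / real b ^ (n + 2)) powr \<epsilon> = real b powr (- real (n + 2) * \<epsilon>)"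
      by (simp only: powr_powr)
    then show ?thesis
      by (simp add: algebra_simps flip: powr_add)
  qed
  also have "\<dots> \<le> (d / 2) powr \<epsilon>"
  proof (rule powr_mono2)
    have "1 / real b ^ (n + 2) = 1 / real b ^ Suc n / real b"
      by simp
    also have "\<dots> \<le> d / 2"
      using n(1) b d(1) by (intro frac_le) auto
    finally show "1 / real b ^ (n + 2) \<le> d / 2" .
  qed (use \<epsilon> in auto)
  also have "\<dots> \<le> 2 * ((2 * C + 1) * norm (q n i))"
    using F_big F_small by linarith
  finally have "real b powr (- 2 * \<epsilon>) / (2 * (2 * C + 1)) * real b powr (- real n * \<epsilon>) \<le> norm (q n i)"
    using C by (simp add: field_simps)
  moreover have "t \<in> {(real i - 1) / real b ^ n..(real i + 2) / real b ^ n}"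
    using i(2) by (rule subsetD) auto
  ultimately show "\<exists>n\<ge>N. \<exists>i<b ^ n. t \<in> {(real i - 1) / real b ^ n..(real i + 2) / real b ^ n} \<and>
    real b powr (- 2 * \<epsilon>) / (2 * (2 * C + 1)) * real b powr (- real n * \<epsilon>) \<le> norm (q n i)"
    using i(1) \<open>N < Suc n\<close> by (intro exI[of _ n]) auto
qed

lemma complement_of_upper_infinite_set_dim_zero:
  assumes exponent: "\<And>y. y \<in> {G 0..G 1} \<Longrightarrow> holder_exponent {G 0..G 1} B y = 0"
    and sum: "\<And>s. s > 0 \<Longrightarrow> \<exists>p>0. summable (\<lambda>n. real b powr (- real n * s / 2) * (\<Sum>j<b ^ n. norm (q n j) ^ p))"
  shows "hausdorff_dim ({0..1} - upper_infinite_set {0..1} G) = 0"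
proof (rule hausdorff_dim_zeroI)
  fix s :: real assume s: "s > 0"
  obtain p where p: "p > 0" "summable (\<lambda>n. real b powr (- real n * s / 2) * (\<Sum>j<b ^ n. norm (q n j) ^ p))"
    using sum[OF s] by blast
  define \<epsilon> where "\<epsilon> = s / (2 * real p)"
  define c where "c = real b powr (- 2 * \<epsilon>) / (2 * (2 * C + 1))"
  define L where "L = {t. \<exists>\<^sub>\<infinity>n. \<exists>i<b ^ n. t \<in> {(real i - 1) / real b ^ n..(real i + 2) / real b ^ n} \<and>
    c * real b powr (- real n * \<epsilon>) \<le> norm (q n i)}"
  define E where "E \<sigma> a m = {t \<in> polynomially_spread G (real (Suc a)) (1 / real (Suc m)).
    \<exists>\<^sub>\<infinity>k. flat_side G \<sigma> (2 * real (Suc a) / s) k t}" for \<sigma> a m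
  have "c > 0"
    using C b by (simp add: c_def)
  then have L: "hausdorff_measure s L = 0"
    unfolding L_def \<epsilon>_def by (intro large_increments_null s p)
  have E: "hausdorff_measure s (E \<sigma> a m) = 0" if "\<sigma> = 1 \<or> \<sigma> = -1" for \<sigma> a m
    unfolding E_def by (intro flat_set_null mono_G s that) auto
  have "hausdorff_measure s (\<Union>a m. E 1 a m \<union> E (-1) a m) = 0"
    by (intro hausdorff_null_UN hausdorff_null_Un s E) auto
  then have null: "hausdorff_measure s (L \<union> (\<Union>a m. E 1 a m \<union> E (-1) a m)) = 0"
    by (intro hausdorff_null_Un s L)
  have "{0..1} - upper_infinite_set {0..1} G \<subseteq> L \<union> (\<Union>a m. E 1 a m \<union> E (-1) a m)"
  proof
    fix t assume t: "t \<in> {0..1} - upper_infinite_set {0..1} G"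
    obtain a' m' where "\<forall>r. 0 < r \<and> r < 1 / real (Suc m') \<longrightarrow> (\<exists>u\<in>{0..1}. \<exists>v\<in>{0..1}.
        \<bar>u - t\<bar> \<le> r \<and> \<bar>v - t\<bar> \<le> r \<and> r powr real (Suc a') < dist (G u) (G v))"
      using not_upper_infiniteD[OF t] by blast
    then have polynomially_spread: "t \<in> polynomially_spread G (real (Suc a')) (1 / real (Suc m'))"
      using t unfolding polynomially_spread_def dist_real_def by blast
    show "t \<in> L \<union> (\<Union>a m. E 1 a m \<union> E (-1) a m)"
    proof (cases "t \<in> E 1 a' m' \<union> E (-1) a' m'")
      case False
      define A where "A = 2 * real (Suc a') / s"
      have "\<forall>\<^sub>\<infinity>k. \<not> flat_side G 1 A k t" "\<forall>\<^sub>\<infinity>k. \<not> flat_side G (-1) A k t"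
        using False polynomially_spread unfolding E_def A_def by (simp_all add: not_INFM)
      then have "\<forall>\<^sub>\<infinity>k. \<not> flat_side G 1 A k t \<and> \<not> flat_side G (-1) A k t"
        by (rule MOST_conjI)
      then obtain k0 where k0: "\<And>k. k0 \<le> k \<Longrightarrow> \<not> flat_side G 1 A k t \<and> \<not> flat_side G (-1) A k t"
        unfolding MOST_nat_le by blast
      have "t \<in> L"
        unfolding L_def c_def mem_Collect_eq
      proof (rule never_flat_large_increments[where A = A and ?k0.0 = k0])
        show "holder_exponent {G 0..G 1} B (G t) = 0"
          using t by (intro exponent G_in) auto
      qed (use t s p k0 in \<open>auto simp: A_def \<epsilon>_def\<close>)
      then show ?thesis by blast
    qed blast
  qed
  then show "hausdorff_measure s ({0..1} - upper_infinite_set {0..1} G) = 0"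
    by (rule hausdorff_null_subset[OF s null])
qed

end

section \<open>Words and products of weights\<close>

definition word_weight :: "(nat list \<Rightarrow> nat \<Rightarrow> complex) \<Rightarrow> nat list \<Rightarrow> nat list \<Rightarrow> complex" where
  "word_weight x w v = (\<Prod>k<length v. x (w @ take k v) (v ! k))"

lemma word_weight_Nil [simp]: "word_weight x w [] = 1"
  by (simp add: word_weight_def)

lemma word_weight_snoc: "word_weight x w (v @ [i]) = word_weight x w v * x (w @ v) i"
  by (simp add: word_weight_def nth_append)

lemma word_weight_append: "word_weight x w (u @ v) = word_weight x w u * word_weight x (w @ u) v"
proof (induction v rule: rev_induct)
  case (snoc i v)
  have "word_weight x w (u @ v @ [i]) = word_weight x w (u @ v) * x (w @ u @ v) i"
    using word_weight_snoc[of x w "u @ v" i] by simp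
  then show ?case
    by (simp add: snoc word_weight_snoc)
qed simp

lemma word_weight_Cons: "word_weight x w (i # v) = x w i * word_weight x (w @ [i]) v"
  using word_weight_append[of x w "[i]" v] word_weight_snoc[of x w "[]" i] by simp

text \<open>The address of the interval \<open>[j / b\<^sup>n, (j + 1) / b\<^sup>n]\<close>: the \<open>n\<close> lowest base \<open>b\<close> digits of \<open>j\<close>, the most
  significant one first.\<close>

fun adic_word :: "nat \<Rightarrow> nat \<Rightarrow> nat \<Rightarrow> nat list" where
  "adic_word b 0 j = []"
| "adic_word b (Suc n) j = adic_word b n (j div b) @ [j mod b]"

lemma adic_word_in_lists: "b > 0 \<Longrightarrow> adic_word b n j \<in> lists {..<b}"
  by (induction n arbitrary: j) auto

lemma adic_word_append:
  assumes "b > 0" "l < b ^ k"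
  shows "adic_word b (n + k) (j * b ^ k + l) = adic_word b n j @ adic_word b k l"
  using assms(2)
proof (induction k arbitrary: l)
  case (Suc k)
  have e: "j * b ^ Suc k + l = l + (j * b ^ k) * b"
    by simp
  have "(j * b ^ Suc k + l) div b = j * b ^ k + l div b"
    unfolding e using assms(1) by (simp add: div_mult_self1)
  moreover have "(j * b ^ Suc k + l) mod b = l mod b"
    unfolding e by (rule mod_mult_self1)
  moreover have "l div b < b ^ k"
    using Suc.prems by (simp add: less_mult_imp_div_less mult.commute)
  ultimately show ?case
    using Suc.IH[of "l div b"] by (simp del: power_Suc)
qed simp

lemma adic_word_Cons:
  assumes "b > 0" "l < b ^ n" "i < b"
  shows "adic_word b (Suc n) (i * b ^ n + l) = i # adic_word b n l"
  using adic_word_append[OF assms(1,2), of 1 i] assms(3) by simp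

lemma sum_adic_snoc:
  "(\<Sum>l<j * b. f (adic_word b (Suc n) l)) = (\<Sum>l<j. \<Sum>i<b. f (adic_word b n l @ [i]))"
proof -
  have "(\<Sum>l<j * b. f (adic_word b (Suc n) l)) = (\<Sum>l<j. \<Sum>i\<in>{l * b..<l * b + b}. f (adic_word b (Suc n) i))"
    by (rule sum.nat_group[symmetric])
  also have "\<dots> = (\<Sum>l<j. \<Sum>i<b. f (adic_word b n l @ [i]))"
  proof (rule sum.cong[OF refl])
    fix l
    have "(\<Sum>i\<in>{l * b..<l * b + b}. f (adic_word b (Suc n) i)) = (\<Sum>i\<in>{0..<b}. f (adic_word b (Suc n) (i + l * b)))"
      using sum.shift_bounds_nat_ivl[of "\<lambda>i. f (adic_word b (Suc n) i)" 0 "l * b" b] by (simp add: add.commute)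
    also have "\<dots> = (\<Sum>i<b. f (adic_word b n l @ [i]))"
      by (intro sum.cong) auto
    finally show "(\<Sum>i\<in>{l * b..<l * b + b}. f (adic_word b (Suc n) i)) = (\<Sum>i<b. f (adic_word b n l @ [i]))" .
  qed
  finally show ?thesis .
qed

lemma sum_adic_Cons:
  assumes "b > 0" "a < b" "i \<le> b ^ n"
  shows "(\<Sum>l<a * b ^ n + i. f (adic_word b (Suc n) l)) =
    (\<Sum>c<a. \<Sum>l<b ^ n. f (c # adic_word b n l)) + (\<Sum>l<i. f (a # adic_word b n l))"
proof -
  have block: "(\<Sum>l\<in>{c * b ^ n..<c * b ^ n + m}. f (adic_word b (Suc n) l)) = (\<Sum>l<m. f (c # adic_word b n l))"
    if "c < b" "m \<le> b ^ n" for c m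
  proof -
    have "(\<Sum>l\<in>{c * b ^ n..<c * b ^ n + m}. f (adic_word b (Suc n) l)) =
        (\<Sum>l\<in>{0..<m}. f (adic_word b (Suc n) (c * b ^ n + l)))"
      using sum.shift_bounds_nat_ivl[of "\<lambda>i. f (adic_word b (Suc n) i)" 0 "c * b ^ n" m]
      by (simp add: add.commute)
    also have "\<dots> = (\<Sum>l<m. f (c # adic_word b n l))"
      using that assms(1) by (intro sum.cong) (auto simp: adic_word_Cons simp del: adic_word.simps)
    finally show ?thesis .
  qed
  have "(\<Sum>l<a * b ^ n + i. f (adic_word b (Suc n) l)) =
      (\<Sum>l<a * b ^ n. f (adic_word b (Suc n) l)) + (\<Sum>l\<in>{a * b ^ n..<a * b ^ n + i}. f (adic_word b (Suc n) l))"
    by (subst sum.union_disjoint[symmetric]) (auto intro!: sum.cong simp del: adic_word.simps)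
  also have "(\<Sum>l<a * b ^ n. f (adic_word b (Suc n) l)) = (\<Sum>c<a. \<Sum>l<b ^ n. f (c # adic_word b n l))"
    unfolding sum.nat_group[symmetric] using assms(2) by (intro sum.cong refl block) auto
  finally show ?thesis
    using assms by (simp add: block del: adic_word.simps)
qed

section \<open>Conservative weights\<close>

definition conservative :: "nat \<Rightarrow> (nat list \<Rightarrow> nat \<Rightarrow> complex) \<Rightarrow> bool" where
  "conservative b x \<longleftrightarrow> (\<forall>w\<in>lists {..<b}. (\<Sum>i<b. x w i) = 1)"

text \<open>Conservation of mass: splitting each interval of generation \<open>n\<close> into \<open>b\<^sup>k\<close> pieces does not change sums.\<close>

lemma sum_weight_refine:
  assumes "b > 0" "conservative b x" "w \<in> lists {..<b}"
  shows "(\<Sum>l<j * b ^ k. word_weight x w (adic_word b (n + k) l)) = (\<Sum>l<j. word_weight x w (adic_word b n l))"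
proof (induction k)
  case (Suc k)
  have *: "(\<Sum>l<m * b. word_weight x w (adic_word b (Suc q) l)) = (\<Sum>l<m. word_weight x w (adic_word b q l))" for m q
  proof -
    have "(\<Sum>i<b. word_weight x w (adic_word b q l @ [i])) = word_weight x w (adic_word b q l)" for l
      using assms(2,3) adic_word_in_lists[OF assms(1), of q l]
      by (simp add: word_weight_snoc conservative_def flip: sum_distrib_left)
    then show ?thesis
      by (subst sum_adic_snoc) simp
  qed
  show ?case
    using *[where m = "j * b ^ k" and q = "n + k"] Suc
    by (simp only: power_Suc2 mult.assoc[symmetric] add_Suc_right)
qed simp

lemma sum_weight_total:
  assumes "b > 0" "conservative b x" "w \<in> lists {..<b}"
  shows "(\<Sum>l<b ^ n. word_weight x w (adic_word b n l)) = 1"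
  using sum_weight_refine[OF assms, where j = 1 and k = n and n = 0] by simp

text \<open>The partial sums over a generation are the values of the cascade at adic points. At the first letter
  \<open>a\<close> they are an affine image of the corresponding sum for the subtree at \<open>a\<close>. If the weight of \<open>a\<close> has modulus
  one, this map is the identity or \<open>z \<mapsto> 1 - z\<close>, both of which preserve the distance to \<open>1/2\<close>; otherwise it
  contracts by \<open>\<gamma>\<close> and shifts by at most \<open>b\<close>. The bound survives both kinds of step and is therefore
  uniform in the generation.\<close>

lemma centred_partial_sums_bounded:
  fixes \<gamma> :: real
  assumes b: "b > 0" and \<gamma>: "0 < \<gamma>" "\<gamma> < 1" and cons: "conservative b x"
    and step: "\<forall>w\<in>lists {..<b}. \<forall>i<b. norm (x w i) \<le> \<gamma> \<or>
      norm (x w i) = 1 \<and> ((\<Sum>k<i. x w k), (\<Sum>k\<le>i. x w k)) \<in> {(0, 1), (1, 0)}"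
    and w: "w \<in> lists {..<b}" and i: "i \<le> b ^ n"
  shows "norm ((\<Sum>l<i. word_weight x w (adic_word b n l)) - 1 / 2) \<le> (real b + 1) / (1 - \<gamma>)"
  using w i
proof (induction n arbitrary: w i)
  define D where "D = (real b + 1) / (1 - \<gamma>)"
  \<comment> \<open>A contracting step takes the bound \<open>D\<close> to at most \<open>b - 1/2 + \<gamma> (D + 1/2)\<close>, which must not exceed \<open>D\<close>.\<close>
  have D: "D = real b + 1 + \<gamma> * D"
    using \<gamma> by (simp add: D_def field_simps)
  have "\<gamma> * D \<ge> 0"
    using \<gamma> by (simp add: D_def)
  then have D1: "D \<ge> 1"
    using D by linarith
  {
    case 0
    then have "i = 0 \<or> i = 1" by auto
    then show ?case using D1 unfolding D_def[symmetric] by (auto simp: norm_divide)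
  next
    case (Suc n)
    note x = step[rule_format, OF Suc.prems(1)]
    show ?case
    proof (cases "i = b ^ Suc n")
      case True
      then show ?thesis
        using sum_weight_total[OF b cons Suc.prems(1), of "Suc n"] D1
        unfolding D_def[symmetric] by (simp add: True norm_divide del: adic_word.simps)
    next
      case False
      define a i' where "a = i div b ^ n" and "i' = i mod b ^ n"
      have i_eq: "i = a * b ^ n + i'" and i': "i' \<le> b ^ n"
        using b by (simp_all add: a_def i'_def less_imp_le del: mod_div_mult_eq add: div_mult_mod_eq)
      have "i < b ^ n * b"
        using False Suc.prems by (simp add: mult.commute)
      then have a: "a < b"
        unfolding a_def by (metis less_mult_imp_div_less mult.commute)
      define p where "p = (\<Sum>l<i'. word_weight x (w @ [a]) (adic_word b n l))"
      have p: "norm (p - 1 / 2) \<le> D"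
        unfolding p_def D_def using Suc.prems(1) a i' by (intro Suc.IH) auto
      have "(\<Sum>l<i. word_weight x w (adic_word b (Suc n) l)) = (\<Sum>c<a. x w c) + x w a * p"
      proof -
        have "(\<Sum>l<b ^ n. word_weight x w (c # adic_word b n l)) = x w c" if "c < a" for c
          using sum_weight_total[OF b cons, of "w @ [c]" n] Suc.prems(1) that a
          by (simp add: word_weight_Cons flip: sum_distrib_left)
        then show ?thesis
          unfolding i_eq sum_adic_Cons[OF b a i'] p_def
          by (simp add: word_weight_Cons sum_distrib_left)
      qed
      moreover have "norm ((\<Sum>c<a. x w c) + x w a * p - 1 / 2) \<le> D"
      proof (cases "norm (x w a) \<le> \<gamma>")
        case True
        have "norm (\<Sum>c<a. x w c) \<le> (\<Sum>c<a. 1)"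
        proof (rule sum_norm_le)
          fix c assume "c \<in> {..<a}"
          then show "norm (x w c) \<le> 1"
            using x[of c] a \<gamma>(2) by auto
        qed
        then have s: "norm (\<Sum>c<a. x w c) \<le> real b - 1"
          using a by simp
        have "norm p \<le> norm (p - 1 / 2) + norm (1 / 2 :: complex)"
          using norm_triangle_ineq[of "p - 1 / 2" "1 / 2"] by simp
        then have "norm p \<le> D + 1 / 2"
          using p by (simp add: norm_divide)
        then have "norm (x w a * p) \<le> \<gamma> * (D + 1 / 2)"
          unfolding norm_mult using True by (intro mult_mono) (use \<gamma> in auto)
        moreover have "norm ((\<Sum>c<a. x w c) + x w a * p - 1 / 2) \<le>
            norm (\<Sum>c<a. x w c) + norm (x w a * p) + norm (1 / 2 :: complex)"
          by (intro order_trans[OF norm_triangle_ineq4] add_mono norm_triangle_ineq order_refl)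
        ultimately have "norm ((\<Sum>c<a. x w c) + x w a * p - 1 / 2) \<le> real b - 1 + \<gamma> * (D + 1 / 2) + 1 / 2"
          using s by (simp add: norm_divide)
        also have "\<dots> \<le> D"
          using D \<gamma> by (simp add: algebra_simps)
        finally show ?thesis .
      next
        case False
        then have *: "((\<Sum>k<a. x w k), (\<Sum>k\<le>a. x w k)) \<in> {(0, 1), (1, 0)}"
          using x[OF a] by auto
        have xa: "x w a = (\<Sum>k\<le>a. x w k) - (\<Sum>k<a. x w k)"
          by (simp flip: lessThan_Suc_atMost)
        from * consider "(\<Sum>k<a. x w k) = 0" "(\<Sum>k\<le>a. x w k) = 1" | "(\<Sum>k<a. x w k) = 1" "(\<Sum>k\<le>a. x w k) = 0"
          by auto
        then show ?thesis
        proof cases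
          case 1
          then show ?thesis using p xa by simp
        next
          case 2
          then have "(\<Sum>c<a. x w c) + x w a * p - 1 / 2 = - (p - 1 / 2)"
            using xa by simp
          then show ?thesis using p by (metis norm_minus_cancel)
        qed
      qed
      ultimately show ?thesis
        by (simp add: D_def del: adic_word.simps)
    qed
  }
qed

section \<open>Sums of powers over a generation\<close>

fun moment_sum :: "nat \<Rightarrow> nat \<Rightarrow> nat \<Rightarrow> nat list \<Rightarrow> (nat list \<Rightarrow> nat \<Rightarrow> complex) \<Rightarrow> real" where
  "moment_sum b k 0 w x = 1"
| "moment_sum b k (Suc N) w x = (\<Sum>i<b. norm (x w i) ^ k * moment_sum b k N (w @ [i]) x)"

lemma moment_sum_nonneg: "moment_sum b k N w x \<ge> 0"
  by (induction N arbitrary: w) (auto intro!: sum_nonneg)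

lemma moment_sum_eq:
  assumes "b > 0"
  shows "moment_sum b k N w x = (\<Sum>l<b ^ N. norm (word_weight x w (adic_word b N l)) ^ k)"
proof (induction N arbitrary: w)
  case (Suc N)
  obtain b' where b': "b = Suc b'"
    using assms by (cases b) auto
  have "(\<Sum>l<b ^ Suc N. norm (word_weight x w (adic_word b (Suc N) l)) ^ k) =
      (\<Sum>i<b. \<Sum>l<b ^ N. norm (word_weight x w (i # adic_word b N l)) ^ k)"
    using sum_adic_Cons[of b b' "b ^ N" N "\<lambda>v. norm (word_weight x w v) ^ k"]
    by (simp add: b' add.commute del: adic_word.simps)
  then show ?case
    by (simp add: Suc word_weight_Cons norm_mult power_mult_distrib sum_distrib_left del: adic_word.simps)
qed simp

lemma moment_sum_cong:
  assumes "\<And>v. v \<in> lists {..<b} \<Longrightarrow> x (w @ v) = y (w @ v)"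
  shows "moment_sum b k N w x = moment_sum b k N w y"
  using assms
proof (induction N arbitrary: w)
  case (Suc N)
  have "x w = y w"
    using Suc.prems[of "[]"] by simp
  moreover have "moment_sum b k N (w @ [i]) x = moment_sum b k N (w @ [i]) y" if "i < b" for i
    using Suc.prems[of "i # v" for v] that by (intro Suc.IH) auto
  ultimately show ?case
    by simp
qed simp

section \<open>The cascade at adic points\<close>

lemma digit_word_eq_adic_word:
  assumes "b > 0" "u \<ge> 0"
  shows "digit_word b u n = adic_word b n (nat \<lfloor>u * real b ^ n\<rfloor>)"
proof (induction n)
  case (Suc n)
  have "\<lfloor>u * real b ^ n\<rfloor> = \<lfloor>u * real b ^ Suc n / real b\<rfloor>"
    using assms by simp
  also have "\<dots> = \<lfloor>u * real b ^ Suc n\<rfloor> div int b"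
    using floor_divide_real_eq_div[of "int b" "u * real b ^ Suc n"] by simp
  finally have "nat \<lfloor>u * real b ^ Suc n\<rfloor> div b = nat \<lfloor>u * real b ^ n\<rfloor>"
    using assms by (metis nat_div_distrib nat_int of_nat_0_le_iff zero_le_floor zero_le_mult_iff zero_le_power)
  then show ?case
    using Suc by (simp add: digit_word_def digit_def del: power_Suc)
qed (simp add: digit_word_def)

lemma prod_digits_eq_word_weight:
  "(\<Prod>k=1..n. x (digit_word b u (k - 1)) (digit b u k)) = word_weight x [] (digit_word b u n)"
proof (induction n)
  case (Suc n)
  have "digit_word b u (Suc n) = digit_word b u n @ [digit b u (Suc n)]"
    by (simp add: digit_word_def)
  then show ?case
    using Suc by (simp add: word_weight_snoc)
qed (simp add: digit_word_def)

text \<open>The integrand is constant on the adic intervals of generation \<open>n\<close>. The closed interval of integration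
  contains its right end point, at which the two sides may differ; it is a null set.\<close>

lemma cascade_at_adic_point:
  assumes b: "b > 0"
  shows "cascade b V n \<omega> (real j / real b ^ n) = (\<Sum>l<j. word_weight (\<lambda>w. V w \<omega>) [] (adic_word b n l))"
proof -
  define q where "q l = word_weight (\<lambda>w. V w \<omega>) [] (adic_word b n l)" for l
  define t where "t = real j / real b ^ n"
  define I where "I l = {real l / real b ^ n..<(real l + 1) / real b ^ n}" for l
  have bn: "real b ^ n > 0"
    using b by simp
  have in_I: "u \<in> I l \<longleftrightarrow> l = nat \<lfloor>u * real b ^ n\<rfloor>" if "u \<ge> 0" for u l
  proof -
    have "u \<in> I l \<longleftrightarrow> real l \<le> u * real b ^ n \<and> u * real b ^ n < real l + 1"
      using bn by (simp add: I_def divide_simps mult.commute)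
    also have "\<dots> \<longleftrightarrow> \<lfloor>u * real b ^ n\<rfloor> = int l"
      by (simp add: floor_eq_iff)
    also have "\<dots> \<longleftrightarrow> l = nat \<lfloor>u * real b ^ n\<rfloor>"
      using that bn by (auto simp: zero_le_floor)
    finally show ?thesis .
  qed
  have pt: "indicator {0..t} u *\<^sub>R (of_nat b ^ n * (\<Prod>k=1..n. V (digit_word b u (k - 1)) \<omega> (digit b u k))) =
      (\<Sum>l<j. indicator (I l) u *\<^sub>R (of_nat b ^ n * q l))" if "u \<noteq> t" for u
  proof (cases "0 \<le> u \<and> u \<le> t")
    case True
    then have "u < t" using that by simp
    define m where "m = nat \<lfloor>u * real b ^ n\<rfloor>"
    have "u * real b ^ n < real j"
      using \<open>u < t\<close> bn by (simp add: t_def field_simps)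
    then have "m < j"
      unfolding m_def using True bn by (auto simp: floor_less_iff nat_less_iff)
    have "(\<Sum>l<j. indicator (I l) u *\<^sub>R (of_nat b ^ n * q l)) = (\<Sum>l<j. if l = m then of_nat b ^ n * q l else 0)"
      using True by (intro sum.cong) (auto simp: indicator_def in_I m_def)
    also have "\<dots> = of_nat b ^ n * q m"
      using \<open>m < j\<close> by simp
    also have "q m = (\<Prod>k=1..n. V (digit_word b u (k - 1)) \<omega> (digit b u k))"
      unfolding q_def m_def using prod_digits_eq_word_weight[of "\<lambda>w. V w \<omega>" b u n] True b
      by (simp add: digit_word_eq_adic_word)
    finally show ?thesis
      using True by simp
  next
    case False
    have "indicator (I l) u = (0::real)" if "l < j" for l
    proof (cases "u < 0")
      case True
      have "0 \<le> real l / real b ^ n" using bn by simp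
      then have "u \<notin> I l" using True unfolding I_def atLeastLessThan_iff by linarith
      then show ?thesis by simp
    next
      case nn: False
      have "(real l + 1) / real b ^ n \<le> t"
        using that bn by (simp add: t_def divide_right_mono)
      then show ?thesis
        using False nn by (simp add: I_def)
    qed
    then show ?thesis
      using False by simp
  qed
  have "has_bochner_integral lborel (\<lambda>u. \<Sum>l<j. indicator (I l) u *\<^sub>R (of_nat b ^ n * q l :: complex))
      (\<Sum>l<j. measure lborel (I l) *\<^sub>R (of_nat b ^ n * q l))"
    by (intro has_bochner_integral_sum has_bochner_integral_scaleR_left has_bochner_integral_real_indicator)
      (auto simp: I_def emeasure_lborel_Ico divide_right_mono)
  moreover have "measure lborel (I l) = 1 / real b ^ n" for l
    using bn by (simp add: I_def divide_right_mono flip: diff_divide_distrib)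
  ultimately have "(LINT u|lborel. (\<Sum>l<j. indicator (I l) u *\<^sub>R (of_nat b ^ n * q l))) = (\<Sum>l<j. q l)"
    using b by (simp add: has_bochner_integral_integral_eq scaleR_conv_of_real)
  moreover have "cascade b V n \<omega> t = (LINT u|lborel. (\<Sum>l<j. indicator (I l) u *\<^sub>R (of_nat b ^ n * q l)))"
    unfolding cascade_def set_lebesgue_integral_def
  proof (rule integral_cong_AE)
    have *: "AE u in lborel. u \<noteq> t"
      by (rule AE_lborel_singleton)
    then show ae: "AE u in lborel. indicator {0..t} u *\<^sub>R (of_nat b ^ n * (\<Prod>k=1..n. V (digit_word b u (k - 1)) \<omega> (digit b u k))) =
      (\<Sum>l<j. indicator (I l) u *\<^sub>R (of_nat b ^ n * q l))"
      by (rule AE_mp) (rule AE_I2, use pt in blast)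
    show meas: "(\<lambda>u. \<Sum>l<j. indicator (I l) u *\<^sub>R (of_nat b ^ n * q l)) \<in> borel_measurable lborel"
      unfolding I_def by measurable
    have "(\<lambda>u. indicator {0..t} u *\<^sub>R (of_nat b ^ n * word_weight (\<lambda>w. V w \<omega>) [] (adic_word b n (nat \<lfloor>u * real b ^ n\<rfloor>))))
        \<in> borel_measurable borel"
    proof -
      have "(\<lambda>u. (\<lambda>m::int. of_nat b ^ n * word_weight (\<lambda>w. V w \<omega>) [] (adic_word b n (nat m))) \<lfloor>u * real b ^ n\<rfloor>) \<in> borel_measurable borel"
        by (rule measurable_compose[where N = "count_space UNIV"]) auto
      then show ?thesis by simp
    qed
    moreover have "(\<lambda>u. indicator {0..t} u *\<^sub>R (of_nat b ^ n * (\<Prod>k=1..n. V (digit_word b u (k - 1)) \<omega> (digit b u k)))) =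
      (\<lambda>u. indicator {0..t} u *\<^sub>R (of_nat b ^ n * word_weight (\<lambda>w. V w \<omega>) [] (adic_word b n (nat \<lfloor>u * real b ^ n\<rfloor>))))"
    proof
      fix u
      show "indicator {0..t} u *\<^sub>R (of_nat b ^ n * (\<Prod>k=1..n. V (digit_word b u (k - 1)) \<omega> (digit b u k))) =
        indicator {0..t} u *\<^sub>R (of_nat b ^ n * word_weight (\<lambda>w. V w \<omega>) [] (adic_word b n (nat \<lfloor>u * real b ^ n\<rfloor>)))"
        using prod_digits_eq_word_weight[of "\<lambda>w. V w \<omega>" b u n] b
        by (cases "u \<ge> 0") (auto simp: digit_word_eq_adic_word)
    qed
    ultimately show "(\<lambda>u. indicator {0..t} u *\<^sub>R (of_nat b ^ n * (\<Prod>k=1..n. V (digit_word b u (k - 1)) \<omega> (digit b u k))))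
        \<in> borel_measurable lborel"
      by simp
  qed
  ultimately show ?thesis
    unfolding t_def q_def by simp
qed

lemma cascade_limit_at_adic_point:
  assumes b: "b > 0" and cons: "conservative b (\<lambda>w. V w \<omega>)"
  shows "cascade_limit b V \<omega> (real j / real b ^ n) = (\<Sum>l<j. word_weight (\<lambda>w. V w \<omega>) [] (adic_word b n l))"
  unfolding cascade_limit_def
proof (rule limI, rule tendsto_eventually, rule eventually_sequentiallyI)
  fix N assume "n \<le> N"
  then have "real j / real b ^ n = real (j * b ^ (N - n)) / real b ^ N"
    using b by (simp add: power_add[symmetric] divide_simps flip: of_nat_mult of_nat_power)
  then have "cascade b V N \<omega> (real j / real b ^ n) = (\<Sum>l<j * b ^ (N - n). word_weight (\<lambda>w. V w \<omega>) [] (adic_word b N l))"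
    using cascade_at_adic_point[OF b] by metis
  then show "cascade b V N \<omega> (real j / real b ^ n) = (\<Sum>l<j. word_weight (\<lambda>w. V w \<omega>) [] (adic_word b n l))"
    using sum_weight_refine[OF b cons, of "[]", where j = j and k = "N - n" and n = n] \<open>n \<le> N\<close> by simp
qed

section \<open>Independence along the branches of the cascade\<close>

definition descendants :: "nat \<Rightarrow> nat list \<Rightarrow> nat list set" where
  "descendants b w = {w @ v | v. v \<in> lists {..<b}}"

lemma self_in_descendants: "w \<in> descendants b w"
  unfolding descendants_def by (rule CollectI, rule exI[of _ "[]"]) simp

lemma measurable_coordinate:
  "w \<in> K \<Longrightarrow> i < b \<Longrightarrow> (\<lambda>x. x w i) \<in> borel_measurable (PiM K (\<lambda>_. cvec_borel b))"
  using measurable_compose[OF measurable_component_singleton[of w K "\<lambda>_. cvec_borel b"]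
      measurable_component_singleton[of i "{..<b}" "\<lambda>_. borel"]] by simp

lemma measurable_moment_sum:
  assumes "descendants b w \<subseteq> K"
  shows "moment_sum b k N w \<in> borel_measurable (PiM K (\<lambda>_. cvec_borel b))"
  using assms
proof (induction N arbitrary: w)
  case (Suc N)
  have "w \<in> K"
    by (rule subsetD[OF Suc.prems self_in_descendants])
  have "(\<lambda>x. norm (x w i) ^ k * moment_sum b k N (w @ [i]) x) \<in> borel_measurable (PiM K (\<lambda>_. cvec_borel b))"
    if "i < b" for i
  proof -
    have "descendants b (w @ [i]) \<subseteq> descendants b w"
    proof
      fix u assume "u \<in> descendants b (w @ [i])"
      then obtain v where v: "v \<in> lists {..<b}" "u = (w @ [i]) @ v"
        unfolding descendants_def mem_Collect_eq by (elim exE conjE)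
      then show "u \<in> descendants b w"
        unfolding descendants_def mem_Collect_eq using that by (intro exI[of _ "i # v"]) simp
    qed
    then have *: "moment_sum b k N (w @ [i]) \<in> borel_measurable (PiM K (\<lambda>_. cvec_borel b))"
      using Suc.prems by (intro Suc.IH) blast
    show ?thesis
      using * measurable_coordinate[OF \<open>w \<in> K\<close> that]
      by (intro borel_measurable_times borel_measurable_power borel_measurable_norm) auto
  qed
  moreover have "moment_sum b k (Suc N) w = (\<lambda>x. \<Sum>i<b. norm (x w i) ^ k * moment_sum b k N (w @ [i]) x)"
    by auto
  ultimately show ?case
    by (simp add: borel_measurable_sum)
next
  case 0
  have "moment_sum b k 0 w = (\<lambda>x. 1)"
    by auto
  then show ?case by simp
qed

lemma moment_sum_restrict:
  "moment_sum b k N w (restrict x (descendants b w)) = moment_sum b k N w x"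
  by (rule moment_sum_cong) (auto simp: descendants_def)

locale cascade_weights = prob_space M for M :: "'a measure" +
  fixes b :: nat and W :: "'a \<Rightarrow> nat \<Rightarrow> complex" and V :: "nat list \<Rightarrow> 'a \<Rightarrow> nat \<Rightarrow> complex"
  assumes b: "b \<ge> 2"
    and W_measurable [measurable]: "W \<in> measurable M (cvec_borel b)"
    and copies: "independent_copies M b W V"
    and weight_le_one: "AE \<omega> in M. \<forall>i<b. norm (W \<omega> i) \<le> 1"
    and weight_nonzero: "AE \<omega> in M. \<forall>i<b. W \<omega> i \<noteq> 0"
begin

lemma V_measurable: "w \<in> lists {..<b} \<Longrightarrow> V w \<in> measurable M (cvec_borel b)"
  using copies unfolding independent_copies_def indep_vars_def by blast

lemma V_distr: "w \<in> lists {..<b} \<Longrightarrow> distr M (cvec_borel b) (V w) = distr M (cvec_borel b) W"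
  using copies unfolding independent_copies_def by blast

lemma AE_copy:
  assumes "w \<in> lists {..<b}" "Measurable.pred (cvec_borel b) P" "AE \<omega> in M. P (W \<omega>)"
  shows "AE \<omega> in M. P (V w \<omega>)"
proof -
  have *: "{x \<in> space (cvec_borel b). P x} \<in> sets (cvec_borel b)"
    using assms(2) by (rule predE)
  have "AE x in distr M (cvec_borel b) W. P x"
    using assms(3) by (subst AE_distr_iff[OF W_measurable *])
  then have "AE x in distr M (cvec_borel b) (V w). P x"
    by (simp only: V_distr[OF assms(1)])
  then show ?thesis
    by (subst (asm) AE_distr_iff[OF V_measurable[OF assms(1)] *])
qed

lemma nn_integral_copy:
  assumes "w \<in> lists {..<b}" "f \<in> borel_measurable (cvec_borel b)"
  shows "(\<integral>\<^sup>+\<omega>. f (V w \<omega>) \<partial>M) = (\<integral>\<^sup>+\<omega>. f (W \<omega>) \<partial>M)"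
  using nn_integral_distr[OF V_measurable[OF assms(1)], of f] nn_integral_distr[OF W_measurable, of f] assms(2)
  by (simp add: V_distr[OF assms(1)])

text \<open>The weights at \<open>w\<close> and the families of weights below its distinct children are mutually independent. This
  is the only form in which the independence of the copies is used.\<close>

lemma nn_integral_branch:
  fixes g :: "nat \<Rightarrow> (nat list \<Rightarrow> nat \<Rightarrow> complex) \<Rightarrow> ennreal"
  assumes w: "w \<in> lists {..<b}" and J: "J \<subseteq> {..<b}"
    and f: "f \<in> borel_measurable (cvec_borel b)"
    and g: "\<And>i. i \<in> J \<Longrightarrow> g i \<in> borel_measurable (PiM (descendants b (w @ [i])) (\<lambda>_. cvec_borel b))"
    and g_restrict: "\<And>i x. i \<in> J \<Longrightarrow> g i (restrict x (descendants b (w @ [i]))) = g i x"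
  shows "(\<integral>\<^sup>+\<omega>. f (V w \<omega>) * (\<Prod>i\<in>J. g i (\<lambda>v. V v \<omega>)) \<partial>M) =
    (\<integral>\<^sup>+\<omega>. f (W \<omega>) \<partial>M) * (\<Prod>i\<in>J. \<integral>\<^sup>+\<omega>. g i (\<lambda>v. V v \<omega>) \<partial>M)"
proof -
  define K where "K j = (case j of None \<Rightarrow> {w} | Some i \<Rightarrow> descendants b (w @ [i]))" for j
  define h where "h j = (case j of None \<Rightarrow> (\<lambda>x. f (x w)) | Some i \<Rightarrow> g i)" for j
  define L where "L = insert None (Some ` J)"
  have fin: "finite J"
    using J finite_subset by blast
  have "disjoint_family_on K L"
    unfolding disjoint_family_on_def L_def K_def descendants_def by (auto split: option.splits)
  moreover have "K j \<subseteq> lists {..<b}" if "j \<in> L" for j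
  proof (cases j)
    case None
    then show ?thesis using w by (simp add: K_def)
  next
    case (Some i)
    then have "i < b"
      using that J by (auto simp: L_def)
    then show ?thesis
      using w Some by (auto simp: K_def descendants_def)
  qed
  ultimately have "indep_vars (\<lambda>j. PiM (K j) (\<lambda>_. cvec_borel b)) (\<lambda>j \<omega>. restrict (\<lambda>v. V v \<omega>) (K j)) L"
    using copies unfolding independent_copies_def by (intro indep_vars_restrict) auto
  moreover have "h j \<in> borel_measurable (PiM (K j) (\<lambda>_. cvec_borel b))" if "j \<in> L" for j
  proof (cases j)
    case None
    then show ?thesis
      using measurable_compose[OF measurable_component_singleton[of w "{w}" "\<lambda>_. cvec_borel b"] f]
      by (simp add: h_def K_def)
  next
    case (Some i)
    then show ?thesis
      using that g by (auto simp: h_def K_def L_def)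
  qed
  ultimately have "indep_vars (\<lambda>_. borel) (\<lambda>j \<omega>. h j (restrict (\<lambda>v. V v \<omega>) (K j))) L"
    by (rule indep_vars_compose2)
  then have "(\<integral>\<^sup>+\<omega>. (\<Prod>j\<in>L. h j (restrict (\<lambda>v. V v \<omega>) (K j))) \<partial>M) =
      (\<Prod>j\<in>L. \<integral>\<^sup>+\<omega>. h j (restrict (\<lambda>v. V v \<omega>) (K j)) \<partial>M)"
    using fin by (intro indep_vars_nn_integral) (auto simp: L_def)
  moreover have "(\<Prod>j\<in>L. \<phi> j) = \<phi> None * (\<Prod>i\<in>J. \<phi> (Some i))" for \<phi> :: "nat option \<Rightarrow> ennreal"
    using fin unfolding L_def by (subst prod.insert) (auto simp: prod.reindex)
  moreover have "h None (restrict (\<lambda>v. V v \<omega>) (K None)) = f (V w \<omega>)" for \<omega>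
    by (simp add: h_def K_def)
  moreover have "h (Some i) (restrict (\<lambda>v. V v \<omega>) (K (Some i))) = g i (\<lambda>v. V v \<omega>)" if "i \<in> J" for i \<omega>
    using g_restrict[OF that] by (simp add: h_def K_def)
  ultimately show ?thesis
    by (simp add: nn_integral_copy[OF w f] cong: prod.cong)
qed

section \<open>First and second moments of the power sums\<close>

abbreviation S :: "nat \<Rightarrow> nat \<Rightarrow> nat list \<Rightarrow> 'a \<Rightarrow> real" where
  "S p N w \<omega> \<equiv> moment_sum b p N w (\<lambda>v. V v \<omega>)"

definition moment :: "nat \<Rightarrow> real" where
  "moment p = (\<integral>\<omega>. (\<Sum>i<b. norm (W \<omega> i) ^ p) \<partial>M)"

lemma coordinate_measurable: "i < b \<Longrightarrow> (\<lambda>x. x i) \<in> borel_measurable (cvec_borel b)"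
  by (rule measurable_component_singleton) simp

lemma W_coordinate_measurable: "i < b \<Longrightarrow> (\<lambda>\<omega>. W \<omega> i) \<in> borel_measurable M"
  using measurable_compose[OF W_measurable coordinate_measurable] .

lemma S_measurable:
  assumes "w \<in> lists {..<b}"
  shows "(\<lambda>\<omega>. S p N w \<omega>) \<in> borel_measurable M"
proof -
  have "(\<lambda>\<omega>. restrict (\<lambda>v. V v \<omega>) (descendants b w)) \<in> measurable M (PiM (descendants b w) (\<lambda>_. cvec_borel b))"
    using assms by (intro measurable_restrict V_measurable) (auto simp: descendants_def)
  from measurable_compose[OF this measurable_moment_sum[OF order_refl]]
  show ?thesis by (simp add: moment_sum_restrict)
qed

lemma integrable_norm_power: "i < b \<Longrightarrow> integrable M (\<lambda>\<omega>. norm (W \<omega> i) ^ p)"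
proof (rule integrable_const_bound[where B = 1])
  assume i: "i < b"
  show "AE \<omega> in M. norm (norm (W \<omega> i) ^ p) \<le> 1"
    using weight_le_one by eventually_elim (use i in \<open>auto intro!: power_le_one\<close>)
  show "(\<lambda>\<omega>. norm (W \<omega> i) ^ p) \<in> borel_measurable M"
    using W_coordinate_measurable[OF i] by simp
qed

lemma moment_eq_sum: "moment p = (\<Sum>i<b. \<integral>\<omega>. norm (W \<omega> i) ^ p \<partial>M)"
  unfolding moment_def by (rule Bochner_Integration.integral_sum) (simp add: integrable_norm_power)

lemma moment_le: "moment p \<le> real b"
proof -
  have "moment p \<le> (\<Sum>i<b. 1)"
    unfolding moment_eq_sum
  proof (rule sum_mono)
    fix i assume i: "i \<in> {..<b}"
    have "(\<integral>\<omega>. norm (W \<omega> i) ^ p \<partial>M) \<le> (\<integral>\<omega>. 1 \<partial>M)"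
    proof (rule integral_mono_AE)
      show "AE \<omega> in M. norm (W \<omega> i) ^ p \<le> 1"
        using weight_le_one by eventually_elim (use i in \<open>auto intro!: power_le_one\<close>)
    qed (use i integrable_norm_power in auto)
    then show "(\<integral>\<omega>. norm (W \<omega> i) ^ p \<partial>M) \<le> 1"
      by (simp add: prob_space)
  qed
  then show ?thesis by simp
qed

lemma moment_nonneg: "0 \<le> moment p"
  unfolding moment_def by (intro Bochner_Integration.integral_nonneg sum_nonneg) simp

lemma nn_integral_norm_power:
  "i < b \<Longrightarrow> (\<integral>\<^sup>+\<omega>. ennreal (norm (W \<omega> i) ^ p) \<partial>M) = ennreal (\<integral>\<omega>. norm (W \<omega> i) ^ p \<partial>M)"
  by (rule nn_integral_eq_integral[OF integrable_norm_power]) auto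

lemma ennreal_S_Suc:
  "ennreal (S p (Suc N) w \<omega>) = (\<Sum>i<b. ennreal (norm (V w \<omega> i) ^ p) * ennreal (S p N (w @ [i]) \<omega>))"
  unfolding moment_sum.simps by (subst sum_ennreal[symmetric]) (auto simp: moment_sum_nonneg ennreal_mult)

lemma first_moment:
  assumes "w \<in> lists {..<b}"
  shows "(\<integral>\<^sup>+\<omega>. ennreal (S p N w \<omega>) \<partial>M) = ennreal (moment p ^ N)"
  using assms
proof (induction N arbitrary: w)
  case 0
  then show ?case by (simp add: emeasure_space_1)
next
  case (Suc N)
  have "(\<integral>\<^sup>+\<omega>. ennreal (S p (Suc N) w \<omega>) \<partial>M) =
      (\<integral>\<^sup>+\<omega>. (\<Sum>i<b. ennreal (norm (V w \<omega> i) ^ p) * ennreal (S p N (w @ [i]) \<omega>)) \<partial>M)"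
    by (simp only: ennreal_S_Suc)
  also have "\<dots> = (\<Sum>i<b. \<integral>\<^sup>+\<omega>. ennreal (norm (V w \<omega> i) ^ p) * ennreal (S p N (w @ [i]) \<omega>) \<partial>M)"
  proof (rule nn_integral_sum)
    fix i assume i: "i \<in> {..<b}"
    then have "w @ [i] \<in> lists {..<b}"
      using Suc.prems by auto
    note [measurable] = S_measurable[OF this]
      measurable_compose[OF V_measurable[OF Suc.prems] coordinate_measurable[OF lessThan_iff[THEN iffD1, OF i]]]
    show "(\<lambda>\<omega>. ennreal (norm (V w \<omega> i) ^ p) * ennreal (S p N (w @ [i]) \<omega>)) \<in> borel_measurable M"
      by measurable
  qed
  also have "\<dots> = (\<Sum>i<b. ennreal (\<integral>\<omega>. norm (W \<omega> i) ^ p \<partial>M) * ennreal (moment p ^ N))"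
  proof (rule sum.cong[OF refl])
    fix i assume i: "i \<in> {..<b}"
    have "(\<integral>\<^sup>+\<omega>. ennreal (norm (V w \<omega> i) ^ p) * (\<Prod>j\<in>{i}. ennreal (S p N (w @ [j]) \<omega>)) \<partial>M) =
        (\<integral>\<^sup>+\<omega>. ennreal (norm (W \<omega> i) ^ p) \<partial>M) * (\<Prod>j\<in>{i}. \<integral>\<^sup>+\<omega>. ennreal (S p N (w @ [j]) \<omega>) \<partial>M)"
      using i Suc.prems coordinate_measurable[of i] measurable_moment_sum[OF order_refl]
      by (intro nn_integral_branch[where f = "\<lambda>x. ennreal (norm (x i) ^ p)" and g = "\<lambda>j x. ennreal (moment_sum b p N (w @ [j]) x)"])
        (auto simp: moment_sum_restrict)
    then show "(\<integral>\<^sup>+\<omega>. ennreal (norm (V w \<omega> i) ^ p) * ennreal (S p N (w @ [i]) \<omega>) \<partial>M) =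
        ennreal (\<integral>\<omega>. norm (W \<omega> i) ^ p \<partial>M) * ennreal (moment p ^ N)"
      using i Suc by (simp add: nn_integral_norm_power)
  qed
  also have "\<dots> = ennreal (moment p ^ Suc N)"
  proof -
    have "(\<Sum>i<b. ennreal (\<integral>\<omega>. norm (W \<omega> i) ^ p \<partial>M)) = ennreal (moment p)"
      unfolding moment_eq_sum by (rule sum_ennreal) simp
    then show ?thesis
      unfolding power_Suc ennreal_mult[OF moment_nonneg zero_le_power[OF moment_nonneg]]
      by (simp only: sum_distrib_right[symmetric])
  qed
  finally show ?case .
qed

text \<open>The diagonal terms of the squared sum contribute at most \<open>m c m\<^sup>2\<^sup>N\<close> because the weights are at most one, and
  the others at most \<open>b\<^sup>2 m\<^sup>2\<^sup>N\<close> by independence of the subtrees. The constant \<open>c\<close> solves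
  \<open>m c + b\<^sup>2 = c m\<^sup>2\<close>, which has a positive solution exactly because \<open>m > 1\<close>.\<close>

lemma second_moment:
  assumes m: "moment p > 1" and w: "w \<in> lists {..<b}"
  defines "c \<equiv> (real b)\<^sup>2 / ((moment p)\<^sup>2 - moment p)"
  shows "(\<integral>\<^sup>+\<omega>. ennreal ((S p N w \<omega>)\<^sup>2) \<partial>M) \<le> ennreal (c * (moment p ^ N)\<^sup>2)"
  using w
proof (induction N arbitrary: w)
  case 0
  have "(moment p)\<^sup>2 \<le> (real b)\<^sup>2"
    using m moment_le by (intro power_mono) auto
  then have "1 \<le> c"
    using m unfolding c_def by (simp add: divide_simps power2_eq_square)
  then show ?case
    using ennreal_leI[of 1 c] by (simp add: emeasure_space_1)
next
  case (Suc N)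
  define \<mu> where "\<mu> = moment p"
  define n where "n i \<omega> = norm (V w \<omega> i) ^ p" for i \<omega>
  define T where "T i \<omega> = S p N (w @ [i]) \<omega>" for i \<omega>
  have nT: "n i \<omega> \<ge> 0" "T i \<omega> \<ge> 0" for i \<omega>
    by (auto simp: n_def T_def moment_sum_nonneg)
  have wi: "w @ [i] \<in> lists {..<b}" if "i < b" for i
    using that Suc.prems by auto
  have c0: "c \<ge> 0" and c_eq: "\<mu> * c + (real b)\<^sup>2 = c * \<mu>\<^sup>2"
  proof -
    have "\<mu>\<^sup>2 - \<mu> > 0"
      using m by (simp add: \<mu>_def power2_eq_square)
    then show "c \<ge> 0"
      unfolding c_def \<mu>_def by simp
    have "c * (\<mu>\<^sup>2 - \<mu>) = (real b)\<^sup>2"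
      using \<open>\<mu>\<^sup>2 - \<mu> > 0\<close> unfolding c_def \<mu>_def by simp
    then show "\<mu> * c + (real b)\<^sup>2 = c * \<mu>\<^sup>2"
      by (simp add: algebra_simps)
  qed
  have \<mu>0: "\<mu> \<ge> 0"
    using m by (simp add: \<mu>_def)
  have square: "ennreal ((S p (Suc N) w \<omega>)\<^sup>2) = (\<Sum>i<b. \<Sum>j<b. ennreal (n i \<omega> * n j \<omega>) * ennreal (T i \<omega> * T j \<omega>))" for \<omega>
  proof -
    have "(S p (Suc N) w \<omega>)\<^sup>2 = (\<Sum>i<b. \<Sum>j<b. (n i \<omega> * n j \<omega>) * (T i \<omega> * T j \<omega>))"
      unfolding moment_sum.simps power2_eq_square sum_product n_def T_def by (simp add: mult_ac)
    also have "ennreal \<dots> = (\<Sum>i<b. \<Sum>j<b. ennreal ((n i \<omega> * n j \<omega>) * (T i \<omega> * T j \<omega>)))"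
      using nT by (simp add: sum_nonneg flip: sum_ennreal)
    finally show ?thesis
      using nT by (simp add: ennreal_mult)
  qed
  have meas: "(\<lambda>\<omega>. ennreal (n i \<omega> * n j \<omega>) * ennreal (T i \<omega> * T j \<omega>)) \<in> borel_measurable M"
    if "i < b" "j < b" for i j
  proof -
    have [measurable]: "n l \<in> borel_measurable M" "T l \<in> borel_measurable M" if "l < b" for l
      using measurable_compose[OF V_measurable[OF Suc.prems] coordinate_measurable[OF that]]
        S_measurable[OF wi[OF that]] unfolding n_def T_def by auto
    show ?thesis
      using that by measurable
  qed
  have term_le: "(\<integral>\<^sup>+\<omega>. ennreal (n i \<omega> * n j \<omega>) * ennreal (T i \<omega> * T j \<omega>) \<partial>M) \<le>
      ennreal ((if i = j then (\<integral>\<omega>. norm (W \<omega> i) ^ p \<partial>M) * (c * (\<mu> ^ N)\<^sup>2) else 0) + (\<mu> ^ N)\<^sup>2)"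
    if ij: "i < b" "j < b" for i j
  proof (cases "i = j")
    case True
    have "(\<integral>\<^sup>+\<omega>. ennreal (n i \<omega> * n i \<omega>) * (\<Prod>l\<in>{i}. ennreal ((T l \<omega>)\<^sup>2)) \<partial>M) =
        (\<integral>\<^sup>+\<omega>. ennreal (norm (W \<omega> i) ^ p * norm (W \<omega> i) ^ p) \<partial>M) * (\<Prod>l\<in>{i}. \<integral>\<^sup>+\<omega>. ennreal ((T l \<omega>)\<^sup>2) \<partial>M)"
      unfolding n_def T_def
      using ij Suc.prems coordinate_measurable[of i] measurable_moment_sum[OF order_refl]
      by (intro nn_integral_branch[where f = "\<lambda>x. ennreal (norm (x i) ^ p * norm (x i) ^ p)"
            and g = "\<lambda>l x. ennreal ((moment_sum b p N (w @ [l]) x)\<^sup>2)"])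
        (auto simp: moment_sum_restrict)
    then have "(\<integral>\<^sup>+\<omega>. ennreal (n i \<omega> * n i \<omega>) * ennreal (T i \<omega> * T i \<omega>) \<partial>M) =
        (\<integral>\<^sup>+\<omega>. ennreal (norm (W \<omega> i) ^ p * norm (W \<omega> i) ^ p) \<partial>M) * (\<integral>\<^sup>+\<omega>. ennreal ((T i \<omega>)\<^sup>2) \<partial>M)"
      by (simp add: power2_eq_square)
    also have "\<dots> \<le> ennreal (\<integral>\<omega>. norm (W \<omega> i) ^ p \<partial>M) * ennreal (c * (\<mu> ^ N)\<^sup>2)"
    proof (rule mult_mono)
      have "(\<integral>\<^sup>+\<omega>. ennreal (norm (W \<omega> i) ^ p * norm (W \<omega> i) ^ p) \<partial>M) \<le> (\<integral>\<^sup>+\<omega>. ennreal (norm (W \<omega> i) ^ p) \<partial>M)"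
      proof (rule nn_integral_mono_AE)
        show "AE \<omega> in M. ennreal (norm (W \<omega> i) ^ p * norm (W \<omega> i) ^ p) \<le> ennreal (norm (W \<omega> i) ^ p)"
          using weight_le_one
          by eventually_elim (use ij in \<open>auto intro!: ennreal_leI mult_left_le power_le_one\<close>)
      qed
      then show "(\<integral>\<^sup>+\<omega>. ennreal (norm (W \<omega> i) ^ p * norm (W \<omega> i) ^ p) \<partial>M) \<le> ennreal (\<integral>\<omega>. norm (W \<omega> i) ^ p \<partial>M)"
        using nn_integral_norm_power[OF ij(1)] by simp
      show "(\<integral>\<^sup>+\<omega>. ennreal ((T i \<omega>)\<^sup>2) \<partial>M) \<le> ennreal (c * (\<mu> ^ N)\<^sup>2)"
        unfolding T_def \<mu>_def by (rule Suc.IH[OF wi[OF ij(1)]])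
    qed auto
    also have "\<dots> = ennreal ((\<integral>\<omega>. norm (W \<omega> i) ^ p \<partial>M) * (c * (\<mu> ^ N)\<^sup>2))"
      using c0 by (intro ennreal_mult[symmetric]) auto
    also have "\<dots> \<le> ennreal ((if i = j then (\<integral>\<omega>. norm (W \<omega> i) ^ p \<partial>M) * (c * (\<mu> ^ N)\<^sup>2) else 0) + (\<mu> ^ N)\<^sup>2)"
      using True by (intro ennreal_leI) simp
    finally show ?thesis
      using True by simp
  next
    case False
    have "(\<integral>\<^sup>+\<omega>. ennreal (n i \<omega> * n j \<omega>) * (\<Prod>l\<in>{i, j}. ennreal (T l \<omega>)) \<partial>M) =
        (\<integral>\<^sup>+\<omega>. ennreal (norm (W \<omega> i) ^ p * norm (W \<omega> j) ^ p) \<partial>M) * (\<Prod>l\<in>{i, j}. \<integral>\<^sup>+\<omega>. ennreal (T l \<omega>) \<partial>M)"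
      unfolding n_def T_def
      using ij Suc.prems coordinate_measurable[of i] coordinate_measurable[of j] measurable_moment_sum[OF order_refl]
      by (intro nn_integral_branch[where f = "\<lambda>x. ennreal (norm (x i) ^ p * norm (x j) ^ p)"
            and g = "\<lambda>l x. ennreal (moment_sum b p N (w @ [l]) x)"])
        (auto simp: moment_sum_restrict)
    then have "(\<integral>\<^sup>+\<omega>. ennreal (n i \<omega> * n j \<omega>) * ennreal (T i \<omega> * T j \<omega>) \<partial>M) =
        (\<integral>\<^sup>+\<omega>. ennreal (norm (W \<omega> i) ^ p * norm (W \<omega> j) ^ p) \<partial>M) *
        ((\<integral>\<^sup>+\<omega>. ennreal (T i \<omega>) \<partial>M) * (\<integral>\<^sup>+\<omega>. ennreal (T j \<omega>) \<partial>M))"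
      using False nT by (simp add: ennreal_mult)
    also have "(\<integral>\<^sup>+\<omega>. ennreal (T i \<omega>) \<partial>M) * (\<integral>\<^sup>+\<omega>. ennreal (T j \<omega>) \<partial>M) = ennreal ((\<mu> ^ N)\<^sup>2)"
      unfolding T_def \<mu>_def first_moment[OF wi[OF ij(1)]] first_moment[OF wi[OF ij(2)]]
      using moment_nonneg by (simp add: power2_eq_square flip: ennreal_mult)
    also have "(\<integral>\<^sup>+\<omega>. ennreal (norm (W \<omega> i) ^ p * norm (W \<omega> j) ^ p) \<partial>M) \<le> (\<integral>\<^sup>+\<omega>. 1 \<partial>M)"
    proof (rule nn_integral_mono_AE)
      show "AE \<omega> in M. ennreal (norm (W \<omega> i) ^ p * norm (W \<omega> j) ^ p) \<le> 1"
        using weight_le_one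
        by eventually_elim (use ij in \<open>auto intro!: mult_le_one power_le_one\<close>)
    qed
    then have "(\<integral>\<^sup>+\<omega>. ennreal (norm (W \<omega> i) ^ p * norm (W \<omega> j) ^ p) \<partial>M) * ennreal ((\<mu> ^ N)\<^sup>2) \<le> 1 * ennreal ((\<mu> ^ N)\<^sup>2)"
      by (intro mult_right_mono) (auto simp: emeasure_space_1)
    finally show ?thesis
      using False by simp
  qed
  have "(\<integral>\<^sup>+\<omega>. ennreal ((S p (Suc N) w \<omega>)\<^sup>2) \<partial>M) =
      (\<Sum>i<b. \<Sum>j<b. \<integral>\<^sup>+\<omega>. ennreal (n i \<omega> * n j \<omega>) * ennreal (T i \<omega> * T j \<omega>) \<partial>M)"
  proof -
    have "(\<integral>\<^sup>+\<omega>. (\<Sum>i<b. \<Sum>j<b. ennreal (n i \<omega> * n j \<omega>) * ennreal (T i \<omega> * T j \<omega>)) \<partial>M) =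
        (\<Sum>i<b. \<integral>\<^sup>+\<omega>. (\<Sum>j<b. ennreal (n i \<omega> * n j \<omega>) * ennreal (T i \<omega> * T j \<omega>)) \<partial>M)"
      by (intro nn_integral_sum borel_measurable_sum meas) auto
    also have "\<dots> = (\<Sum>i<b. \<Sum>j<b. \<integral>\<^sup>+\<omega>. ennreal (n i \<omega> * n j \<omega>) * ennreal (T i \<omega> * T j \<omega>) \<partial>M)"
    proof (rule sum.cong[OF refl])
      fix i assume "i \<in> {..<b}"
      then show "(\<integral>\<^sup>+\<omega>. (\<Sum>j<b. ennreal (n i \<omega> * n j \<omega>) * ennreal (T i \<omega> * T j \<omega>)) \<partial>M) =
          (\<Sum>j<b. \<integral>\<^sup>+\<omega>. ennreal (n i \<omega> * n j \<omega>) * ennreal (T i \<omega> * T j \<omega>) \<partial>M)"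
        by (intro nn_integral_sum meas) auto
    qed
    finally show ?thesis
      unfolding square .
  qed
  also have "\<dots> \<le> (\<Sum>i<b. \<Sum>j<b. ennreal ((if i = j then (\<integral>\<omega>. norm (W \<omega> i) ^ p \<partial>M) * (c * (\<mu> ^ N)\<^sup>2) else 0) + (\<mu> ^ N)\<^sup>2))"
    by (intro sum_mono term_le) auto
  also have "\<dots> = ennreal (\<Sum>i<b. \<Sum>j<b. (if i = j then (\<integral>\<omega>. norm (W \<omega> i) ^ p \<partial>M) * (c * (\<mu> ^ N)\<^sup>2) else 0) + (\<mu> ^ N)\<^sup>2)"
  proof -
    have nonneg: "0 \<le> (if i = j then (\<integral>\<omega>. norm (W \<omega> i) ^ p \<partial>M) * (c * (\<mu> ^ N)\<^sup>2) else 0) + (\<mu> ^ N)\<^sup>2" for i j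
      using c0 by simp
    show ?thesis
      by (simp only: sum_ennreal nonneg sum_nonneg)
  qed
  also have "(\<Sum>i<b. \<Sum>j<b. (if i = j then (\<integral>\<omega>. norm (W \<omega> i) ^ p \<partial>M) * (c * (\<mu> ^ N)\<^sup>2) else 0) + (\<mu> ^ N)\<^sup>2) =
      \<mu> * (c * (\<mu> ^ N)\<^sup>2) + (real b)\<^sup>2 * (\<mu> ^ N)\<^sup>2"
    unfolding \<mu>_def moment_eq_sum[of p]
    by (simp add: sum.distrib sum.delta power2_eq_square mult.assoc flip: sum_distrib_right)
  also have "\<dots> = c * (\<mu> ^ Suc N)\<^sup>2"
  proof -
    have "\<mu> * (c * (\<mu> ^ N)\<^sup>2) + (real b)\<^sup>2 * (\<mu> ^ N)\<^sup>2 = (\<mu> * c + (real b)\<^sup>2) * (\<mu> ^ N)\<^sup>2"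
      by (simp add: algebra_simps)
    then show ?thesis
      unfolding c_eq by (simp add: power_mult_distrib)
  qed
  finally show ?case
    by (simp add: \<mu>_def)
qed

text \<open>A Paley-Zygmund estimate: a variable with second moment at most \<open>c\<close> times its squared mean exceeds half
  of the mean with probability at least \<open>1 / (4 c)\<close>.\<close>

lemma prob_moment_sum_large:
  assumes m: "moment p > 1" and w: "w \<in> lists {..<b}"
  defines "\<delta> \<equiv> 1 / (4 * ((real b)\<^sup>2 / ((moment p)\<^sup>2 - moment p)))"
  shows "0 < \<delta>" "\<delta> \<le> prob {\<omega> \<in> space M. moment p ^ N / 2 < S p N w \<omega>}"
proof -
  define c where "c = (real b)\<^sup>2 / ((moment p)\<^sup>2 - moment p)"
  define \<mu> where "\<mu> = moment p ^ N"
  have \<mu>: "\<mu> > 0"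
    using m by (simp add: \<mu>_def)
  have "(moment p)\<^sup>2 - moment p > 0"
    using m by (simp add: power2_eq_square)
  then have c: "c > 0"
    using b by (simp add: c_def)
  have \<delta>: "\<delta> = 1 / (4 * c)"
    by (simp add: \<delta>_def c_def)
  then show "0 < \<delta>"
    using c by simp
  define X where "X = S p N w"
  have X_meas [measurable]: "X \<in> borel_measurable M"
    unfolding X_def by (rule S_measurable[OF w])
  have X0: "X \<omega> \<ge> 0" for \<omega>
    by (simp add: X_def moment_sum_nonneg)
  have "integrable M X \<and> expectation X = \<mu>"
  proof (subst nn_integral_eq_integrable[symmetric])
    show "(\<integral>\<^sup>+\<omega>. ennreal (X \<omega>) \<partial>M) = ennreal \<mu>"
      unfolding X_def \<mu>_def by (rule first_moment[OF w])
  qed (use X0 \<mu> in auto)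
  then have X: "integrable M X" "expectation X = \<mu>"
    by auto
  have X2_nn: "(\<integral>\<^sup>+\<omega>. ennreal ((X \<omega>)\<^sup>2) \<partial>M) \<le> ennreal (c * \<mu>\<^sup>2)"
    unfolding X_def \<mu>_def c_def by (rule second_moment[OF m w])
  have X2_int: "integrable M (\<lambda>\<omega>. (X \<omega>)\<^sup>2)"
    using X2_nn by (intro integrableI_nonneg) (auto intro: le_less_trans)
  have X2: "expectation (\<lambda>\<omega>. (X \<omega>)\<^sup>2) \<le> c * \<mu>\<^sup>2"
    using X2_nn c by (intro integral_real_bounded) auto
  define A where "A = {\<omega> \<in> space M. \<mu> / 2 < X \<omega>}"
  have A_meas [measurable]: "A \<in> sets M"
    unfolding A_def by measurable
  have int_A: "integrable M (indicator A :: 'a \<Rightarrow> real)"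
    by (intro integrable_real_indicator) (auto simp: less_top[symmetric])
  have pointwise: "X \<omega> \<le> \<mu> / 2 + \<delta> / \<mu> * (X \<omega>)\<^sup>2 + \<mu> / (4 * \<delta>) * indicator A \<omega>" if "\<omega> \<in> space M" for \<omega>
  proof (cases "\<omega> \<in> A")
    case True
    \<comment> \<open>Completing the square; \<open>\<delta>\<close> is chosen such that the mean of the quadratic term becomes \<open>\<mu> / 4\<close>.\<close>
    have "0 \<le> \<delta> / \<mu> * (X \<omega> - \<mu> / (2 * \<delta>))\<^sup>2"
      using \<mu> \<open>0 < \<delta>\<close> by simp
    also have "\<dots> = \<delta> / \<mu> * (X \<omega>)\<^sup>2 + \<mu> / (4 * \<delta>) - X \<omega>"
      using \<mu> \<open>0 < \<delta>\<close> by (simp add: power2_eq_square field_simps)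
    finally show ?thesis
      using True \<mu> by simp
  next
    case False
    then have "X \<omega> \<le> \<mu> / 2"
      using that by (simp add: A_def)
    then show ?thesis
      using False \<mu> \<open>0 < \<delta>\<close> by (simp add: add_increasing2)
  qed
  have "expectation X \<le> expectation (\<lambda>\<omega>. \<mu> / 2 + \<delta> / \<mu> * (X \<omega>)\<^sup>2 + \<mu> / (4 * \<delta>) * indicator A \<omega>)"
  proof (rule integral_mono)
    show "integrable M (\<lambda>\<omega>. \<mu> / 2 + \<delta> / \<mu> * (X \<omega>)\<^sup>2 + \<mu> / (4 * \<delta>) * indicator A \<omega>)"
      by (intro Bochner_Integration.integrable_add integrable_mult_right X2_int int_A) simp
  qed (use X pointwise in auto)
  also have "\<dots> = \<mu> / 2 + \<delta> / \<mu> * expectation (\<lambda>\<omega>. (X \<omega>)\<^sup>2) + \<mu> / (4 * \<delta>) * prob A"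
    using X2_int int_A by (simp add: prob_space del: times_divide_eq_left times_divide_eq_right)
  also have "\<dots> \<le> \<mu> / 2 + \<delta> / \<mu> * (c * \<mu>\<^sup>2) + \<mu> / (4 * \<delta>) * prob A"
    using X2 \<mu> \<open>0 < \<delta>\<close> by (intro add_mono mult_left_mono) auto
  also have "\<delta> / \<mu> * (c * \<mu>\<^sup>2) = \<mu> / 4"
    using c \<mu> by (simp add: \<delta> power2_eq_square)
  finally have "\<mu> / 4 \<le> \<mu> / (4 * \<delta>) * prob A"
    unfolding X(2) by linarith
  then have "\<delta> \<le> prob A"
    using \<mu> \<open>0 < \<delta>\<close> by (simp add: field_simps)
  then show "\<delta> \<le> prob {\<omega> \<in> space M. moment p ^ N / 2 < S p N w \<omega>}"
    by (simp add: A_def X_def \<mu>_def)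
qed

section \<open>Almost sure divergence and summability of the power sums\<close>

text \<open>The bound is a natural number, so that the event is a countable combination of measurable ones.\<close>

definition bounded_moments :: "nat \<Rightarrow> nat list \<Rightarrow> (nat list \<Rightarrow> nat \<Rightarrow> complex) \<Rightarrow> bool" where
  "bounded_moments p w x \<longleftrightarrow> (\<exists>K::nat. \<forall>N. moment_sum b p N w x \<le> real K)"

lemma bounded_moments_restrict:
  "bounded_moments p w (restrict x (descendants b w)) = bounded_moments p w x"
  by (simp add: bounded_moments_def moment_sum_restrict)

lemma pred_bounded_moments:
  "Measurable.pred (PiM (descendants b w) (\<lambda>_. cvec_borel b)) (bounded_moments p w)"
proof -
  have [measurable]: "(\<lambda>x. moment_sum b p N w x) \<in> borel_measurable (PiM (descendants b w) (\<lambda>_. cvec_borel b))" for N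
    by (rule measurable_moment_sum) simp
  show ?thesis
    unfolding bounded_moments_def by measurable
qed

lemma bounded_moments_event:
  assumes "w \<in> lists {..<b}"
  shows "{\<omega> \<in> space M. bounded_moments p w (\<lambda>v. V v \<omega>)} \<in> sets M"
proof -
  have [measurable]: "(\<lambda>\<omega>. S p N w \<omega>) \<in> borel_measurable M" for N
    by (rule S_measurable[OF assms])
  show ?thesis
    unfolding bounded_moments_def by measurable
qed

text \<open>The means \<open>m\<^sup>N\<close> exceed any bound, and every power sum exceeds half of its mean with probability at least \<open>\<delta>\<close>.\<close>

lemma prob_bounded_moments_le:
  assumes m: "moment p > 1" and w: "w \<in> lists {..<b}"
  defines "\<delta> \<equiv> 1 / (4 * ((real b)\<^sup>2 / ((moment p)\<^sup>2 - moment p)))"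
  shows "prob {\<omega> \<in> space M. bounded_moments p w (\<lambda>v. V v \<omega>)} \<le> 1 - \<delta>"
proof -
  have [measurable]: "(\<lambda>\<omega>. S p N w \<omega>) \<in> borel_measurable M" for N
    by (rule S_measurable[OF w])
  define A where "A K = {\<omega> \<in> space M. \<forall>N. S p N w \<omega> \<le> real K}" for K :: nat
  have A_sets: "range A \<subseteq> sets M"
    unfolding A_def by auto
  have A_inc: "incseq A"
  proof (rule incseq_SucI)
    fix K
    show "A K \<subseteq> A (Suc K)"
      unfolding A_def by (auto intro: order_trans)
  qed
  have "prob (A K) \<le> 1 - \<delta>" for K
  proof -
    obtain N where N: "2 * real K < moment p ^ N"
      using real_arch_pow[OF m] by blast
    define E where "E = {\<omega> \<in> space M. moment p ^ N / 2 < S p N w \<omega>}"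
    have "E \<in> events"
      unfolding E_def by measurable
    have "A K \<subseteq> space M - E"
    proof
      fix \<omega> assume "\<omega> \<in> A K"
      then have "\<omega> \<in> space M" "S p N w \<omega> \<le> real K"
        by (auto simp: A_def)
      then show "\<omega> \<in> space M - E"
        using N by (simp add: E_def)
    qed
    then have "prob (A K) \<le> prob (space M - E)"
      using \<open>E \<in> events\<close> by (intro finite_measure_mono) auto
    also have "\<dots> = 1 - prob E"
      using \<open>E \<in> events\<close> by (rule prob_compl)
    also have "\<dots> \<le> 1 - \<delta>"
      using prob_moment_sum_large(2)[OF m w, of N] by (simp add: E_def \<delta>_def)
    finally show ?thesis .
  qed
  moreover have "(\<lambda>K. prob (A K)) \<longlonglongrightarrow> prob (\<Union>K. A K)"
    by (rule finite_Lim_measure_incseq[OF A_sets A_inc])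
  ultimately have "prob (\<Union>K. A K) \<le> 1 - \<delta>"
    by (intro LIMSEQ_le_const2) auto
  moreover have "{\<omega> \<in> space M. bounded_moments p w (\<lambda>v. V v \<omega>)} = (\<Union>K. A K)"
    unfolding bounded_moments_def A_def by blast
  ultimately show ?thesis by simp
qed

lemma bounded_moments_child:
  assumes "bounded_moments p w x" "i < b" "x w i \<noteq> 0"
  shows "bounded_moments p (w @ [i]) x"
proof -
  obtain K where K: "\<And>N. moment_sum b p N w x \<le> real K"
    using assms(1) unfolding bounded_moments_def by blast
  have pos: "norm (x w i) ^ p > 0"
    using assms(3) by simp
  have "moment_sum b p N (w @ [i]) x \<le> real (nat \<lceil>real K / norm (x w i) ^ p\<rceil>)" for N
  proof -
    have "norm (x w i) ^ p * moment_sum b p N (w @ [i]) x \<le> moment_sum b p (Suc N) w x"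
      unfolding moment_sum.simps
      by (rule member_le_sum[of i "{..<b}" "\<lambda>i. norm (x w i) ^ p * moment_sum b p N (w @ [i]) x"])
        (use assms(2) in \<open>auto simp: moment_sum_nonneg\<close>)
    also have "\<dots> \<le> real K" by (rule K)
    finally have "moment_sum b p N (w @ [i]) x \<le> real K / norm (x w i) ^ p"
      using pos by (simp add: field_simps)
    then show ?thesis by linarith
  qed
  then show ?thesis
    unfolding bounded_moments_def by blast
qed

lemma AE_nonzero:
  assumes "w \<in> lists {..<b}"
  shows "AE \<omega> in M. \<forall>i<b. V w \<omega> i \<noteq> 0"
proof -
  have "AE \<omega> in M. V w \<omega> i \<noteq> 0" if i: "i < b" for i
  proof (rule AE_copy[OF assms, where P = "\<lambda>x. x i \<noteq> 0"])
    have [measurable]: "(\<lambda>x. x i) \<in> borel_measurable (cvec_borel b)"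
      by (rule coordinate_measurable[OF i])
    show "Measurable.pred (cvec_borel b) (\<lambda>x. x i \<noteq> 0)"
      by measurable
    show "AE \<omega> in M. W \<omega> i \<noteq> 0"
      using weight_nonzero by eventually_elim (use i in blast)
  qed
  then have "AE \<omega> in M. \<forall>i\<in>{..<b}. V w \<omega> i \<noteq> 0"
    by (intro AE_finite_allI) auto
  then show ?thesis
    by eventually_elim simp
qed

text \<open>Since the weights do not vanish, bounded power sums at \<open>w\<close> are inherited by all children of \<open>w\<close>, and the
  children are independent.\<close>

lemma prob_bounded_moments_branch:
  assumes w: "w \<in> lists {..<b}"
  shows "prob {\<omega> \<in> space M. bounded_moments p w (\<lambda>v. V v \<omega>)} \<le>
    (\<Prod>i<b. prob {\<omega> \<in> space M. bounded_moments p (w @ [i]) (\<lambda>v. V v \<omega>)})"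
proof -
  let ?A = "\<lambda>w. {\<omega> \<in> space M. bounded_moments p w (\<lambda>v. V v \<omega>)}"
  define g :: "nat \<Rightarrow> (nat list \<Rightarrow> nat \<Rightarrow> complex) \<Rightarrow> ennreal"
    where "g i x = (if bounded_moments p (w @ [i]) x then 1 else 0)" for i x
  have wi: "w @ [i] \<in> lists {..<b}" if "i < b" for i
    using w that by auto
  have nn_g: "(\<integral>\<^sup>+\<omega>. g i (\<lambda>v. V v \<omega>) \<partial>M) = emeasure M (?A (w @ [i]))" if "i < b" for i
  proof -
    have "(\<integral>\<^sup>+\<omega>. g i (\<lambda>v. V v \<omega>) \<partial>M) = (\<integral>\<^sup>+\<omega>. indicator (?A (w @ [i])) \<omega> \<partial>M)"
      by (rule nn_integral_cong) (simp add: g_def)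
    then show ?thesis
      using bounded_moments_event[OF wi[OF that]] by simp
  qed
  have "emeasure M (?A w) = (\<integral>\<^sup>+\<omega>. indicator (?A w) \<omega> \<partial>M)"
    using bounded_moments_event[OF w] by simp
  also have "\<dots> \<le> (\<integral>\<^sup>+\<omega>. 1 * (\<Prod>i<b. g i (\<lambda>v. V v \<omega>)) \<partial>M)"
  proof (rule nn_integral_mono_AE)
    show "AE \<omega> in M. indicator (?A w) \<omega> \<le> 1 * (\<Prod>i<b. g i (\<lambda>v. V v \<omega>))"
      using AE_nonzero[OF w]
    proof eventually_elim
      case (elim \<omega>)
      show ?case
      proof (cases "\<omega> \<in> ?A w")
        case True
        then have "g i (\<lambda>v. V v \<omega>) = 1" if "i < b" for i
          using bounded_moments_child[of p w "\<lambda>v. V v \<omega>" i] elim that by (simp add: g_def)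
        then show ?thesis by (simp add: indicator_def)
      qed simp
    qed
  qed
  also have "\<dots> = (\<integral>\<^sup>+\<omega>. 1 \<partial>M) * (\<Prod>i<b. \<integral>\<^sup>+\<omega>. g i (\<lambda>v. V v \<omega>) \<partial>M)"
  proof (rule nn_integral_branch[where f = "\<lambda>_. 1", OF w order_refl])
    show "g i \<in> borel_measurable (PiM (descendants b (w @ [i])) (\<lambda>_. cvec_borel b))" for i
      unfolding g_def using pred_bounded_moments[where w = "w @ [i]" and p = p] by (intro measurable_If) auto
    show "g i (restrict x (descendants b (w @ [i]))) = g i x" for i x
      by (simp add: g_def bounded_moments_restrict)
  qed simp
  also have "\<dots> = (\<Prod>i<b. emeasure M (?A (w @ [i])))"
    using nn_g by (simp add: emeasure_space_1)
  also have "\<dots> = ennreal (\<Prod>i<b. prob (?A (w @ [i])))"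
    by (simp add: emeasure_eq_measure prod_ennreal)
  finally show ?thesis
    by (simp add: emeasure_eq_measure prod_nonneg)
qed

text \<open>A zero-one law: the bound \<open>1 - \<delta>\<close> for the probability of boundedness holds at every node, and passing to
  the children raises it to the power \<open>b \<ge> 2\<close>.\<close>

lemma AE_unbounded_moments:
  assumes m: "moment p > 1" and w: "w \<in> lists {..<b}"
  shows "AE \<omega> in M. \<forall>K::real. \<exists>N. K < S p N w \<omega>"
proof -
  let ?A = "\<lambda>w. {\<omega> \<in> space M. bounded_moments p w (\<lambda>v. V v \<omega>)}"
  define \<delta> where "\<delta> = 1 / (4 * ((real b)\<^sup>2 / ((moment p)\<^sup>2 - moment p)))"
  have \<delta>: "0 < \<delta>"
    using prob_moment_sum_large(1)[OF m w] by (simp add: \<delta>_def)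
  have base: "prob (?A w) \<le> 1 - \<delta>" if "w \<in> lists {..<b}" for w
    using prob_bounded_moments_le[OF m that] by (simp add: \<delta>_def)
  have \<delta>1: "0 \<le> 1 - \<delta>"
    using base[OF w] measure_nonneg[of M "?A w"] by linarith
  have power_bound: "prob (?A w) \<le> (1 - \<delta>) ^ Suc n" if "w \<in> lists {..<b}" for w n
    using that
  proof (induction n arbitrary: w)
    case 0
    then show ?case using base by simp
  next
    case (Suc n)
    have "prob (?A w) \<le> (\<Prod>i<b. prob (?A (w @ [i])))"
      by (rule prob_bounded_moments_branch[OF Suc.prems])
    also have "\<dots> \<le> (\<Prod>i<b. (1 - \<delta>) ^ Suc n)"
      using Suc by (intro prod_mono) auto
    also have "\<dots> = (1 - \<delta>) ^ (Suc n * b)"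
      by (simp only: power_mult prod_constant card_lessThan)
    also have "\<dots> \<le> (1 - \<delta>) ^ Suc (Suc n)"
    proof (rule power_decreasing)
      have "Suc n * 2 \<le> Suc n * b"
        using b by (rule mult_le_mono2)
      then show "Suc (Suc n) \<le> Suc n * b" by simp
    qed (use \<delta> \<delta>1 in auto)
    finally show ?case .
  qed
  have "(\<lambda>n. (1 - \<delta>) ^ Suc n) \<longlonglongrightarrow> 0"
    using \<delta> \<delta>1 by (intro LIMSEQ_Suc LIMSEQ_power_zero) auto
  then have "prob (?A w) \<le> 0"
    by (rule LIMSEQ_le_const) (use power_bound[OF w] in blast)
  then have "prob (?A w) = 0"
    using measure_nonneg[of M "?A w"] by linarith
  then have "AE \<omega> in M. \<omega> \<notin> ?A w"
    using bounded_moments_event[OF w] by (simp add: prob_eq_0)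
  then show ?thesis
    using AE_space
  proof eventually_elim
    case (elim \<omega>)
    then have unb: "\<exists>N. real K < S p N w \<omega>" for K :: nat
      unfolding bounded_moments_def by (simp add: not_le)
    show ?case
    proof
      fix K :: real
      show "\<exists>N. K < S p N w \<omega>"
        using unb[of "nat \<lceil>K\<rceil>"] by (meson le_less_trans real_nat_ceiling_ge)
    qed
  qed
qed

lemma AE_summable_moments:
  assumes p: "0 \<le> \<kappa>" "moment p * \<kappa> < 1"
  shows "AE \<omega> in M. summable (\<lambda>n. \<kappa> ^ n * S p n [] \<omega>)"
proof -
  have [measurable]: "(\<lambda>\<omega>. S p N [] \<omega>) \<in> borel_measurable M" for N
    by (rule S_measurable) simp
  have "(\<integral>\<^sup>+\<omega>. (\<Sum>n. ennreal (\<kappa> ^ n * S p n [] \<omega>)) \<partial>M) = (\<Sum>n. \<integral>\<^sup>+\<omega>. ennreal (\<kappa> ^ n * S p n [] \<omega>) \<partial>M)"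
    by (rule nn_integral_suminf) measurable
  also have "\<dots> = (\<Sum>n. ennreal ((moment p * \<kappa>) ^ n))"
  proof (rule suminf_cong)
    fix n
    have "(\<integral>\<^sup>+\<omega>. ennreal (\<kappa> ^ n * S p n [] \<omega>) \<partial>M) = ennreal (\<kappa> ^ n) * (\<integral>\<^sup>+\<omega>. ennreal (S p n [] \<omega>) \<partial>M)"
      using p(1) by (subst nn_integral_cmult[symmetric]) (auto simp: ennreal_mult moment_sum_nonneg)
    also have "\<dots> = ennreal ((moment p * \<kappa>) ^ n)"
      using p(1) moment_nonneg by (subst first_moment) (simp_all add: power_mult_distrib mult.commute flip: ennreal_mult)
    finally show "(\<integral>\<^sup>+\<omega>. ennreal (\<kappa> ^ n * S p n [] \<omega>) \<partial>M) = ennreal ((moment p * \<kappa>) ^ n)" .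
  qed
  also have "\<dots> = ennreal (\<Sum>n. (moment p * \<kappa>) ^ n)"
    using p moment_nonneg[of p] by (intro suminf_ennreal2 summable_geometric) auto
  also have "\<dots> < \<infinity>" by simp
  finally have "AE \<omega> in M. (\<Sum>n. ennreal (\<kappa> ^ n * S p n [] \<omega>)) \<noteq> \<infinity>"
    by (intro nn_integral_PInf_AE) auto
  then show ?thesis
  proof eventually_elim
    case (elim \<omega>)
    then show ?case
      using p(1) by (intro summable_suminf_not_top) (auto simp: moment_sum_nonneg)
  qed
qed

section \<open>The moments of the weights decrease to one\<close>

lemma moment_Suc_le: "moment (Suc p) \<le> moment p"
  unfolding moment_eq_sum
proof (rule sum_mono)
  fix i assume i: "i \<in> {..<b}"
  show "(\<integral>\<omega>. norm (W \<omega> i) ^ Suc p \<partial>M) \<le> (\<integral>\<omega>. norm (W \<omega> i) ^ p \<partial>M)"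
  proof (rule integral_mono_AE)
    show "AE \<omega> in M. norm (W \<omega> i) ^ Suc p \<le> norm (W \<omega> i) ^ p"
      using weight_le_one by eventually_elim (use i in \<open>auto intro!: mult_left_le_one_le\<close>)
  qed (use i integrable_norm_power in \<open>auto simp del: power_Suc\<close>)
qed

text \<open>For weights of modulus at most one the \<open>p\<close>-th powers dominate the next ones, so that equality in mean is
  equality almost surely. This excludes all moduli in \<open>(0, 1)\<close>.\<close>

lemma AE_norm_one_if_moments_agree:
  assumes "moment (Suc p) = moment p"
  shows "AE \<omega> in M. \<forall>i<b. norm (W \<omega> i) = 1"
proof -
  let ?f = "\<lambda>\<omega>. \<Sum>i<b. norm (W \<omega> i) ^ p - norm (W \<omega> i) ^ Suc p"
  have int: "integrable M ?f"
    by (intro Bochner_Integration.integrable_sum Bochner_Integration.integrable_diff integrable_norm_power) auto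
  have nonneg: "AE \<omega> in M. \<forall>i<b. 0 \<le> norm (W \<omega> i) ^ p - norm (W \<omega> i) ^ Suc p"
    using weight_le_one by eventually_elim (auto intro!: mult_left_le_one_le)
  have "expectation ?f = moment p - moment (Suc p)"
  proof -
    have "expectation ?f = (\<Sum>i<b. \<integral>\<omega>. norm (W \<omega> i) ^ p - norm (W \<omega> i) ^ Suc p \<partial>M)"
      by (intro Bochner_Integration.integral_sum Bochner_Integration.integrable_diff integrable_norm_power) auto
    also have "\<dots> = (\<Sum>i<b. (\<integral>\<omega>. norm (W \<omega> i) ^ p \<partial>M) - (\<integral>\<omega>. norm (W \<omega> i) ^ Suc p \<partial>M))"
      by (intro sum.cong refl Bochner_Integration.integral_diff integrable_norm_power) auto
    finally show ?thesis
      unfolding moment_eq_sum by (simp only: sum_subtractf)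
  qed
  then have "expectation ?f = 0"
    using assms by simp
  moreover have "AE \<omega> in M. 0 \<le> ?f \<omega>"
    using nonneg by eventually_elim (rule sum_nonneg, blast)
  ultimately have "AE \<omega> in M. ?f \<omega> = 0"
    using integral_nonneg_eq_0_iff_AE[OF int] by blast
  with nonneg weight_nonzero show ?thesis
  proof eventually_elim
    case (elim \<omega>)
    show ?case
    proof (intro allI impI)
      fix i assume i: "i < b"
      have "norm (W \<omega> i) ^ p - norm (W \<omega> i) ^ Suc p = 0"
        using elim(1,3) i by (subst (asm) sum_nonneg_eq_0_iff) auto
      then have "norm (W \<omega> i) ^ p * (1 - norm (W \<omega> i)) = 0"
        by (simp add: algebra_simps)
      then show "norm (W \<omega> i) = 1"
        using elim(2) i by simp
    qed
  qed
qed

lemma moment_gt_one: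
  assumes lim: "moment \<longlonglongrightarrow> 1"
  shows "moment p > 1"
proof (rule ccontr)
  assume "\<not> 1 < moment p"
  have "decseq moment"
    by (rule decseq_SucI) (rule moment_Suc_le)
  then have ge: "1 \<le> moment q" for q
    using lim by (rule decseq_ge)
  have "moment p = 1" "moment (Suc p) = 1"
    using ge[of p] ge[of "Suc p"] moment_Suc_le[of p] \<open>\<not> 1 < moment p\<close> by linarith+
  then have "AE \<omega> in M. \<forall>i<b. norm (W \<omega> i) = 1"
    by (intro AE_norm_one_if_moments_agree[of p]) simp
  then have "AE \<omega> in M. (\<Sum>i<b. norm (W \<omega> i) ^ p) = real b"
    by eventually_elim simp
  then have "moment p = expectation (\<lambda>_. real b)"
    unfolding moment_def using W_coordinate_measurable
    by (intro integral_cong_AE) auto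
  then show False
    using \<open>moment p = 1\<close> b by (simp add: prob_space)
qed

lemma phi_eq:
  assumes "moment p > 0"
  shows "phi M b W (real p) = ereal (- (ln (moment p) / ln (real b)))"
proof -
  have "AE \<omega> in M. ennreal (\<Sum>i<b. norm (W \<omega> i) powr real p) = ennreal (\<Sum>i<b. norm (W \<omega> i) ^ p)"
    using weight_nonzero by eventually_elim (simp add: powr_realpow)
  then have "(\<integral>\<^sup>+\<omega>. ennreal (\<Sum>i<b. norm (W \<omega> i) powr real p) \<partial>M) = (\<integral>\<^sup>+\<omega>. ennreal (\<Sum>i<b. norm (W \<omega> i) ^ p) \<partial>M)"
    by (rule nn_integral_cong_AE)
  also have "\<dots> = ennreal (moment p)"
    unfolding moment_def
    by (intro nn_integral_eq_integral Bochner_Integration.integrable_sum) (auto intro!: integrable_norm_power sum_nonneg)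
  finally show ?thesis
    using assms b by (simp add: phi_def eln_def)
qed

lemma moment_pos: "moment p > 0"
proof (rule ccontr)
  assume "\<not> 0 < moment p"
  then have "moment p = 0"
    using moment_nonneg[of p] by linarith
  have "(\<integral>\<omega>. norm (W \<omega> 0) ^ p \<partial>M) \<le> moment p"
    unfolding moment_eq_sum using b by (intro member_le_sum[of 0 "{..<b}" "\<lambda>i. \<integral>\<omega>. norm (W \<omega> i) ^ p \<partial>M"]) auto
  then have "(\<integral>\<omega>. norm (W \<omega> 0) ^ p \<partial>M) = 0"
    using \<open>moment p = 0\<close> by (intro antisym Bochner_Integration.integral_nonneg) auto
  then have "AE \<omega> in M. norm (W \<omega> 0) ^ p = 0"
    using integral_nonneg_eq_0_iff_AE[OF integrable_norm_power[of 0 p]] b by simp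
  with weight_nonzero have "AE \<omega> in M. False"
    by eventually_elim (use b in auto)
  then show False
    by simp
qed

lemma moment_tendsto_one:
  assumes "(phi M b W \<longlongrightarrow> 0) at_top"
  shows "moment \<longlonglongrightarrow> 1"
proof -
  have "(\<lambda>p. phi M b W (real p)) \<longlonglongrightarrow> 0"
    by (rule filterlim_compose[OF assms filterlim_real_sequentially])
  then have "(\<lambda>p. ereal (- (ln (moment p) / ln (real b)))) \<longlonglongrightarrow> ereal 0"
    using phi_eq[OF moment_pos] by (simp add: zero_ereal_def)
  then have "(\<lambda>p. - (ln (moment p) / ln (real b))) \<longlonglongrightarrow> 0"
    by (simp only: lim_ereal)
  then have "(\<lambda>p. exp (- (- (ln (moment p) / ln (real b)) * ln (real b)))) \<longlonglongrightarrow> exp (- (0 * ln (real b)))"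
    by (intro tendsto_intros)
  moreover have "exp (- (- (ln (moment p) / ln (real b)) * ln (real b))) = moment p" for p
    using b moment_pos[of p] by simp
  ultimately show ?thesis
    by simp
qed

end

section \<open>From the cascade to the time change\<close>

lemma word_weight_nonzero:
  assumes "\<forall>w\<in>lists {..<b}. \<forall>i<b. x w i \<noteq> 0" "w \<in> lists {..<b}" "v \<in> lists {..<b}"
  shows "word_weight x w v \<noteq> 0"
  using assms(3)
proof (induction v rule: rev_induct)
  case (snoc i v)
  then show ?case
    using assms(1,2) by (auto simp: word_weight_snoc)
qed simp

text \<open>Self-similarity reduces the bound for \<open>F\<close> on the interval of \<open>w\<close> to \<open>centred_partial_sums_bounded\<close> in the subtree
  at \<open>w\<close>, first at adic points and then, by continuity, everywhere.\<close>

lemma cascade_adic_increments: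
  fixes V :: "nat list \<Rightarrow> 'a \<Rightarrow> nat \<Rightarrow> complex" and \<gamma> :: real
  defines "x \<omega> w \<equiv> V w \<omega>"
  assumes b: "b \<ge> 2" and \<gamma>: "0 < \<gamma>" "\<gamma> < 1" and cons: "conservative b (x \<omega>)"
    and step: "\<forall>w\<in>lists {..<b}. \<forall>i<b. norm (x \<omega> w i) \<le> \<gamma> \<or>
      norm (x \<omega> w i) = 1 \<and> ((\<Sum>k<i. x \<omega> w k), (\<Sum>k\<le>i. x \<omega> w k)) \<in> {(0, 1), (1, 0)}"
    and cont: "continuous_on {0..1} (cascade_limit b V \<omega>)"
  shows "adic_increments b (cascade_limit b V \<omega>) (\<lambda>n j. word_weight (x \<omega>) [] (adic_word b n j))
    ((real b + 1) / (1 - \<gamma>) + 1 / 2)"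
proof
  define F where "F = cascade_limit b V \<omega>"
  define C where "C = (real b + 1) / (1 - \<gamma>) + 1 / 2"
  define q where "q n j = word_weight (x \<omega>) [] (adic_word b n j)" for n j
  have b0: "b > 0" using b by simp
  have F_adic: "F (real j / real b ^ n) = (\<Sum>l<j. q n l)" for n j
    using cascade_limit_at_adic_point[OF b0, where V = V and \<omega> = \<omega>] cons unfolding F_def q_def x_def by simp
  show "b \<ge> 2" by (rule b)
  show "0 \<le> (real b + 1) / (1 - \<gamma>) + 1 / 2"
    using \<gamma> by simp
  show "continuous_on {0..1} (cascade_limit b V \<omega>)"
    by (rule cont)
  show "cascade_limit b V \<omega> (real (Suc j) / real b ^ n) - cascade_limit b V \<omega> (real j / real b ^ n) =
      word_weight (x \<omega>) [] (adic_word b n j)" for j n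
    using F_adic[of "Suc j" n] F_adic[of j n] by (simp add: F_def q_def)
  fix j n :: nat and t :: real
  assume j: "j < b ^ n" and t: "real j / real b ^ n \<le> t" "t \<le> real (Suc j) / real b ^ n"
  have bn: "real b ^ m > 0" for m
    using b0 by simp
  have at_adic: "norm (F (real (j * b ^ k + i) / real b ^ (n + k)) - F (real j / real b ^ n)) \<le> C * norm (q n j)"
    if i: "i \<le> b ^ k" for i k
  proof -
    let ?w = "adic_word b n j"
    have w: "?w \<in> lists {..<b}"
      by (rule adic_word_in_lists[OF b0])
    have "(\<Sum>l<j * b ^ k + i. q (n + k) l) = (\<Sum>l<j * b ^ k. q (n + k) l) + (\<Sum>l<i. q (n + k) (j * b ^ k + l))"
      by (induction i) (auto simp: add.assoc)
    also have "(\<Sum>l<j * b ^ k. q (n + k) l) = (\<Sum>l<j. q n l)"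
      unfolding q_def by (rule sum_weight_refine[OF b0 cons]) simp
    also have "(\<Sum>l<i. q (n + k) (j * b ^ k + l)) = q n j * (\<Sum>l<i. word_weight (x \<omega>) ?w (adic_word b k l))"
      unfolding sum_distrib_left
    proof (rule sum.cong[OF refl])
      fix l assume "l \<in> {..<i}"
      then have "l < b ^ k" using i by simp
      then show "q (n + k) (j * b ^ k + l) = q n j * word_weight (x \<omega>) ?w (adic_word b k l)"
        unfolding q_def adic_word_append[OF b0 \<open>l < b ^ k\<close>] word_weight_append by simp
    qed
    finally have "F (real (j * b ^ k + i) / real b ^ (n + k)) - F (real j / real b ^ n) =
        q n j * (\<Sum>l<i. word_weight (x \<omega>) ?w (adic_word b k l))"
      unfolding F_adic by simp
    moreover have bound: "norm (\<Sum>l<i. word_weight (x \<omega>) ?w (adic_word b k l)) \<le> C"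
      using centred_partial_sums_bounded[OF b0 \<gamma> cons step w i]
        norm_triangle_ineq2[of "\<Sum>l<i. word_weight (x \<omega>) ?w (adic_word b k l)" "1 / 2"]
      by (simp add: C_def norm_divide)
    ultimately show ?thesis
      using mult_left_mono[OF bound norm_ge_zero[of "q n j"]] by (simp add: norm_mult mult.commute)
  qed
  define d where "d = t * real b ^ n - real j"
  have d: "0 \<le> d" "d \<le> 1"
    using t bn[of n] by (simp_all add: d_def field_simps)
  define i where "i k = nat \<lfloor>d * real b ^ k\<rfloor>" for k
  define u where "u k = real (j * b ^ k + i k) / real b ^ (n + k)" for k
  have i_le: "real (i k) \<le> d * real b ^ k" "d * real b ^ k \<le> real (i k) + 1" for k
    using d bn[of k] by (auto simp: i_def)
  have i_bound: "i k \<le> b ^ k" for k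
  proof -
    have "real (i k) \<le> 1 * real b ^ k"
      using i_le(1)[of k] d bn[of k] mult_right_mono[of d 1 "real b ^ k"] by linarith
    then have "real (i k) \<le> real (b ^ k)" by simp
    then show ?thesis by (simp only: of_nat_le_iff)
  qed
  have t_eq: "t = (real j * real b ^ k + d * real b ^ k) / real b ^ (n + k)" for k
    using bn[of n] bn[of k] by (simp add: d_def power_add field_simps)
  have u_le: "u k \<le> t" "t \<le> u k + (1 / real b) ^ k" for k
  proof -
    show "u k \<le> t"
      unfolding u_def t_eq[of k] using i_le(1)[of k] bn[of "n + k"] by (intro divide_right_mono) auto
    have "t \<le> (real j * real b ^ k + (real (i k) + 1)) / real b ^ (n + k)"
      unfolding t_eq[of k] using i_le(2)[of k] bn[of "n + k"] by (intro divide_right_mono) auto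
    also have "\<dots> = u k + 1 / real b ^ (n + k)"
      by (simp add: u_def add_divide_distrib)
    also have "1 / real b ^ (n + k) \<le> 1 / real b ^ k"
      using b by (intro divide_left_mono power_increasing) auto
    finally show "t \<le> u k + (1 / real b) ^ k"
      by (simp add: power_one_over)
  qed
  have u_lim: "u \<longlonglongrightarrow> t"
  proof (rule tendsto_sandwich)
    have "(\<lambda>k. t - (1 / real b) ^ k) \<longlonglongrightarrow> t - 0"
      using b by (intro tendsto_intros LIMSEQ_power_zero) auto
    then show "(\<lambda>k. t - (1 / real b) ^ k) \<longlonglongrightarrow> t" by simp
    show "eventually (\<lambda>k. t - (1 / real b) ^ k \<le> u k) sequentially"
      using u_le(2) by (intro always_eventually allI) (simp add: diff_le_eq)
    show "eventually (\<lambda>k. u k \<le> t) sequentially"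
      using u_le(1) by (intro always_eventually allI)
  qed simp
  have t01: "t \<in> {0..1}"
  proof -
    have "real (Suc j) \<le> real (b ^ n)"
      using j unfolding of_nat_le_iff by simp
    then have "real (Suc j) / real b ^ n \<le> 1"
      using bn[of n] by simp
    moreover have "0 \<le> real j / real b ^ n"
      using bn[of n] by simp
    ultimately show ?thesis
      using t unfolding atLeastAtMost_iff by linarith
  qed
  have u01: "u k \<in> {0..1}" for k
  proof -
    have "0 \<le> u k"
      using bn[of "n + k"] unfolding u_def by (intro divide_nonneg_pos) auto
    then show ?thesis
      using u_le(1)[of k] t01 unfolding atLeastAtMost_iff by linarith
  qed
  have "(\<lambda>k. F (u k)) \<longlonglongrightarrow> F t"
    using cont u_lim t01 u01 unfolding F_def continuous_on_sequentially by (auto simp: o_def)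
  then have "(\<lambda>k. norm (F (u k) - F (real j / real b ^ n))) \<longlonglongrightarrow> norm (F t - F (real j / real b ^ n))"
    by (intro tendsto_intros)
  then have "norm (F t - F (real j / real b ^ n)) \<le> C * norm (q n j)"
    by (rule LIMSEQ_le_const2) (use at_adic[OF i_bound] in \<open>auto simp: u_def\<close>)
  then show "norm (cascade_limit b V \<omega> t - cascade_limit b V \<omega> (real j / real b ^ n)) \<le>
      ((real b + 1) / (1 - \<gamma>) + 1 / 2) * norm (word_weight (x \<omega>) [] (adic_word b n j))"
    by (simp add: F_def C_def q_def)
qed

text \<open>The deterministic part of the theorem, with the properties of the realization as hypotheses.\<close>

lemma time_change_conclusion:
  fixes B :: "real \<Rightarrow> complex" and G :: "real \<Rightarrow> real"
  assumes incr: "adic_increments b F (\<lambda>n j. word_weight x [] (adic_word b n j)) C"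
    and nonzero: "\<forall>w\<in>lists {..<b}. \<forall>i<b. x w i \<noteq> 0"
    and unbounded: "\<And>w p K. w \<in> lists {..<b} \<Longrightarrow> \<exists>N. K < moment_sum b p N w x"
    and summable: "\<And>s. s > 0 \<Longrightarrow> \<exists>p>0. summable (\<lambda>n. real b powr (- real n * s / 2) * moment_sum b p n [] x)"
    and G: "continuous_on {0..1} G" "mono_on {0..1} G"
    and B: "continuous_on {G 0..G 1} B" "monofractal {G 0..G 1} B"
    and F_eq: "\<forall>t\<in>{0..1}. F t = B (G t)"
  shows "monofractal_exponent {G 0..G 1} B = 0 \<and> hausdorff_dim ({0..1} - upper_infinite_set {0..1} G) = 0"
proof -
  define q where "q n j = word_weight x [] (adic_word b n j)" for n j
  interpret adic_increments b F q C
    using incr unfolding q_def .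
  interpret time_change b F q C B G
    by unfold_locales (use G F_eq in auto)
  have b0: "b > 0" using b by simp
  define H where "H = monofractal_exponent {G 0..G 1} B"
  have H: "holder_exponent {G 0..G 1} B y = H" if "y \<in> {G 0..G 1}" for y
    unfolding H_def by (rule monofractal_exponent_eq[OF B(2,1) that])
  have "\<not> 0 < H"
  proof (rule exponent_not_positive[OF _ H])
    fix n j p :: nat and K :: real
    assume j: "j < b ^ n" "0 < p"
    let ?w = "adic_word b n j"
    have w: "?w \<in> lists {..<b}"
      by (rule adic_word_in_lists[OF b0])
    have "q n j \<noteq> 0"
      unfolding q_def by (rule word_weight_nonzero[OF nonzero _ w]) simp
    then have pos: "norm (q n j) ^ p > 0" by simp
    obtain N where N: "K / norm (q n j) ^ p < moment_sum b p N ?w x"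
      using unbounded[OF w] by blast
    have "(\<Sum>l<b ^ N. norm (q (n + N) (j * b ^ N + l)) ^ p) = norm (q n j) ^ p * moment_sum b p N ?w x"
      unfolding moment_sum_eq[OF b0] sum_distrib_left
    proof (rule sum.cong[OF refl])
      fix l assume "l \<in> {..<b ^ N}"
      then have l: "l < b ^ N" by simp
      show "norm (q (n + N) (j * b ^ N + l)) ^ p = norm (q n j) ^ p * norm (word_weight x ?w (adic_word b N l)) ^ p"
        unfolding q_def adic_word_append[OF b0 l] word_weight_append by (simp add: norm_mult power_mult_distrib)
    qed
    also have "\<dots> > K"
      using N pos by (simp add: divide_less_eq mult.commute)
    finally show "\<exists>N. K < (\<Sum>l<b ^ N. norm (q (n + N) (j * b ^ N + l)) ^ p)"
      by blast
  qed
  moreover have "G 0 \<in> {G 0..G 1}"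
    using G_in[of 0] by simp
  then have "0 \<le> H"
    using holder_exponent_nonneg[OF B(1)] H by metis
  ultimately have H0: "H = 0"
    by (meson antisym_conv not_less)
  have "hausdorff_dim ({0..1} - upper_infinite_set {0..1} G) = 0"
  proof (rule complement_of_upper_infinite_set_dim_zero)
    show "holder_exponent {G 0..G 1} B y = 0" if "y \<in> {G 0..G 1}" for y
      using H[OF that] H0 by simp
    show "\<exists>p>0. Series.summable (\<lambda>n. real b powr (- real n * s / 2) * (\<Sum>j<b ^ n. norm (q n j) ^ p))" if "s > 0" for s
      using summable[OF that] unfolding moment_sum_eq[OF b0] q_def .
  qed
  with H0 show ?thesis
    by (simp add: H_def)
qed

section \<open>Properties of almost every realization\<close>

context cascade_weights
begin

lemma AE_conservative:
  assumes "AE \<omega> in M. (\<Sum>i<b. W \<omega> i) = 1"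
  shows "AE \<omega> in M. conservative b (\<lambda>w. V w \<omega>)"
  unfolding conservative_def
proof (subst AE_ball_countable)
  show "\<forall>w\<in>lists {..<b}. AE \<omega> in M. (\<Sum>i<b. V w \<omega> i) = 1"
  proof
    fix w assume w: "w \<in> lists {..<b}"
    show "AE \<omega> in M. (\<Sum>i<b. V w \<omega> i) = 1"
    proof (rule AE_copy[OF w _ assms])
      have [measurable]: "(\<lambda>x. \<Sum>i<b. x i) \<in> borel_measurable (cvec_borel b)"
        by (intro borel_measurable_sum coordinate_measurable) simp
      show "Measurable.pred (cvec_borel b) (\<lambda>x. (\<Sum>i<b. x i) = 1)"
        by measurable
    qed
  qed
qed (simp add: countable_lists)

lemma AE_steps:
  assumes "AE \<omega> in M. \<forall>i<b. norm (W \<omega> i) \<le> \<gamma> \<or>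
      norm (W \<omega> i) = 1 \<and> ((\<Sum>k<i. W \<omega> k), (\<Sum>k\<le>i. W \<omega> k)) \<in> {(0, 1), (1, 0)}"
  shows "AE \<omega> in M. \<forall>w\<in>lists {..<b}. \<forall>i<b. norm (V w \<omega> i) \<le> \<gamma> \<or>
      norm (V w \<omega> i) = 1 \<and> ((\<Sum>k<i. V w \<omega> k), (\<Sum>k\<le>i. V w \<omega> k)) \<in> {(0, 1), (1, 0)}"
proof (subst AE_ball_countable)
  let ?P = "\<lambda>i x. norm (x i) \<le> \<gamma> \<or> norm (x i) = 1 \<and> ((\<Sum>k<i. x k), (\<Sum>k\<le>i. x k)) \<in> {(0, 1), (1, 0)}"
  show "\<forall>w\<in>lists {..<b}. AE \<omega> in M. \<forall>i<b. ?P i (V w \<omega>)"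
  proof
    fix w assume w: "w \<in> lists {..<b}"
    have "AE \<omega> in M. ?P i (V w \<omega>)" if i: "i < b" for i
    proof (rule AE_copy[OF w])
      have [measurable]: "(\<lambda>x. x i) \<in> borel_measurable (cvec_borel b)"
        "(\<lambda>x. \<Sum>k<i. x k) \<in> borel_measurable (cvec_borel b)"
        "(\<lambda>x. \<Sum>k\<le>i. x k) \<in> borel_measurable (cvec_borel b)"
        using i by (auto intro!: borel_measurable_sum coordinate_measurable)
      show "Measurable.pred (cvec_borel b) (?P i)"
        unfolding insert_iff empty_iff prod.inject by measurable
      show "AE \<omega> in M. ?P i (W \<omega>)"
        using assms by eventually_elim (use i in blast)
    qed
    then have "AE \<omega> in M. \<forall>i\<in>{..<b}. ?P i (V w \<omega>)"
      by (intro AE_finite_allI) auto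
    then show "AE \<omega> in M. \<forall>i<b. ?P i (V w \<omega>)"
      by eventually_elim simp
  qed
qed (simp add: countable_lists)

lemma AE_all_nonzero: "AE \<omega> in M. \<forall>w\<in>lists {..<b}. \<forall>i<b. V w \<omega> i \<noteq> 0"
  by (subst AE_ball_countable) (auto simp: countable_lists intro: AE_nonzero)

lemma AE_all_unbounded:
  assumes "moment \<longlonglongrightarrow> 1"
  shows "AE \<omega> in M. \<forall>w\<in>lists {..<b}. \<forall>p. \<forall>K::real. \<exists>N. K < S p N w \<omega>"
proof (subst AE_ball_countable)
  show "\<forall>w\<in>lists {..<b}. AE \<omega> in M. \<forall>p. \<forall>K::real. \<exists>N. K < S p N w \<omega>"
    using AE_unbounded_moments[OF moment_gt_one[OF assms]] by (simp add: AE_all_countable)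
qed (simp add: countable_lists)

text \<open>For fixed \<open>s\<close> one needs \<open>m(p) < b\<^bsup>s / 2\<^esup>\<close>, which holds for large \<open>p\<close> because \<open>m(p)\<close> tends to 1. The terms
  decrease in \<open>s\<close>, so it suffices to treat the values \<open>1 / (l + 1)\<close>.\<close>

lemma AE_all_summable:
  assumes lim: "moment \<longlonglongrightarrow> 1"
  shows "AE \<omega> in M. \<forall>s>0. \<exists>p>0. summable (\<lambda>n. real b powr (- real n * s / 2) * S p n [] \<omega>)"
proof -
  have ex: "\<exists>p>0. AE \<omega> in M. summable (\<lambda>n. (real b powr (- 1 / (2 * real (Suc l)))) ^ n * S p n [] \<omega>)" for l :: nat
  proof -
    define \<kappa> where "\<kappa> = real b powr (- 1 / (2 * real (Suc l)))"
    have "\<kappa> < 1"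
      using b powr_less_mono[of "- 1 / (2 * real (Suc l))" 0 "real b"] by (simp add: \<kappa>_def)
    moreover have "(\<lambda>p. moment p * \<kappa>) \<longlonglongrightarrow> 1 * \<kappa>"
      by (intro tendsto_intros lim)
    ultimately have "eventually (\<lambda>p. moment p * \<kappa> < 1) sequentially"
      by (intro order_tendstoD(2)) auto
    then have "eventually (\<lambda>p. moment p * \<kappa> < 1 \<and> 0 < p) sequentially"
      by (intro eventually_conj eventually_gt_at_top)
    then obtain p where "moment p * \<kappa> < 1" "0 < p"
      by (auto simp: eventually_sequentially)
    then show ?thesis
      using AE_summable_moments[of \<kappa> p] unfolding \<kappa>_def by (intro exI[of _ p]) auto
  qed
  have "\<exists>P. \<forall>l. P l > 0 \<and> (AE \<omega> in M. summable (\<lambda>n. (real b powr (- 1 / (2 * real (Suc l)))) ^ n * S (P l) n [] \<omega>))"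
    by (rule choice, rule allI, rule ex)
  then obtain P where *: "\<forall>l. P l > 0 \<and> (AE \<omega> in M. summable (\<lambda>n. (real b powr (- 1 / (2 * real (Suc l)))) ^ n * S (P l) n [] \<omega>))"
    by (elim exE)
  have P: "P l > 0"
    "AE \<omega> in M. summable (\<lambda>n. (real b powr (- 1 / (2 * real (Suc l)))) ^ n * S (P l) n [] \<omega>)" for l
    by (rule conjunct1[OF spec[OF *]], rule conjunct2[OF spec[OF *]])
  have "AE \<omega> in M. \<forall>l. summable (\<lambda>n. (real b powr (- 1 / (2 * real (Suc l)))) ^ n * S (P l) n [] \<omega>)"
    using P(2) by (simp add: AE_all_countable)
  then show ?thesis
  proof eventually_elim
    case (elim \<omega>)
    show ?case
    proof (intro allI impI)
      fix s :: real assume "s > 0"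
      then obtain l where l: "1 / real (Suc l) < s"
        using nat_approx_posE by blast
      have "summable (\<lambda>n. real b powr (- real n * s / 2) * S (P l) n [] \<omega>)"
      proof (rule summable_comparison_test)
        show "summable (\<lambda>n. (real b powr (- 1 / (2 * real (Suc l)))) ^ n * S (P l) n [] \<omega>)"
          using elim by blast
        have "norm (real b powr (- real n * s / 2) * S (P l) n [] \<omega>) \<le>
            (real b powr (- 1 / (2 * real (Suc l)))) ^ n * S (P l) n [] \<omega>" for n
        proof -
          have "real n * (1 / real (Suc l)) \<le> real n * s"
            using l by (intro mult_left_mono) auto
          then have "- real n * s / 2 \<le> real n * (- 1 / (2 * real (Suc l)))"
            by (simp add: field_simps)
          then have "real b powr (- real n * s / 2) \<le> real b powr (real n * (- 1 / (2 * real (Suc l))))"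
            using b by (intro powr_mono) auto
          also have "\<dots> = (real b powr (- 1 / (2 * real (Suc l)))) ^ n"
            using b by (simp add: powr_power mult.commute)
          finally have "real b powr (- real n * s / 2) \<le> (real b powr (- 1 / (2 * real (Suc l)))) ^ n" .
          then show ?thesis
            by (simp add: abs_mult moment_sum_nonneg mult_right_mono)
        qed
        then show "\<exists>N. \<forall>n\<ge>N. norm (real b powr (- real n * s / 2) * S (P l) n [] \<omega>) \<le>
            (real b powr (- 1 / (2 * real (Suc l)))) ^ n * S (P l) n [] \<omega>"
          by blast
      qed
      then show "\<exists>p>0. summable (\<lambda>n. real b powr (- real n * s / 2) * S p n [] \<omega>)"
        using P(1) by blast
    qed
  qed
qed

end

section \<open>Decompositions of the cascade limit\<close>

theorem theorem2p4:
  fixes M :: "'a measure" and b :: nat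
    and W :: "'a \<Rightarrow> nat \<Rightarrow> complex"
    and V :: "nat list \<Rightarrow> 'a \<Rightarrow> nat \<Rightarrow> complex"
  assumes "prob_space M"
    and "b \<ge> 2"
    and "W \<in> measurable M (cvec_borel b)"
    and "\<And>i. i < b \<Longrightarrow> integrable M (\<lambda>\<omega>. W \<omega> i)"
    and "(\<integral>\<omega>. (\<Sum>i<b. W \<omega> i) \<partial>M) = 1"
    and "independent_copies M b W V"
    and "measure M {\<omega> \<in> space M. (\<Sum>i<b. W \<omega> i) = 1} = 1"
    and "(phi M b W \<longlongrightarrow> 0) at_top"
    and "measure M {\<omega> \<in> space M. card {i. i < b \<and> norm (W \<omega> i) = 1} = 1} < 1"
    and "\<exists>\<gamma>\<in>{0<..<1}. AE \<omega> in M. \<forall>i<b.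
           norm (W \<omega> i) \<le> \<gamma> \<or>
           norm (W \<omega> i) = 1 \<and> ((\<Sum>k<i. W \<omega> k), (\<Sum>k\<le>i. W \<omega> k)) \<in> {(0, 1), (1, 0)}"
    and "AE \<omega> in M. \<forall>i<b. W \<omega> i \<noteq> 0"
  shows "AE \<omega> in M. \<forall>(B :: real \<Rightarrow> complex) (G :: real \<Rightarrow> real).
           continuous_on {0..1} G \<and> mono_on {0..1} G \<and> multifractal {0..1} G \<and> G 0 = 0 \<and>
           continuous_on {G 0..G 1} B \<and> monofractal {G 0..G 1} B \<and>
           (\<forall>t\<in>{0..1}. cascade_limit b V \<omega> t = B (G t))
           \<longrightarrow> monofractal_exponent {G 0..G 1} B = 0 \<and>
               hausdorff_dim ({0..1} - upper_infinite_set {0..1} G) = 0"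
proof -
  interpret prob_space M by fact
  obtain \<gamma> where \<gamma>: "0 < \<gamma>" "\<gamma> < 1" and step: "AE \<omega> in M. \<forall>i<b. norm (W \<omega> i) \<le> \<gamma> \<or>
      norm (W \<omega> i) = 1 \<and> ((\<Sum>k<i. W \<omega> k), (\<Sum>k\<le>i. W \<omega> k)) \<in> {(0, 1), (1, 0)}"
    using assms(10) by auto
  interpret cascade_weights M b W V
  proof
    show "AE \<omega> in M. \<forall>i<b. norm (W \<omega> i) \<le> 1"
      using step by eventually_elim (use \<gamma> in force)
  qed fact+
  have sum_meas [measurable]: "(\<lambda>\<omega>. \<Sum>i<b. W \<omega> i) \<in> borel_measurable M"
    by (intro borel_measurable_sum W_coordinate_measurable) simp
  have "{\<omega> \<in> space M. (\<Sum>i<b. W \<omega> i) = 1} \<in> events"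
    by measurable
  then have sum_one: "AE \<omega> in M. (\<Sum>i<b. W \<omega> i) = 1"
    using assms(7) by (simp add: prob_Collect_eq_1)
  have lim: "moment \<longlonglongrightarrow> 1"
    by (rule moment_tendsto_one) fact
  show ?thesis
    using AE_conservative[OF sum_one] AE_steps[OF step] AE_all_nonzero AE_all_unbounded[OF lim] AE_all_summable[OF lim]
  proof eventually_elim
    case (elim \<omega>)
    show ?case
    proof (intro allI impI, elim conjE)
      fix B :: "real \<Rightarrow> complex" and G :: "real \<Rightarrow> real"
      assume G: "continuous_on {0..1} G" "mono_on {0..1} G"
        and B: "continuous_on {G 0..G 1} B" "monofractal {G 0..G 1} B"
        and F_eq: "\<forall>t\<in>{0..1}. cascade_limit b V \<omega> t = B (G t)"
      have "G ` {0..1} \<subseteq> {G 0..G 1}"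
        using mono_onD[OF G(2)] by auto
      then have "continuous_on {0..1} (\<lambda>t. B (G t))"
        by (rule continuous_on_compose2[OF B(1) G(1)])
      then have "continuous_on {0..1} (cascade_limit b V \<omega>)"
        by (subst continuous_on_cong[OF refl, of _ _ "\<lambda>t. B (G t)"]) (use F_eq in auto)
      then have incr: "adic_increments b (cascade_limit b V \<omega>)
          (\<lambda>n j. word_weight (\<lambda>w. V w \<omega>) [] (adic_word b n j)) ((real b + 1) / (1 - \<gamma>) + 1 / 2)"
        by (intro cascade_adic_increments[OF b \<gamma>, where V = V and \<omega> = \<omega>] elim(1,2))
      show "monofractal_exponent {G 0..G 1} B = 0 \<and>
          hausdorff_dim ({0..1} - upper_infinite_set {0..1} G) = 0"
        by (rule time_change_conclusion[OF incr elim(3) _ _ G B F_eq]) (use elim(4,5) in blast)+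
    qed
  qed
qed

end
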